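(* Let $\Pi\in\mathcal P_\infty$. Then for each one of the following conditions separately there exists a kernel $W$ with $\Pi_W=\Pi$ satisfying that condition: (i) $W$ is a strict kernel; (ii) $W$ is a kernel on an ordered probability space of the form $([0,1],\mathcal B,\lambda,\prec)$, where $\mathcal B$ is the Borel $\sigma$-field, $\lambda$ is Lebesgue measure and $\prec$ is some measurable strict partial order on $[0,1]$ (not necessarily the standard order); (iii) $W$ is a kernel on the ordered probability space $[0,1]^2$ with Lebesgue measure (on Borel sets) and the order $(x_1,y_1)\prec(x_2,y_2)$ iff $x_1<x_2$.
   Context: A poset is a nonempty set with a strict partial order $<$. For finite posets $Q,P$, $t(Q,P)$ is the proportion of all maps $\varphi$ from the ground set of $Q$ to that of $P$ with $x<_Qy\Rightarrow\varphi(x)<_P\varphi(y)$. Let $\mathcal P$ be the set of isomorphism classes of finite nonempty posets; identify $\mathcal P$ with its (injective) image under $P\mapsto((t(Q,P))_{Q\in\mathcal P},|P|^{-1})\in[0,1]^{\mathcal P}\times[0,1]$, let $\overline{\mathcal P}$ be the closure (product topology) and $\mathcal P_\infty=\overline{\mathcal P}\setminus\mathcal P$. The functions $t(Q,\cdot)$ extend continuously to $\overline{\mathcal P}$, and an element of $\mathcal P_\infty$ is determined by the values $t(Q,\cdot)$. An ordered probability space $(\mathcal S,\mathcal F,\mu,\prec)$ is a probability space with a strict partial order $\prec$ such that $\{(x,y):x\prec y\}\in\mathcal F\times\mathcal F$. A kernel on it is a measurable $W:\mathcal S^2\to[0,1]$ such that for all $x,y,z$: $W(x,y)>0\Rightarrow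 x\prec y$, and ($W(x,y)>0$, $W(y,z)>0$) $\Rightarrow W(x,z)=1$. A strict kernel is a kernel with $W(x,y)>0\iff x\prec y$. For a kernel $W$, $\Pi_W$ denotes the element of $\mathcal P_\infty$ with $t(Q,\Pi_W)=\int\prod_{(i,j):i<_Qj}W(x_i,x_j)\,d\mu(x_1)\cdots d\mu(x_{|Q|})$ for all finite posets $Q$ on $\{1,\dots,|Q|\}$. *)

theory Defs
  imports "HOL-Probability.Probability"
begin

text \<open>A finite nonempty poset is coded as (n, R) with ground set {0..<n} and strict order R.\<close>
type_synonym pcode = "nat \<times> (nat \<times> nat) set"

definition valid_poset :: "pcode \<Rightarrow> bool" where
  "valid_poset P \<longleftrightarrow> 0 < fst P \<and> snd P \<subseteq> {0..<fst P} \<times> {0..<fst P}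
     \<and> irrefl (snd P) \<and> trans (snd P)"

definition hom_dens :: "pcode \<Rightarrow> pcode \<Rightarrow> real" where
  "hom_dens Q P = real (card {f \<in> {0..<fst Q} \<rightarrow>\<^sub>E {0..<fst P}.
       \<forall>(i,j) \<in> snd Q. (f i, f j) \<in> snd P}) / real (fst P) ^ fst Q"

text \<open>The embedding of finite posets into [0,1]^(posets) \<times> [0,1]; coordinates of
  non-poset codes are set to 0 (they carry no information).\<close>
definition profile :: "pcode \<Rightarrow> (pcode \<Rightarrow> real) \<times> real" where
  "profile P = ((\<lambda>Q. if valid_poset Q then hom_dens Q P else 0), 1 / real (fst P))"

definition Pbar :: "((pcode \<Rightarrow> real) \<times> real) set" where
  "Pbar = closure (profile ` {P. valid_poset P})"

definition Pinf :: "((pcode \<Rightarrow> real) \<times> real) set" where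
  "Pinf = Pbar - profile ` {P. valid_poset P}"

definition ordered_prob_space :: "'a measure \<Rightarrow> ('a \<Rightarrow> 'a \<Rightarrow> bool) \<Rightarrow> bool" where
  "ordered_prob_space M lt \<longleftrightarrow> prob_space M
     \<and> (\<forall>x\<in>space M. \<not> lt x x)
     \<and> (\<forall>x\<in>space M. \<forall>y\<in>space M. \<forall>z\<in>space M. lt x y \<longrightarrow> lt y z \<longrightarrow> lt x z)
     \<and> {(x,y) \<in> space M \<times> space M. lt x y} \<in> sets (M \<Otimes>\<^sub>M M)"

definition is_kernel :: "'a measure \<Rightarrow> ('a \<Rightarrow> 'a \<Rightarrow> bool) \<Rightarrow> ('a \<Rightarrow> 'a \<Rightarrow> real) \<Rightarrow> bool" where
  "is_kernel M lt W \<longleftrightarrow> ordered_prob_space M lt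
     \<and> (\<lambda>(x,y). W x y) \<in> borel_measurable (M \<Otimes>\<^sub>M M)
     \<and> (\<forall>x\<in>space M. \<forall>y\<in>space M. 0 \<le> W x y \<and> W x y \<le> 1)
     \<and> (\<forall>x\<in>space M. \<forall>y\<in>space M. W x y > 0 \<longrightarrow> lt x y)
     \<and> (\<forall>x\<in>space M. \<forall>y\<in>space M. \<forall>z\<in>space M. W x y > 0 \<longrightarrow> W y z > 0 \<longrightarrow> W x z = 1)"

definition strict_kernel :: "'a measure \<Rightarrow> ('a \<Rightarrow> 'a \<Rightarrow> bool) \<Rightarrow> ('a \<Rightarrow> 'a \<Rightarrow> real) \<Rightarrow> bool" where
  "strict_kernel M lt W \<longleftrightarrow> is_kernel M lt W
     \<and> (\<forall>x\<in>space M. \<forall>y\<in>space M. W x y > 0 \<longleftrightarrow> lt x y)"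

definition kernel_dens :: "'a measure \<Rightarrow> ('a \<Rightarrow> 'a \<Rightarrow> real) \<Rightarrow> pcode \<Rightarrow> real" where
  "kernel_dens M W Q = (\<integral>x. (\<Prod>(i,j)\<in>snd Q. W (x i) (x j)) \<partial>(PiM {0..<fst Q} (\<lambda>_. M)))"

text \<open>Pi_W = p  (elements of P_infinity are determined by their t-values).\<close>
definition represents :: "'a measure \<Rightarrow> ('a \<Rightarrow> 'a \<Rightarrow> real) \<Rightarrow> (pcode \<Rightarrow> real) \<times> real \<Rightarrow> bool" where
  "represents M W p \<longleftrightarrow> (\<forall>Q. valid_poset Q \<longrightarrow> fst p Q = kernel_dens M W Q)"

definition unit_interval_space :: "real measure" where
  "unit_interval_space = restrict_space lborel {0..1}"

definition unit_square_space :: "(real \<times> real) measure" where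
  "unit_square_space = restrict_space lborel ({0..1} \<times> {0..1})"

end

theory Submission
  imports Defs "HOL-Complex_Analysis.Great_Picard"
begin

text \<open>
  A point of the closure is a limit of densities in finite posets \<open>P\<^sub>n\<close>. Greedily refining partitions of
  each \<open>P\<^sub>n\<close> makes the energy of the block averages converge, so at suitable levels the relation is close
  in cut norm to its block averages and the counting lemma applies. Along a subsequence all block masses and block
  densities converge; laying out the limit blocks as nested intervals in \<open>[0,1]\<close> gives step functions that
  form an \<open>L\<^sup>2\<close>-bounded martingale, whose \<open>L\<^sup>1\<close>-limit \<open>W\<close> has the required densities.
  Comparing the path with the chain on three vertices, and using that the directed 3-cycle has density 0, \<open>W\<close>
  satisfies the kernel conditions almost everywhere. Redefining \<open>x \<prec> y\<close> to mean that \<open>{W > 0}\<close> has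
  density tending to 1 in the blocks around \<open>(x, y)\<close> makes them hold everywhere; this settles (i) and (ii) on
  \<open>[0,1]\<close> itself. For (iii), almost all related pairs are strictly ordered by the measure of their
  down-sets, and the joint law of this rank and the point is transported to the unit square by a monotone quantile
  in the first coordinate and a conditional quantile in the second.
\<close>

section \<open>Posets converging to a point of the closure\<close>

text \<open>The partitions must be nested, with a number of blocks depending on the level alone;
  otherwise neither the diagonal subsequence nor the martingale would be available. Hence every
  refinement splits each block into exactly four labelled children, possibly empty. The price is
  that no single level is known to be good for all n: the energy increment is small only at some
  level of each window, and that level varies with n. For each Q this leaves only arbitrarily high
  levels at which the limit block density is close to the target, which suffices since the densities
  of the step functions converge along the full sequence. The 2-cycle would be the natural
  certificate of antisymmetry, but the cut norm does not control two edges on one pair of vertices;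
  the 3-cycle avoids this. Block densities, unlike an almost everywhere class, have a value at every
  point, so an inequality integrated over three blocks becomes a statement about every triple of
  points. In (iii) the rank alone forgets which point it came from; the second coordinate restores
  the point through its conditional law given the rank.\<close>

lemma countable_valid_poset: "countable {Q. valid_poset Q}"
proof -
  have "{Q. valid_poset Q} \<subseteq> Sigma UNIV (\<lambda>n. Pow ({0..<n} \<times> {0..<n}))"
    by (auto simp: valid_poset_def)
  moreover have "countable (Sigma UNIV (\<lambda>n::nat. Pow ({0..<n} \<times> {0..<n})))"
    by (rule countable_SIGMA) (auto intro: countable_finite)
  ultimately show ?thesis by (rule countable_subset)
qed

lemma valid_poset_point: "valid_poset (1, {})"
  by (auto simp: valid_poset_def irrefl_def trans_def)

text \<open>The index type \<open>pcode\<close> is uncountable, so points of a closure in this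
  product space need not be limits of sequences for topological reasons alone. Only the countably
  many valid codes matter: the n-th poset is chosen to match the first n densities up to
  \<open>1 / real (Suc n)\<close>.\<close>

lemma Pbar_imp_convergent_posets:
  assumes "p \<in> Pbar"
  obtains P where "\<And>n::nat. valid_poset (P n)"
    "\<And>Q. valid_poset Q \<Longrightarrow> (\<lambda>n. hom_dens Q (P n)) \<longlonglongrightarrow> fst p Q"
proof -
  define q where "q = from_nat_into {Q. valid_poset Q}"
  have q: "valid_poset (q i)" for i
    using from_nat_into[of "{Q. valid_poset Q}" i] valid_poset_point by (auto simp: q_def)
  have surj: "\<exists>i. Q = q i" if "valid_poset Q" for Q
    using that from_nat_into_surj[OF countable_valid_poset, of Q] by (auto simp: q_def)
  have "\<exists>P. valid_poset P \<and> (\<forall>i<n. \<bar>hom_dens (q i) P - fst p (q i)\<bar> < 1 / real (Suc n))" for n :: nat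
  proof -
    \<comment> \<open>Only finitely many coordinates are constrained, so this is a neighbourhood in
      the product topology.\<close>
    define U where "U = (\<Inter>i<n. (\<lambda>z::(pcode \<Rightarrow> real) \<times> real. fst z (q i)) -` ball (fst p (q i)) (1 / real (Suc n)))"
    have "open ((\<lambda>z::(pcode \<Rightarrow> real) \<times> real. fst z (q i)) -` ball (fst p (q i)) (1 / real (Suc n)))" for i
    proof (rule open_vimage)
      show "continuous_on UNIV (\<lambda>z::(pcode \<Rightarrow> real) \<times> real. fst z (q i))"
        by (rule continuous_on_product_then_coordinatewise)
           (intro continuous_intros)
    qed simp
    then have "open U" unfolding U_def by (intro open_INT) auto
    moreover have "p \<in> U" by (auto simp: U_def)
    ultimately obtain z where "z \<in> U" "z \<in> profile ` {P. valid_poset P}"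
      using assms unfolding Pbar_def by (metis disjoint_iff open_Int_closure_eq_empty)
    then obtain P where "valid_poset P" "z = profile P" by auto
    with \<open>z \<in> U\<close> show ?thesis
      using q by (intro exI[of _ P]) (auto simp: U_def profile_def dist_real_def abs_minus_commute)
  qed
  then obtain P where P: "\<And>n. valid_poset (P n)"
    "\<And>n i. i < n \<Longrightarrow> \<bar>hom_dens (q i) (P n) - fst p (q i)\<bar> < 1 / real (Suc n)"
    by metis
  show thesis
  proof
    fix Q assume "valid_poset Q"
    then obtain i where i: "Q = q i" using surj by blast
    have "(\<lambda>n. 1 / real (Suc n)) \<longlonglongrightarrow> 0"
      using LIMSEQ_inverse_real_of_nat by (simp add: inverse_eq_divide)
    then have "(\<lambda>n. hom_dens (q i) (P n) - fst p (q i)) \<longlonglongrightarrow> 0"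
      by (rule Lim_null_comparison[rotated])
         (use P(2) in \<open>auto intro!: eventually_mono[OF eventually_gt_at_top[of i]] less_imp_le\<close>)
    then show "(\<lambda>n. hom_dens Q (P n)) \<longlonglongrightarrow> fst p Q" using i Lim_null by blast
  qed (rule P)
qed

section \<open>Block averages and the counting lemma in finite posets\<close>

definition cell_card :: "'a set \<Rightarrow> ('a \<Rightarrow> nat) \<Rightarrow> nat \<Rightarrow> real" where
  "cell_card V c i = real (card {x\<in>V. c x = i})"

definition cell_sum :: "'a set \<Rightarrow> ('a \<Rightarrow> 'a \<Rightarrow> real) \<Rightarrow> ('a \<Rightarrow> nat) \<Rightarrow> nat \<Rightarrow> nat \<Rightarrow> real" where
  "cell_sum V w c i j = (\<Sum>x\<in>{x\<in>V. c x = i}. \<Sum>y\<in>{y\<in>V. c y = j}. w x y)"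

text \<open>Division by zero makes the density of an empty cell 0, so weights in [0, 1] always give
  densities in [0, 1].\<close>

definition cell_dens :: "'a set \<Rightarrow> ('a \<Rightarrow> 'a \<Rightarrow> real) \<Rightarrow> ('a \<Rightarrow> nat) \<Rightarrow> nat \<Rightarrow> nat \<Rightarrow> real" where
  "cell_dens V w c i j = cell_sum V w c i j / (cell_card V c i * cell_card V c j)"

definition block_average :: "'a set \<Rightarrow> ('a \<Rightarrow> 'a \<Rightarrow> real) \<Rightarrow> ('a \<Rightarrow> nat) \<Rightarrow> 'a \<Rightarrow> 'a \<Rightarrow> real" where
  "block_average V w c x y = cell_dens V w c (c x) (c y)"

text \<open>The squared L2 norm of the block average, not normalised: for weights in [0, 1] it lies
  between 0 and \<open>(real (card V))\<^sup>2\<close>.\<close>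

definition energy :: "'a set \<Rightarrow> ('a \<Rightarrow> 'a \<Rightarrow> real) \<Rightarrow> ('a \<Rightarrow> nat) \<Rightarrow> real" where
  "energy V w c = (\<Sum>x\<in>V. \<Sum>y\<in>V. (block_average V w c x y)\<^sup>2)"

lemma cell_sum_eq_dens:
  assumes "finite V"
  shows "cell_sum V w c i j = cell_dens V w c i j * cell_card V c i * cell_card V c j"
proof (cases "cell_card V c i * cell_card V c j = 0")
  case True
  then have "{x\<in>V. c x = i} = {} \<or> {x\<in>V. c x = j} = {}"
    using assms by (auto simp: cell_card_def)
  then have "cell_sum V w c i j = 0" unfolding cell_sum_def by (elim disjE) (simp_all only: sum.empty sum.neutral_const)
  then show ?thesis using True by auto
qed (auto simp: cell_dens_def)

lemma cell_dens_bounds: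
  assumes "finite V" "\<And>x y. x \<in> V \<Longrightarrow> y \<in> V \<Longrightarrow> 0 \<le> w x y \<and> w x y \<le> 1"
  shows "0 \<le> cell_dens V w c i j" "cell_dens V w c i j \<le> 1"
proof -
  show "0 \<le> cell_dens V w c i j"
    unfolding cell_dens_def cell_sum_def cell_card_def
    using assms by (intro divide_nonneg_nonneg sum_nonneg) auto
  have "cell_sum V w c i j \<le> (\<Sum>x\<in>{x\<in>V. c x = i}. \<Sum>y\<in>{y\<in>V. c y = j}. 1)"
    unfolding cell_sum_def using assms by (intro sum_mono) auto
  then have *: "cell_sum V w c i j \<le> cell_card V c i * cell_card V c j"
    by (simp add: cell_card_def)
  show "cell_dens V w c i j \<le> 1"
    unfolding cell_dens_def using *
    by (cases "cell_card V c i * cell_card V c j = 0") (auto simp: cell_card_def divide_simps split: if_splits)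
qed

lemma sum_cells:
  fixes g :: "'a \<Rightarrow> 'a \<Rightarrow> real" and c :: "'a \<Rightarrow> nat"
  assumes "finite V"
  shows "(\<Sum>x\<in>V. \<Sum>y\<in>V. g x y) =
    (\<Sum>i\<in>c ` V. \<Sum>j\<in>c ` V. \<Sum>x\<in>{x\<in>V. c x = i}. \<Sum>y\<in>{y\<in>V. c y = j}. g x y)"
proof -
  have "(\<Sum>x\<in>V. \<Sum>y\<in>V. g x y) = (\<Sum>i\<in>c ` V. \<Sum>x\<in>{x\<in>V. c x = i}. \<Sum>y\<in>V. g x y)"
    using assms by (rule sum.image_gen)
  also have "\<dots> = (\<Sum>i\<in>c ` V. \<Sum>x\<in>{x\<in>V. c x = i}. \<Sum>j\<in>c ` V. \<Sum>y\<in>{y\<in>V. c y = j}. g x y)"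
    by (intro sum.cong sum.image_gen assms refl)
  also have "\<dots> = (\<Sum>i\<in>c ` V. \<Sum>j\<in>c ` V. \<Sum>x\<in>{x\<in>V. c x = i}. \<Sum>y\<in>{y\<in>V. c y = j}. g x y)"
    by (intro sum.cong refl sum.swap)
  finally show ?thesis .
qed

text \<open>Averaging over blocks is the orthogonal projection onto the functions of the labels,
  here tested against such a function \<open>s\<close>.\<close>

lemma block_average_projection:
  assumes "finite V"
  shows "(\<Sum>x\<in>V. \<Sum>y\<in>V. w x y * s (c x) (c y)) = (\<Sum>x\<in>V. \<Sum>y\<in>V. block_average V w c x y * s (c x) (c y))"
proof -
  have "(\<Sum>x\<in>{x\<in>V. c x = i}. \<Sum>y\<in>{y\<in>V. c y = j}. w x y * s (c x) (c y))
     = (\<Sum>x\<in>{x\<in>V. c x = i}. \<Sum>y\<in>{y\<in>V. c y = j}. block_average V w c x y * s (c x) (c y))" for i j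
  proof -
    have "(\<Sum>x\<in>{x\<in>V. c x = i}. \<Sum>y\<in>{y\<in>V. c y = j}. w x y * s (c x) (c y)) = cell_sum V w c i j * s i j"
      by (simp add: cell_sum_def sum_distrib_right)
    moreover have "(\<Sum>x\<in>{x\<in>V. c x = i}. \<Sum>y\<in>{y\<in>V. c y = j}. block_average V w c x y * s (c x) (c y))
       = (\<Sum>x\<in>{x\<in>V. c x = i}. \<Sum>y\<in>{y\<in>V. c y = j}. cell_dens V w c i j * s i j)"
      by (intro sum.cong) (auto simp: block_average_def)
    ultimately show ?thesis
      using cell_sum_eq_dens[OF assms, of w c i j] by (simp add: cell_card_def)
  qed
  then show ?thesis
    unfolding sum_cells[OF assms, of "\<lambda>x y. w x y * s (c x) (c y)" c]
      sum_cells[OF assms, of "\<lambda>x y. block_average V w c x y * s (c x) (c y)" c]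
    by simp
qed

text \<open>The function \<open>h\<close> witnesses that \<open>c'\<close> refines \<open>c\<close>,
  while \<open>hS\<close> and \<open>hT\<close> witness that S and T are unions of cells of
  \<open>c'\<close>. So w may be replaced on S x T by its finer average, and Cauchy-Schwarz bounds
  the inner product of the increment of the averages with the indicator of S x T.\<close>

lemma refinement_energy_gain:
  assumes V: "finite V" and S: "S \<subseteq> V" and T: "T \<subseteq> V"
    and c: "\<And>x. x \<in> V \<Longrightarrow> c x = h (c' x)"
    and hS: "\<And>x. x \<in> V \<Longrightarrow> x \<in> S \<longleftrightarrow> hS (c' x)"
    and hT: "\<And>x. x \<in> V \<Longrightarrow> x \<in> T \<longleftrightarrow> hT (c' x)"
  shows "(\<Sum>x\<in>S. \<Sum>y\<in>T. w x y - block_average V w c x y)\<^sup>2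
           \<le> (real (card V))\<^sup>2 * (energy V w c' - energy V w c)"
proof -
  define d where "d x y = block_average V w c' x y - block_average V w c x y" for x y
  define b where "b x y = (of_bool (x \<in> S \<and> y \<in> T) :: real)" for x y
  have b: "b x y = of_bool (hS (c' x) \<and> hT (c' y))" if "x \<in> V" "y \<in> V" for x y
    using that hS hT by (auto simp: b_def)
  have bsum: "(\<Sum>x\<in>S. \<Sum>y\<in>T. g x y) = (\<Sum>x\<in>V. \<Sum>y\<in>V. g x y * b x y)" for g :: "'a \<Rightarrow> 'a \<Rightarrow> real"
  proof -
    have "(\<Sum>x\<in>V. \<Sum>y\<in>V. g x y * b x y) = (\<Sum>x\<in>S. \<Sum>y\<in>V. g x y * b x y)"
      by (rule sum.mono_neutral_right[OF V S]) (auto simp: b_def)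
    also have "\<dots> = (\<Sum>x\<in>S. \<Sum>y\<in>T. g x y * b x y)"
      by (intro sum.cong refl sum.mono_neutral_right[OF V T]) (auto simp: b_def)
    also have "\<dots> = (\<Sum>x\<in>S. \<Sum>y\<in>T. g x y)"
      by (intro sum.cong refl) (auto simp: b_def)
    finally show ?thesis ..
  qed
  have "(\<Sum>x\<in>S. \<Sum>y\<in>T. w x y) = (\<Sum>x\<in>V. \<Sum>y\<in>V. w x y * of_bool (hS (c' x) \<and> hT (c' y)))"
    unfolding bsum by (intro sum.cong refl) (simp add: b)
  also have "\<dots> = (\<Sum>x\<in>V. \<Sum>y\<in>V. block_average V w c' x y * of_bool (hS (c' x) \<and> hT (c' y)))"
    by (rule block_average_projection[OF V, of w "\<lambda>i j. of_bool (hS i \<and> hT j)"])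
  also have "\<dots> = (\<Sum>x\<in>S. \<Sum>y\<in>T. block_average V w c' x y)"
    unfolding bsum by (intro sum.cong refl) (simp add: b)
  finally have "(\<Sum>x\<in>S. \<Sum>y\<in>T. w x y - block_average V w c x y) = (\<Sum>x\<in>S. \<Sum>y\<in>T. d x y)"
    by (simp add: d_def sum_subtractf)
  also have "\<dots> = (\<Sum>x\<in>V. \<Sum>y\<in>V. d x y * b x y)" by (rule bsum)
  also have "\<dots>\<^sup>2 = (\<Sum>(x,y)\<in>V\<times>V. d x y * b x y)\<^sup>2" by (simp add: sum.cartesian_product)
  also have "\<dots> \<le> (\<Sum>(x,y)\<in>V\<times>V. (d x y)\<^sup>2) * (\<Sum>(x,y)\<in>V\<times>V. (b x y)\<^sup>2)"
    using Cauchy_Schwarz_ineq_sum[of "\<lambda>(x,y). d x y" "\<lambda>(x,y). b x y" "V \<times> V"]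
    by (simp add: case_prod_unfold)
  also have "\<dots> \<le> (\<Sum>(x,y)\<in>V\<times>V. (d x y)\<^sup>2) * (\<Sum>(x,y)\<in>V\<times>V. 1)"
    by (intro mult_left_mono sum_mono sum_nonneg) (auto simp: b_def)
  also have "\<dots> = (real (card V))\<^sup>2 * (\<Sum>x\<in>V. \<Sum>y\<in>V. (d x y)\<^sup>2)"
    by (simp add: sum.cartesian_product case_prod_unfold power2_eq_square card_cartesian_product)
  \<comment> \<open>Pythagoras: the coarse average is also a function of the fine labels, so
    projecting twice turns the cross term into the coarse energy.\<close>
  also have "(\<Sum>x\<in>V. \<Sum>y\<in>V. (d x y)\<^sup>2) = energy V w c' - energy V w c"
  proof -
    define s where "s i j = cell_dens V w c (h i) (h j)" for i j
    have s: "block_average V w c x y = s (c' x) (c' y)" if "x \<in> V" "y \<in> V" for x y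
      using that c by (simp add: s_def block_average_def)
    have "(\<Sum>x\<in>V. \<Sum>y\<in>V. block_average V w c' x y * block_average V w c x y) = (\<Sum>x\<in>V. \<Sum>y\<in>V. block_average V w c' x y * s (c' x) (c' y))"
      by (intro sum.cong refl) (simp add: s)
    also have "\<dots> = (\<Sum>x\<in>V. \<Sum>y\<in>V. w x y * s (c' x) (c' y))"
      by (rule block_average_projection[OF V, symmetric])
    also have "\<dots> = (\<Sum>x\<in>V. \<Sum>y\<in>V. w x y * cell_dens V w c (c x) (c y))"
      by (intro sum.cong refl) (simp add: s_def c)
    also have "\<dots> = (\<Sum>x\<in>V. \<Sum>y\<in>V. block_average V w c x y * cell_dens V w c (c x) (c y))"
      by (rule block_average_projection[OF V])
    also have "\<dots> = energy V w c" by (simp add: energy_def block_average_def power2_eq_square)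
    finally have cross: "(\<Sum>x\<in>V. \<Sum>y\<in>V. block_average V w c' x y * block_average V w c x y) = energy V w c" .
    have "(\<Sum>x\<in>V. \<Sum>y\<in>V. (d x y)\<^sup>2) = energy V w c' + energy V w c
        - 2 * (\<Sum>x\<in>V. \<Sum>y\<in>V. block_average V w c' x y * block_average V w c x y)"
      by (simp add: d_def power2_diff energy_def sum.distrib sum_subtractf sum_distrib_left mult.assoc)
    then show ?thesis by (simp add: cross)
  qed
  finally show ?thesis .
qed

section \<open>Weak regularity by greedy refinement\<close>

text \<open>Refining along a pair of sets that maximises the discrepancy makes the energy gain
  dominate the discrepancy of every pair. Finiteness of V provides the maximiser.\<close>

lemma greedy_refinement:
  fixes w :: "'a \<Rightarrow> 'a \<Rightarrow> real"
  assumes V: "finite V"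
  obtains C where "\<And>x. C 0 x = (0::nat)" "\<And>k x. C (Suc k) x div 4 = C k x"
    "\<And>k S T. S \<subseteq> V \<Longrightarrow> T \<subseteq> V \<Longrightarrow> (\<Sum>x\<in>S. \<Sum>y\<in>T. w x y - block_average V w (C k) x y)\<^sup>2
           \<le> (real (card V))\<^sup>2 * (energy V w (C (Suc k)) - energy V w (C k))"
proof -
  define good where "good c c' \<longleftrightarrow> (\<forall>x. c' x div 4 = c x) \<and>
     (\<forall>S T. S \<subseteq> V \<longrightarrow> T \<subseteq> V \<longrightarrow> (\<Sum>x\<in>S. \<Sum>y\<in>T. w x y - block_average V w c x y)\<^sup>2
           \<le> (real (card V))\<^sup>2 * (energy V w c' - energy V w c))" for c c' :: "'a \<Rightarrow> nat"
  have ex: "\<exists>c'. good c c'" for c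
  proof -
    define g where "g = (\<lambda>(S,T). (\<Sum>x\<in>S. \<Sum>y\<in>T. w x y - block_average V w c x y)\<^sup>2)"
    have fin: "finite (g ` (Pow V \<times> Pow V))" using V by auto
    moreover have "g ` (Pow V \<times> Pow V) \<noteq> {}" by auto
    ultimately have "Max (g ` (Pow V \<times> Pow V)) \<in> g ` (Pow V \<times> Pow V)" by (rule Max_in)
    then obtain S0 T0 where ST: "S0 \<subseteq> V" "T0 \<subseteq> V" "Max (g ` (Pow V \<times> Pow V)) = g (S0, T0)" by auto
    have max: "g (S, T) \<le> g (S0, T0)" if "S \<subseteq> V" "T \<subseteq> V" for S T
      using that fin unfolding ST(3)[symmetric] by (intro Max_ge) auto
    \<comment> \<open>Two bits are appended to the label, recording membership in \<open>S0\<close>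
      and in \<open>T0\<close>; \<open>div 4\<close> forgets them again.\<close>
    define c' where "c' x = 4 * c x + 2 * of_bool (x \<in> S0) + of_bool (x \<in> T0)" for x
    have "g (S0, T0) \<le> (real (card V))\<^sup>2 * (energy V w c' - energy V w c)"
      unfolding g_def prod.case
      by (rule refinement_energy_gain[OF V ST(1,2), where h = "\<lambda>i. i div 4"
            and hS = "\<lambda>i. odd (i div 2)" and hT = odd]) (auto simp: c'_def)
    then have "good c c'"
      unfolding good_def using order_trans[OF max] by (auto simp: c'_def g_def of_bool_def)
    then show ?thesis by blast
  qed
  obtain C where C: "C 0 = (\<lambda>_. 0)" "\<And>k. good (C k) (C (Suc k))"
    using dependent_nat_choice[of "\<lambda>n c. n = 0 \<longrightarrow> c = (\<lambda>_. 0)" "\<lambda>_. good"] ex by auto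
  show thesis by (rule that[of C]) (use C in \<open>auto simp: good_def\<close>)
qed

text \<open>The energies stay between 0 and \<open>(real (card V))\<^sup>2\<close>, so one of any K
  consecutive increments is at most a K-th of that bound. The window may start at any level L, and
  its length depends on the accuracy alone, not on V.\<close>

lemma weak_regularity:
  fixes w :: "'a \<Rightarrow> 'a \<Rightarrow> real"
  assumes V: "finite V" "V \<noteq> {}" and w: "\<And>x y. x \<in> V \<Longrightarrow> y \<in> V \<Longrightarrow> 0 \<le> w x y \<and> w x y \<le> 1"
    and C: "\<And>k S T. S \<subseteq> V \<Longrightarrow> T \<subseteq> V \<Longrightarrow> (\<Sum>x\<in>S. \<Sum>y\<in>T. w x y - block_average V w (C k) x y)\<^sup>2
           \<le> (real (card V))\<^sup>2 * (energy V w (C (Suc k)) - energy V w (C k))"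
    and K: "K > 0"
  obtains k where "L \<le> k" "k < L + K"
    "\<And>S T. S \<subseteq> V \<Longrightarrow> T \<subseteq> V \<Longrightarrow> \<bar>\<Sum>x\<in>S. \<Sum>y\<in>T. w x y - block_average V w (C k) x y\<bar> \<le> (real (card V))\<^sup>2 / sqrt K"
proof -
  let ?n = "real (card V)"
  have n: "?n > 0" using V by (simp add: card_gt_0_iff)
  have e: "0 \<le> energy V w c" "energy V w c \<le> ?n\<^sup>2" for c
  proof -
    show "0 \<le> energy V w c" by (auto simp: energy_def intro!: sum_nonneg)
    have "energy V w c \<le> (\<Sum>x\<in>V. \<Sum>y\<in>V. 1)"
      unfolding energy_def block_average_def using cell_dens_bounds[OF V(1) w]
      by (intro sum_mono power_le_one) auto
    then show "energy V w c \<le> ?n\<^sup>2" by (simp add: power2_eq_square)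
  qed
  define D where "D k = energy V w (C (Suc k)) - energy V w (C k)" for k
  have "(\<Sum>k\<in>{L..<L+K}. D k) = energy V w (C (L+K)) - energy V w (C L)"
    unfolding D_def by (rule sum_Suc_diff') simp
  then have sum: "(\<Sum>k\<in>{L..<L+K}. D k) \<le> ?n\<^sup>2" using e[of "C L"] e[of "C (L+K)"] by linarith
  have "\<exists>k\<in>{L..<L+K}. D k \<le> ?n\<^sup>2 / K"
  proof (rule ccontr)
    assume "\<not> ?thesis"
    then have "(\<Sum>k\<in>{L..<L+K}. D k) > (\<Sum>k\<in>{L..<L+K}. ?n\<^sup>2 / K)"
      using K by (intro sum_strict_mono) (auto simp: not_le)
    then show False using sum K by simp
  qed
  then obtain k where k: "k \<in> {L..<L+K}" "D k \<le> ?n\<^sup>2 / K" by blast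
  show thesis
  proof (rule that[of k])
    fix S T assume "S \<subseteq> V" "T \<subseteq> V"
    from C[OF this, of k] have "(\<Sum>x\<in>S. \<Sum>y\<in>T. w x y - block_average V w (C k) x y)\<^sup>2 \<le> ?n\<^sup>2 * D k"
      by (simp add: D_def)
    also have "\<dots> \<le> ?n\<^sup>2 * (?n\<^sup>2 / K)" using k(2) by (intro mult_left_mono) auto
    also have "\<dots> = (?n\<^sup>2 / sqrt K)\<^sup>2" by (simp add: power_divide power2_eq_square)
    finally show "\<bar>\<Sum>x\<in>S. \<Sum>y\<in>T. w x y - block_average V w (C k) x y\<bar> \<le> ?n\<^sup>2 / sqrt K"
      by (subst (asm) power2_le_iff_abs_le) auto
  qed (use k in auto)
qed

section \<open>Cut bounds and homomorphism sums\<close>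

text \<open>A linear function of weights in [0, 1] is largest and smallest at the indicators of the
  sets where \<open>r\<close> is positive and negative.\<close>

lemma abs_sum_weighted_le:
  fixes r :: "'a \<Rightarrow> real"
  assumes V: "finite V" and r: "\<And>S. S \<subseteq> V \<Longrightarrow> \<bar>\<Sum>x\<in>S. r x\<bar> \<le> B"
    and a: "\<And>x. x \<in> V \<Longrightarrow> 0 \<le> a x \<and> a x \<le> 1"
  shows "\<bar>\<Sum>x\<in>V. a x * r x\<bar> \<le> B"
proof -
  have "(\<Sum>x\<in>V. a x * r x) \<le> (\<Sum>x\<in>V. if 0 < r x then r x else 0)"
  proof (rule sum_mono)
    fix x assume "x \<in> V"
    then show "a x * r x \<le> (if 0 < r x then r x else 0)"
      using a[of x] by (auto intro: mult_left_le_one_le simp: mult_nonneg_nonpos)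
  qed
  also have "\<dots> = (\<Sum>x\<in>{x\<in>V. 0 < r x}. r x)" using V by (simp add: sum.inter_filter)
  also have "\<dots> \<le> B" using r[of "{x\<in>V. 0 < r x}"] by auto
  finally have 1: "(\<Sum>x\<in>V. a x * r x) \<le> B" .
  have "(\<Sum>x\<in>V. - (a x * r x)) \<le> (\<Sum>x\<in>V. if r x < 0 then - r x else 0)"
  proof (rule sum_mono)
    fix x assume "x \<in> V"
    then show "- (a x * r x) \<le> (if r x < 0 then - r x else 0)"
      using a[of x] mult_left_le_one_le[of "- r x" "a x"] by auto
  qed
  also have "\<dots> = (\<Sum>x\<in>{x\<in>V. r x < 0}. - r x)" using V by (simp add: sum.inter_filter)
  also have "\<dots> \<le> B" using r[of "{x\<in>V. r x < 0}"] by (auto simp: sum_negf)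
  finally have 2: "- (\<Sum>x\<in>V. a x * r x) \<le> B" by (simp add: sum_negf)
  from 1 2 show ?thesis by linarith
qed

text \<open>The passage from sets to weights is made in one coordinate at a time, the other set
  being kept fixed.\<close>

lemma abs_sum_cut_weighted_le:
  fixes g :: "'a \<Rightarrow> 'a \<Rightarrow> real"
  assumes V: "finite V"
    and g: "\<And>S T. S \<subseteq> V \<Longrightarrow> T \<subseteq> V \<Longrightarrow> \<bar>\<Sum>x\<in>S. \<Sum>y\<in>T. g x y\<bar> \<le> B"
    and a: "\<And>x. x \<in> V \<Longrightarrow> 0 \<le> a x \<and> a x \<le> 1" and b: "\<And>x. x \<in> V \<Longrightarrow> 0 \<le> b x \<and> b x \<le> 1"
  shows "\<bar>\<Sum>x\<in>V. \<Sum>y\<in>V. g x y * (a x * b y)\<bar> \<le> B"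
proof -
  have "\<bar>\<Sum>x\<in>V. a x * (\<Sum>y\<in>V. b y * g x y)\<bar> \<le> B"
  proof (rule abs_sum_weighted_le[OF V _ a])
    fix S assume S: "S \<subseteq> V"
    have "\<bar>\<Sum>y\<in>V. b y * (\<Sum>x\<in>S. g x y)\<bar> \<le> B"
    proof (rule abs_sum_weighted_le[OF V _ b])
      fix T assume "T \<subseteq> V"
      then show "\<bar>\<Sum>y\<in>T. \<Sum>x\<in>S. g x y\<bar> \<le> B" using g[OF S] by (subst sum.swap) auto
    qed
    then show "\<bar>\<Sum>x\<in>S. \<Sum>y\<in>V. b y * g x y\<bar> \<le> B"
      by (subst sum.swap) (simp add: sum_distrib_left)
  qed
  then show ?thesis by (simp add: sum_distrib_left mult_ac)
qed

lemma sum_PiE_remove: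
  fixes F :: "('i \<Rightarrow> 'a) \<Rightarrow> real"
  assumes "i \<in> I"
  shows "(\<Sum>f\<in>I \<rightarrow>\<^sub>E V. F f) = (\<Sum>x\<in>V. \<Sum>g\<in>(I - {i}) \<rightarrow>\<^sub>E V. F (g(i := x)))"
proof -
  have "I \<rightarrow>\<^sub>E V = (insert i (I - {i})) \<rightarrow>\<^sub>E V" using assms by (simp add: insert_absorb)
  also have "\<dots> = (\<lambda>(y, g). g(i := y)) ` (V \<times> ((I - {i}) \<rightarrow>\<^sub>E V))" by (rule PiE_insert_eq)
  finally have "(\<Sum>f\<in>I \<rightarrow>\<^sub>E V. F f) = (\<Sum>z\<in>V \<times> ((I - {i}) \<rightarrow>\<^sub>E V). F ((\<lambda>(y, g). g(i := y)) z))"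
    using inj_combinator[of i "I - {i}" "\<lambda>_. V"] by (simp add: sum.reindex)
  then show ?thesis by (simp add: sum.cartesian_product case_prod_unfold)
qed

text \<open>Each edge carries its own weight function, so that weights can be exchanged edge by
  edge.\<close>

definition hom_sum :: "nat \<Rightarrow> 'a set \<Rightarrow> (nat \<times> nat) set \<Rightarrow> (nat \<times> nat \<Rightarrow> 'a \<Rightarrow> 'a \<Rightarrow> real) \<Rightarrow> real" where
  "hom_sum q V Q u = (\<Sum>f\<in>{0..<q} \<rightarrow>\<^sub>E V. \<Prod>e\<in>Q. u e (f (fst e)) (f (snd e)))"

text \<open>With all vertices but \<open>i\<close> and \<open>j\<close> fixed, the remaining factors split into a function of the
  image of \<open>i\<close> times a function of the image of \<open>j\<close>; this is where 2-cycles are excluded.\<close>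

lemma hom_sum_change_edge:
  fixes \<epsilon> :: real
  assumes V: "finite V" and ij: "(i, j) \<in> Q" "i < q" "j < q" "i \<noteq> j" "(j, i) \<notin> Q"
    and Q: "finite Q" "irrefl Q" and Qq: "Q \<subseteq> {0..<q} \<times> {0..<q}"
    and u: "\<And>e x y. x \<in> V \<Longrightarrow> y \<in> V \<Longrightarrow> 0 \<le> u e x y \<and> u e x y \<le> 1"
    and u': "\<And>e. e \<noteq> (i, j) \<Longrightarrow> u' e = u e"
    and cut: "\<And>S T. S \<subseteq> V \<Longrightarrow> T \<subseteq> V \<Longrightarrow>
       \<bar>\<Sum>x\<in>S. \<Sum>y\<in>T. u (i, j) x y - u' (i, j) x y\<bar> \<le> \<epsilon> * (real (card V))\<^sup>2"
  shows "\<bar>hom_sum q V Q u - hom_sum q V Q u'\<bar> \<le> \<epsilon> * real (card V) ^ q"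
proof -
  define g where "g x y = u (i, j) x y - u' (i, j) x y" for x y
  \<comment> \<open>\<open>Q1\<close> consists of the other edges at i. None of them meets j, since
    (i, j) is removed and (j, i) is not in Q. Hence the product over \<open>Q1\<close> depends on
    the image of i but not of j, and the product over \<open>Q2\<close> does not depend on the image
    of i.\<close>
  define Q1 where "Q1 = {e \<in> Q - {(i, j)}. fst e = i \<or> snd e = i}"
  define Q2 where "Q2 = Q - {(i, j)} - Q1"
  define J where "J = {0..<q} - {j} - {i}"
  define G where "G f = (\<Prod>e\<in>Q - {(i, j)}. u e (f (fst e)) (f (snd e)))" for f
  have "hom_sum q V Q u - hom_sum q V Q u' = (\<Sum>f\<in>{0..<q} \<rightarrow>\<^sub>E V. g (f i) (f j) * G f)"
  proof -
    have "(\<Prod>e\<in>Q. v e (f (fst e)) (f (snd e))) = v (i, j) (f i) (f j) * G f"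
      if "\<And>e. e \<noteq> (i, j) \<Longrightarrow> v e = u e" for v :: "nat \<times> nat \<Rightarrow> 'a \<Rightarrow> 'a \<Rightarrow> real" and f
    proof -
      have "(\<Prod>e\<in>Q. v e (f (fst e)) (f (snd e))) = v (i, j) (f i) (f j) *
          (\<Prod>e\<in>Q - {(i, j)}. v e (f (fst e)) (f (snd e)))"
        using Q(1) ij(1) by (simp add: prod.remove)
      also have "(\<Prod>e\<in>Q - {(i, j)}. v e (f (fst e)) (f (snd e))) = G f"
        unfolding G_def by (intro prod.cong refl) (use that in auto)
      finally show ?thesis .
    qed
    from this[of u] this[of u'] show ?thesis
      using u' by (simp add: hom_sum_def g_def algebra_simps flip: sum_subtractf)
  qed
  also have "\<dots> = (\<Sum>y\<in>V. \<Sum>x\<in>V. \<Sum>h\<in>J \<rightarrow>\<^sub>E V. g x y * G (h(i := x, j := y)))"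
    unfolding J_def using ij by (simp add: sum_PiE_remove[of j] sum_PiE_remove[of i])
  also have "\<dots> = (\<Sum>y\<in>V. \<Sum>h\<in>J \<rightarrow>\<^sub>E V. \<Sum>x\<in>V. g x y * G (h(i := x, j := y)))"
    by (intro sum.cong refl sum.swap)
  also have "\<dots> = (\<Sum>h\<in>J \<rightarrow>\<^sub>E V. \<Sum>y\<in>V. \<Sum>x\<in>V. g x y * G (h(i := x, j := y)))"
    by (rule sum.swap)
  also have "\<dots> = (\<Sum>h\<in>J \<rightarrow>\<^sub>E V. \<Sum>x\<in>V. \<Sum>y\<in>V. g x y * G (h(i := x, j := y)))"
    by (intro sum.cong refl sum.swap)
  finally have eq: "hom_sum q V Q u - hom_sum q V Q u' =
    (\<Sum>h\<in>J \<rightarrow>\<^sub>E V. \<Sum>x\<in>V. \<Sum>y\<in>V. g x y * G (h(i := x, j := y)))" .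
  have "\<bar>\<Sum>x\<in>V. \<Sum>y\<in>V. g x y * G (h(i := x, j := y))\<bar> \<le> \<epsilon> * (real (card V))\<^sup>2"
    if h: "h \<in> J \<rightarrow>\<^sub>E V" for h
  proof -
    define a where "a x = (\<Prod>e\<in>Q1. u e ((h(i := x)) (fst e)) ((h(i := x)) (snd e)))" for x
    define b where "b y = (\<Prod>e\<in>Q2. u e ((h(j := y)) (fst e)) ((h(j := y)) (snd e)))" for y
    have G: "G (h(i := x, j := y)) = a x * b y" for x y
    proof -
      let ?f = "h(i := x, j := y)"
      have "G ?f = (\<Prod>e\<in>Q1. u e (?f (fst e)) (?f (snd e))) * (\<Prod>e\<in>Q2. u e (?f (fst e)) (?f (snd e)))"
        unfolding G_def Q2_def using Q(1) by (subst prod.subset_diff[of Q1]) (auto simp: Q1_def mult.commute)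
      also have "(\<Prod>e\<in>Q1. u e (?f (fst e)) (?f (snd e))) = a x"
        unfolding a_def
      proof (intro prod.cong refl)
        fix e assume "e \<in> Q1"
        then have "fst e \<noteq> j" "snd e \<noteq> j"
          using ij Q(2) by (cases e; auto simp: Q1_def irrefl_def)+
        then show "u e (?f (fst e)) (?f (snd e)) = u e ((h(i := x)) (fst e)) ((h(i := x)) (snd e))" by simp
      qed
      also have "(\<Prod>e\<in>Q2. u e (?f (fst e)) (?f (snd e))) = b y"
        unfolding b_def
      proof (intro prod.cong refl)
        fix e assume "e \<in> Q2"
        then have "fst e \<noteq> i" "snd e \<noteq> i" by (auto simp: Q1_def Q2_def)
        then show "u e (?f (fst e)) (?f (snd e)) = u e ((h(j := y)) (fst e)) ((h(j := y)) (snd e))" by simp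
      qed
      finally show ?thesis .
    qed
    show ?thesis
      unfolding G
    proof (rule abs_sum_cut_weighted_le[OF V])
      show "\<bar>\<Sum>x\<in>S. \<Sum>y\<in>T. g x y\<bar> \<le> \<epsilon> * (real (card V))\<^sup>2" if "S \<subseteq> V" "T \<subseteq> V" for S T
        using cut[OF that] by (simp add: g_def)
      have hV: "h k \<in> V" if "k < q" "k \<noteq> i" "k \<noteq> j" for k
        using h that by (auto simp: J_def PiE_iff)
      show "0 \<le> a x \<and> a x \<le> 1" if "x \<in> V" for x
      proof -
        have "0 \<le> u e ((h(i := x)) (fst e)) ((h(i := x)) (snd e)) \<and> u e ((h(i := x)) (fst e)) ((h(i := x)) (snd e)) \<le> 1"
          if e: "e \<in> Q1" for e
        proof (rule u)
          have "fst e \<noteq> j" "snd e \<noteq> j" using ij Q(2) e by (cases e; auto simp: Q1_def irrefl_def)+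
          moreover have "fst e < q" "snd e < q" using Qq e by (auto simp: Q1_def)
          ultimately show "(h(i := x)) (fst e) \<in> V" "(h(i := x)) (snd e) \<in> V"
            using hV \<open>x \<in> V\<close> by auto
        qed
        then show ?thesis unfolding a_def by (auto intro!: prod_nonneg prod_le_1)
      qed
      show "0 \<le> b x \<and> b x \<le> 1" if "x \<in> V" for x
      proof -
        have "0 \<le> u e ((h(j := x)) (fst e)) ((h(j := x)) (snd e)) \<and> u e ((h(j := x)) (fst e)) ((h(j := x)) (snd e)) \<le> 1"
          if e: "e \<in> Q2" for e
        proof (rule u)
          have "fst e \<noteq> i" "snd e \<noteq> i" using e by (auto simp: Q1_def Q2_def)
          moreover have "fst e < q" "snd e < q" using Qq e by (auto simp: Q2_def)
          ultimately show "(h(j := x)) (fst e) \<in> V" "(h(j := x)) (snd e) \<in> V"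
            using hV \<open>x \<in> V\<close> by auto
        qed
        then show ?thesis unfolding b_def by (auto intro!: prod_nonneg prod_le_1)
      qed
    qed
  qed
  then have "\<bar>hom_sum q V Q u - hom_sum q V Q u'\<bar> \<le> (\<Sum>h\<in>J \<rightarrow>\<^sub>E V. \<epsilon> * (real (card V))\<^sup>2)"
    unfolding eq by (rule order_trans[OF sum_abs sum_mono])
  also have "\<dots> = \<epsilon> * (real (card V) ^ card J * (real (card V))\<^sup>2)"
    by (simp add: card_PiE J_def)
  also have "\<dots> = \<epsilon> * real (card V) ^ q"
  proof -
    have "card J + 2 = q" using ij by (simp add: J_def)
    then show ?thesis by (metis power_add)
  qed
  finally show ?thesis .
qed

text \<open>A hybrid argument: \<open>w\<close> is exchanged for \<open>w'\<close> on one edge at a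
  time, each exchange costing one cut error. Q is an asymmetric relation rather than an order
  because the directed path and the directed 3-cycle on three vertices have to be counted as
  well.\<close>

lemma counting_lemma:
  fixes \<epsilon> :: real
  assumes V: "finite V" and Q: "Q \<subseteq> {0..<q} \<times> {0..<q}" "irrefl Q" "asym Q"
    and w: "\<And>x y. x \<in> V \<Longrightarrow> y \<in> V \<Longrightarrow> 0 \<le> w x y \<and> w x y \<le> 1"
    and w': "\<And>x y. x \<in> V \<Longrightarrow> y \<in> V \<Longrightarrow> 0 \<le> w' x y \<and> w' x y \<le> 1"
    and cut: "\<And>S T. S \<subseteq> V \<Longrightarrow> T \<subseteq> V \<Longrightarrow>
       \<bar>\<Sum>x\<in>S. \<Sum>y\<in>T. w x y - w' x y\<bar> \<le> \<epsilon> * (real (card V))\<^sup>2"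
  shows "\<bar>hom_sum q V Q (\<lambda>_. w) - hom_sum q V Q (\<lambda>_. w')\<bar> \<le> card Q * (\<epsilon> * real (card V) ^ q)"
proof -
  have finQ: "finite Q" using Q(1) by (rule finite_subset) auto
  have "\<bar>hom_sum q V Q (\<lambda>e. if e \<in> A then w else w') - hom_sum q V Q (\<lambda>_. w')\<bar>
      \<le> card A * (\<epsilon> * real (card V) ^ q)" if "finite A" "A \<subseteq> Q" for A
    using that
  proof (induction A)
    case (insert e A)
    obtain i j where e: "e = (i, j)" by (cases e)
    have "\<bar>hom_sum q V Q (\<lambda>e'. if e' \<in> insert e A then w else w') - hom_sum q V Q (\<lambda>e. if e \<in> A then w else w')\<bar>
        \<le> \<epsilon> * real (card V) ^ q"
    proof (rule hom_sum_change_edge[OF V, of i j])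
      show "(j, i) \<notin> Q" using insert.prems e Q(3) by (auto dest: asymD)
      show "\<bar>\<Sum>x\<in>S. \<Sum>y\<in>T. (if (i, j) \<in> insert e A then w else w') x y - (if (i, j) \<in> A then w else w') x y\<bar>
         \<le> \<epsilon> * (real (card V))\<^sup>2" if "S \<subseteq> V" "T \<subseteq> V" for S T
        using cut[OF that] insert.hyps e by simp
      show "i \<noteq> j" using insert.prems e Q(2) by (auto simp: irrefl_def)
    qed (use insert.prems e Q finQ w w' in auto)
    with insert show ?case by (simp add: algebra_simps)
  qed simp
  from this[OF finQ subset_refl] have "\<bar>hom_sum q V Q (\<lambda>e. if e \<in> Q then w else w') - hom_sum q V Q (\<lambda>_. w')\<bar>
      \<le> card Q * (\<epsilon> * real (card V) ^ q)" .
  moreover have "hom_sum q V Q (\<lambda>e. if e \<in> Q then w else w') = hom_sum q V Q (\<lambda>_. w)"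
    unfolding hom_sum_def by (intro sum.cong prod.cong refl) auto
  ultimately show ?thesis by simp
qed

section \<open>The limit of the block structure on the unit interval\<close>

text \<open>The homomorphism density of Q in a weighted digraph on m vertices with vertex weights
  \<mu> and edge weights D.\<close>

definition block_dens :: "nat \<Rightarrow> (nat \<times> nat) set \<Rightarrow> nat \<Rightarrow> (nat \<Rightarrow> real) \<Rightarrow> (nat \<Rightarrow> nat \<Rightarrow> real) \<Rightarrow> real" where
  "block_dens q Q m \<mu> D = (\<Sum>\<phi>\<in>{0..<q} \<rightarrow>\<^sub>E {..<m}. (\<Prod>i\<in>{0..<q}. \<mu> (\<phi> i)) * (\<Prod>e\<in>Q. D (\<phi> (fst e)) (\<phi> (snd e))))"

lemma space_unit_interval [simp]: "space unit_interval_space = {0..1}"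
  by (simp add: unit_interval_space_def space_restrict_space)

lemma prob_space_unit_interval: "prob_space unit_interval_space"
  by (intro prob_spaceI) (simp add: unit_interval_space_def emeasure_restrict_space space_restrict_space)

lemma sum_blocks_of_4:
  fixes f :: "nat \<Rightarrow> real"
  shows "(\<Sum>i<n. \<Sum>i'\<in>{4*i..<4*i+4}. f i') = (\<Sum>i'<4*n. f i')"
  using sum.nat_group[of f 4 n] by (simp add: mult.commute)

text \<open>Level k cuts [0, 1) into half-open intervals at the partial sums of
  \<open>\<mu> k\<close>. By the refinement identity these cut points recur as every fourth cut
  point of the next level, so the intervals are nested with labels related by
  \<open>div 4\<close>.\<close>

lemma unit_interval_cells:
  fixes \<mu> :: "nat \<Rightarrow> nat \<Rightarrow> real"
  assumes nonneg: "\<And>k i. 0 \<le> \<mu> k i" and total: "\<And>k. (\<Sum>i<4^k. \<mu> k i) = 1"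
    and refine: "\<And>k i. \<mu> k i = (\<Sum>i'\<in>{4*i..<4*i+4}. \<mu> (Suc k) i')"
  obtains c :: "nat \<Rightarrow> real \<Rightarrow> nat" where
    "\<And>k. c k \<in> measurable unit_interval_space (count_space UNIV)"
    "\<And>k u. c k u < 4 ^ k" "\<And>k u. c (Suc k) u div 4 = c k u"
    "\<And>k i. i < 4 ^ k \<Longrightarrow> measure unit_interval_space {u\<in>space unit_interval_space. c k u = i} = \<mu> k i"
proof -
  define F where "F k j = (\<Sum>i<j. \<mu> k i)" for k j
  have F0 [simp]: "F k 0 = 0" for k by (simp add: F_def)
  have F1: "F k (4 ^ k) = 1" for k using total by (simp add: F_def)
  have F_mono: "F k i \<le> F k j" if "i \<le> j" for k i j
    unfolding F_def using that nonneg by (intro sum_mono2) auto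
  have F_Suc: "F (Suc k) (4 * j) = F k j" for k j
    unfolding F_def using sum_blocks_of_4[of "\<mu> (Suc k)" j] by (simp flip: refine)
  \<comment> \<open>\<open>LEAST\<close> skips intervals of length 0. Points outside [0, 1) go to
    cell 0, which keeps the bound and the \<open>div 4\<close> relation true everywhere; the only
    such point of the space is 1, a null set.\<close>
  define c where "c k u = (if 0 \<le> u \<and> u < 1 then LEAST i. u < F k (Suc i) else 0)" for k u
  have c: "F k (c k u) \<le> u \<and> u < F k (Suc (c k u)) \<and> c k u < 4 ^ k" if "0 \<le> u" "u < 1" for k u
  proof -
    have *: "u < F k (Suc (4 ^ k - 1))" using that F1[of k] by simp
    have 1: "u < F k (Suc (c k u))" unfolding c_def using that by (simp add: LeastI[of "\<lambda>i. u < F k (Suc i)", OF *])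
    have "(LEAST i. u < F k (Suc i)) \<le> 4 ^ k - 1" by (rule Least_le) (rule *)
    then have "c k u \<le> 4 ^ k - 1" unfolding c_def using that by simp
    moreover have "(0::nat) < 4 ^ k" by simp
    ultimately have 2: "c k u < 4 ^ k" by linarith
    have "F k (c k u) \<le> u"
    proof (cases "c k u")
      case (Suc i)
      then have "\<not> u < F k (Suc i)" using that not_less_Least[of i "\<lambda>i. u < F k (Suc i)"] by (simp add: c_def)
      then show ?thesis using Suc by simp
    qed (use that in simp)
    with 1 2 show ?thesis by blast
  qed
  have c_eq: "c k u = i" if "0 \<le> u" "u < 1" "F k i \<le> u" "u < F k (Suc i)" for k u i
  proof (rule ccontr)
    assume "c k u \<noteq> i"
    then consider "Suc (c k u) \<le> i" | "Suc i \<le> c k u" by linarith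
    then show False
    proof cases
      case 1
      then show ?thesis using c[OF that(1,2), of k] that(3) F_mono[OF 1, of k] by linarith
    next
      case 2
      then show ?thesis using c[OF that(1,2), of k] that(4) F_mono[OF 2, of k] by linarith
    qed
  qed
  have out: "c k u = 0" if "\<not> (0 \<le> u \<and> u < 1)" for k u using that by (simp only: c_def if_False)
  have less: "c k u < 4 ^ k" for k u using c[of u k] out[of u k] by (cases "0 \<le> u \<and> u < 1") simp_all
  have div4: "c (Suc k) u div 4 = c k u" for k u
  proof (cases "0 \<le> u \<and> u < 1")
    case True
    let ?i = "c (Suc k) u"
    have "F k (?i div 4) \<le> F (Suc k) ?i"
      unfolding F_Suc[of k "?i div 4", symmetric] by (rule F_mono) simp
    moreover have "F (Suc k) (Suc ?i) \<le> F k (Suc (?i div 4))"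
      unfolding F_Suc[of k "Suc (?i div 4)", symmetric] by (rule F_mono) presburger
    ultimately show ?thesis
      using True c[of u "Suc k"] by (intro c_eq[symmetric]) auto
  qed (simp add: out)
  have meas: "c k \<in> measurable unit_interval_space (count_space UNIV)" for k
    unfolding c_def[abs_def] unit_interval_space_def
    by (intro measurable_restrict_space1) measurable
  have mass: "measure unit_interval_space {u\<in>space unit_interval_space. c k u = i} = \<mu> k i" if i: "i < 4 ^ k" for k i
  proof -
    let ?A = "{u\<in>{0..1}. c k u = i}"
    have Fi: "0 \<le> F k i" "F k i \<le> F k (Suc i)" "F k (Suc i) \<le> 1"
      using F_mono[of 0 i k] F_mono[of i "Suc i" k] F_mono[of "Suc i" "4^k" k] F1[of k] i by auto
    have meas: "?A \<in> sets lborel"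
      unfolding c_def[abs_def] by measurable
    have "measure unit_interval_space {u\<in>space unit_interval_space. c k u = i} = measure lborel ?A"
      unfolding unit_interval_space_def
      by (subst measure_restrict_space) (auto simp: space_restrict_space)
    also have "\<dots> = measure lborel {F k i..<F k (Suc i)}"
    proof (rule measure_eq_AE)
      show "AE u in lborel. u \<in> ?A \<longleftrightarrow> u \<in> {F k i..<F k (Suc i)}"
        using AE_lborel_singleton[of 1]
      proof eventually_elim
        case (elim u)
        show ?case
        proof (cases "0 \<le> u \<and> u < 1")
          case True
          then have "c k u = i \<longleftrightarrow> F k i \<le> u \<and> u < F k (Suc i)"
            using c[of u k] c_eq[of u k i] by blast
          with True show ?thesis by simp
        next
          case False
          then have "u < 0 \<or> 1 < u" using elim by linarith
          with Fi show ?thesis by auto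
        qed
      qed
    qed (use meas in auto)
    also have "\<dots> = F k (Suc i) - F k i" using Fi by simp
    also have "\<dots> = \<mu> k i" by (simp add: F_def)
    finally show ?thesis .
  qed
  show thesis by (rule that[OF meas less div4 mass])
qed

section \<open>Block data of posets and their limits\<close>

lemma hom_dens_eq_hom_sum:
  assumes "finite Q"
  shows "hom_dens (q, Q) (N, R) = hom_sum q {0..<N} Q (\<lambda>_ x y. of_bool ((x, y) \<in> R)) / real N ^ q"
proof -
  have "(\<Prod>e\<in>Q. of_bool ((f (fst e), f (snd e)) \<in> R) :: real) = of_bool (\<forall>(i,j)\<in>Q. (f i, f j) \<in> R)" for f :: "nat \<Rightarrow> nat"
    using assms by (induction Q) auto
  then have "hom_sum q {0..<N} Q (\<lambda>_ x y. of_bool ((x, y) \<in> R)) =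
     (\<Sum>f\<in>{0..<q} \<rightarrow>\<^sub>E {0..<N}. of_bool (\<forall>(i,j)\<in>Q. (f i, f j) \<in> R))"
    unfolding hom_sum_def by (intro sum.cong) auto
  also have "\<dots> = real (card {f \<in> {0..<q} \<rightarrow>\<^sub>E {0..<N}. \<forall>(i,j)\<in>Q. (f i, f j) \<in> R})"
    by (simp add: sum.If_cases of_bool_def Int_def finite_PiE)
  finally show ?thesis by (simp add: hom_dens_def)
qed

text \<open>Group the maps by the labels of their values: the maps with label vector \<phi> form a
  product of cells, and the summand is constant there.\<close>

lemma hom_sum_block_average_eq_block_dens:
  assumes V: "finite V" "V \<noteq> {}" and c: "\<And>x. x \<in> V \<Longrightarrow> c x < m" and Q: "Q \<subseteq> {0..<q} \<times> {0..<q}"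
  shows "hom_sum q V Q (\<lambda>_. block_average V w c) / real (card V) ^ q =
    block_dens q Q m (\<lambda>i. cell_card V c i / real (card V)) (cell_dens V w c)"
proof -
  let ?I = "{0..<q}"
  define g where "g f = restrict (\<lambda>i. c (f i)) ?I" for f :: "nat \<Rightarrow> 'a"
  define h where "h f = (\<Prod>e\<in>Q. block_average V w c (f (fst e)) (f (snd e)))" for f
  have "hom_sum q V Q (\<lambda>_. block_average V w c) = (\<Sum>\<phi>\<in>?I \<rightarrow>\<^sub>E {..<m}. \<Sum>f\<in>{f\<in>?I \<rightarrow>\<^sub>E V. g f = \<phi>}. h f)"
    unfolding hom_sum_def h_def[symmetric]
    by (rule sum.group[symmetric]) (use V c in \<open>auto simp: g_def PiE_iff intro!: finite_PiE\<close>)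
  also have "\<dots> = (\<Sum>\<phi>\<in>?I \<rightarrow>\<^sub>E {..<m}. (\<Prod>i\<in>?I. cell_card V c (\<phi> i)) * (\<Prod>e\<in>Q. cell_dens V w c (\<phi> (fst e)) (\<phi> (snd e))))"
  proof (rule sum.cong[OF refl])
    fix \<phi> assume \<phi>: "\<phi> \<in> ?I \<rightarrow>\<^sub>E {..<m}"
    have eq: "{f\<in>?I \<rightarrow>\<^sub>E V. g f = \<phi>} = (\<Pi>\<^sub>E i\<in>?I. {x\<in>V. c x = \<phi> i})"
      using \<phi> by (auto simp: g_def PiE_iff fun_eq_iff extensional_def)
    have "(\<Sum>f\<in>{f\<in>?I \<rightarrow>\<^sub>E V. g f = \<phi>}. h f) =
       (\<Sum>f\<in>{f\<in>?I \<rightarrow>\<^sub>E V. g f = \<phi>}. \<Prod>e\<in>Q. cell_dens V w c (\<phi> (fst e)) (\<phi> (snd e)))"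
      unfolding h_def block_average_def by (intro sum.cong prod.cong refl) (use Q in \<open>auto simp: g_def\<close>)
    also have "\<dots> = real (card (\<Pi>\<^sub>E i\<in>?I. {x\<in>V. c x = \<phi> i})) * (\<Prod>e\<in>Q. cell_dens V w c (\<phi> (fst e)) (\<phi> (snd e)))"
      by (simp add: eq)
    finally show "(\<Sum>f\<in>{f\<in>?I \<rightarrow>\<^sub>E V. g f = \<phi>}. h f) = (\<Prod>i\<in>?I. cell_card V c (\<phi> i)) * (\<Prod>e\<in>Q. cell_dens V w c (\<phi> (fst e)) (\<phi> (snd e)))"
      by (simp add: card_PiE cell_card_def)
  qed
  finally show ?thesis
    by (simp add: block_dens_def prod_dividef sum_divide_distrib)
qed

lemma sum_cell_refine:
  fixes h :: "'a \<Rightarrow> real"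
  assumes "finite V" "\<And>x. c' x div 4 = (c x :: nat)"
  shows "(\<Sum>x\<in>{x\<in>V. c x = i}. h x) = (\<Sum>i'\<in>{4*i..<4*i+4}. \<Sum>x\<in>{x\<in>V. c' x = i'}. h x)"
proof -
  have c: "c x = i \<longleftrightarrow> 4 * i \<le> c' x \<and> c' x < 4 * i + 4" for x
    unfolding assms(2)[symmetric] by presburger
  have "(\<Sum>i'\<in>{4*i..<4*i+4}. \<Sum>x\<in>{x\<in>V. c' x = i'}. h x) =
     (\<Sum>i'\<in>{4*i..<4*i+4}. \<Sum>x\<in>{x\<in>{x\<in>V. c x = i}. c' x = i'}. h x)"
    by (intro sum.cong refl) (auto simp: c)
  also have "\<dots> = (\<Sum>x\<in>{x\<in>V. c x = i}. h x)"
    by (rule sum.group) (use assms(1) in \<open>auto simp: c\<close>)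
  finally show ?thesis ..
qed

lemma cell_card_refine:
  assumes "finite V" "\<And>x. c' x div 4 = c x"
  shows "cell_card V c i = (\<Sum>i'\<in>{4*i..<4*i+4}. cell_card V c' i')"
  using sum_cell_refine[OF assms, where h = "\<lambda>_. 1"] by (simp add: cell_card_def)

lemma cell_sum_refine:
  assumes "finite V" "\<And>x. c' x div 4 = c x"
  shows "cell_sum V w c i j = (\<Sum>i'\<in>{4*i..<4*i+4}. \<Sum>j'\<in>{4*j..<4*j+4}. cell_sum V w c' i' j')"
proof -
  have "cell_sum V w c i j = (\<Sum>i'\<in>{4*i..<4*i+4}. \<Sum>x\<in>{x\<in>V. c' x = i'}. \<Sum>j'\<in>{4*j..<4*j+4}. \<Sum>y\<in>{y\<in>V. c' y = j'}. w x y)"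
    unfolding cell_sum_def by (simp only: sum_cell_refine[OF assms])
  also have "\<dots> = (\<Sum>i'\<in>{4*i..<4*i+4}. \<Sum>j'\<in>{4*j..<4*j+4}. cell_sum V w c' i' j')"
    unfolding cell_sum_def by (intro sum.cong refl sum.swap)
  finally show ?thesis .
qed

lemma refinement_less_power:
  fixes C :: "nat \<Rightarrow> 'a \<Rightarrow> nat"
  assumes "\<And>x. C 0 x = 0" "\<And>k x. C (Suc k) x div 4 = C k x"
  shows "C k x < 4 ^ k"
proof (induction k)
  case (Suc k)
  then have "C (Suc k) x div 4 < 4 ^ k" using assms(2) by simp
  then show ?case by (simp add: div_less_iff_less_mult mult.commute)
qed (simp add: assms)

text \<open>The last clause only promises closeness at arbitrarily high levels, because the good
  level for \<open>P n\<close> varies with n. The refinement of densities is stated after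
  multiplication by masses: masses may tend to 0, and the limit densities of such cells are not tied
  to those of the next level.\<close>

lemma poset_sequence_limit_template:
  fixes P :: "nat \<Rightarrow> pcode"
  assumes P: "\<And>n. valid_poset (P n)"
  obtains \<mu> :: "nat \<Rightarrow> nat \<Rightarrow> real" and D :: "nat \<Rightarrow> nat \<Rightarrow> nat \<Rightarrow> real" where
    "\<And>k i. 0 \<le> \<mu> k i" "\<And>k. (\<Sum>i<4^k. \<mu> k i) = 1"
    "\<And>k i. \<mu> k i = (\<Sum>i'\<in>{4*i..<4*i+4}. \<mu> (Suc k) i')"
    "\<And>k i j. 0 \<le> D k i j \<and> D k i j \<le> 1"
    "\<And>k i j. D k i j * \<mu> k i * \<mu> k j =
       (\<Sum>i'\<in>{4*i..<4*i+4}. \<Sum>j'\<in>{4*j..<4*j+4}. D (Suc k) i' j' * \<mu> (Suc k) i' * \<mu> (Suc k) j')"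
    "\<And>q Q a e L. Q \<subseteq> {0..<q} \<times> {0..<q} \<Longrightarrow> irrefl Q \<Longrightarrow> asym Q \<Longrightarrow>
       (\<lambda>n. hom_dens (q, Q) (P n)) \<longlonglongrightarrow> a \<Longrightarrow> e > 0 \<Longrightarrow>
       \<exists>k\<ge>L. \<bar>block_dens q Q (4^k) (\<mu> k) (D k) - a\<bar> \<le> e"
proof -
  define V where "V n = {0..<fst (P n)}" for n
  define N where "N n = real (card (V n))" for n
  define w where "w n x y = (of_bool ((x, y) \<in> snd (P n)) :: real)" for n x y
  have V: "finite (V n)" "V n \<noteq> {}" for n using P[of n] by (auto simp: V_def valid_poset_def)
  have N: "N n > 0" for n using V[of n] by (simp add: N_def card_gt_0_iff)
  have w01: "0 \<le> w n x y \<and> w n x y \<le> 1" for n x y by (simp add: w_def)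
  define good where "good n C \<longleftrightarrow> (\<forall>x. C 0 x = 0) \<and> (\<forall>k x. C (Suc k) x div 4 = C k x) \<and>
    (\<forall>k S T. S \<subseteq> V n \<longrightarrow> T \<subseteq> V n \<longrightarrow> (\<Sum>x\<in>S. \<Sum>y\<in>T. w n x y - block_average (V n) (w n) (C k) x y)\<^sup>2
           \<le> (N n)\<^sup>2 * (energy (V n) (w n) (C (Suc k)) - energy (V n) (w n) (C k)))" for n C
  have "\<exists>C. good n C" for n
    unfolding good_def N_def by (rule greedy_refinement[OF V(1), of n "w n"]) blast
  then obtain C where C: "\<And>n. good n (C n)" by metis
  have C0: "\<And>n x. C n 0 x = 0" and CS: "\<And>n k x. C n (Suc k) x div 4 = C n k x"
    using C unfolding good_def by simp_all
  have Ccut: "(\<Sum>x\<in>S. \<Sum>y\<in>T. w n x y - block_average (V n) (w n) (C n k) x y)\<^sup>2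
           \<le> (N n)\<^sup>2 * (energy (V n) (w n) (C n (Suc k)) - energy (V n) (w n) (C n k))"
    if "S \<subseteq> V n" "T \<subseteq> V n" for n k S T
    using C[of n] that unfolding good_def by simp
  have Cless: "C n k x < 4 ^ k" for n k x
    by (rule refinement_less_power) (use C0 CS in auto)
  define m where "m n k i = cell_card (V n) (C n k) i / N n" for n k i
  define d where "d n k i j = cell_dens (V n) (w n) (C n k) i j" for n k i j
  have d01: "0 \<le> d n k i j" "d n k i j \<le> 1" for n k i j
    unfolding d_def using cell_dens_bounds[OF V(1)] w01 by metis+
  have m01: "0 \<le> m n k i" "m n k i \<le> 1" for n k i
    using N[of n] V(1)[of n] by (auto simp: m_def cell_card_def N_def divide_le_eq intro!: card_mono)
  have mS: "m n k i = (\<Sum>i'\<in>{4*i..<4*i+4}. m n (Suc k) i')" for n k i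
    unfolding m_def by (subst cell_card_refine[OF V(1) CS]) (simp add: sum_divide_distrib)
  have dS: "d n k i j * m n k i * m n k j =
       (\<Sum>i'\<in>{4*i..<4*i+4}. \<Sum>j'\<in>{4*j..<4*j+4}. d n (Suc k) i' j' * m n (Suc k) i' * m n (Suc k) j')" for n k i j
  proof -
    have *: "d n k i j * m n k i * m n k j = cell_sum (V n) (w n) (C n k) i j / (N n)\<^sup>2" for k i j
      by (simp add: d_def m_def cell_sum_eq_dens[OF V(1)] power2_eq_square)
    show ?thesis unfolding * by (subst cell_sum_refine[OF V(1) CS]) (simp add: sum_divide_distrib)
  qed
  \<comment> \<open>All masses and densities form one bounded function on a countable index set, so
    a single diagonal subsequence serves them all. The masses ignore the last index, which is
    therefore set to 0 in \<open>\<mu>\<close>.\<close>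
  define F where "F n = (\<lambda>(b, k, i, j). if b then d n k i j else m n k i)" for n
  have "\<exists>r. strict_mono (r :: nat \<Rightarrow> nat) \<and> (\<forall>x. \<exists>l. (\<lambda>n. F (r n) x) \<longlonglongrightarrow> l)"
  proof (rule function_convergent_subsequence[of UNIV F 1])
    show "norm (F n x) \<le> 1" for n x using d01 m01 by (auto simp: F_def split: prod.split)
  qed auto
  then obtain r l where r: "strict_mono (r :: nat \<Rightarrow> nat)" and l: "\<And>x. (\<lambda>n. F (r n) x) \<longlonglongrightarrow> l x"
    by metis
  define \<mu> where "\<mu> k i = l (False, k, i, 0)" for k i
  define D where "D k i j = l (True, k, i, j)" for k i j
  have m_lim: "(\<lambda>n. m (r n) k i) \<longlonglongrightarrow> \<mu> k i" for k i
    using l[of "(False, k, i, 0)"] by (simp add: F_def \<mu>_def)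
  have d_lim: "(\<lambda>n. d (r n) k i j) \<longlonglongrightarrow> D k i j" for k i j
    using l[of "(True, k, i, j)"] by (simp add: F_def D_def)
  show thesis
  proof (rule that[of \<mu> D])
    show "0 \<le> \<mu> k i" for k i by (rule LIMSEQ_le_const[OF m_lim]) (use m01 in auto)
    show "0 \<le> D k i j \<and> D k i j \<le> 1" for k i j
      using LIMSEQ_le_const[OF d_lim] LIMSEQ_le_const2[OF d_lim] d01 by blast
    show \<mu>S: "\<mu> k i = (\<Sum>i'\<in>{4*i..<4*i+4}. \<mu> (Suc k) i')" for k i
    proof (rule LIMSEQ_unique[OF m_lim])
      show "(\<lambda>n. m (r n) k i) \<longlonglongrightarrow> (\<Sum>i'\<in>{4*i..<4*i+4}. \<mu> (Suc k) i')"
        unfolding mS[of _ k i] by (intro tendsto_intros m_lim)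
    qed
    show "D k i j * \<mu> k i * \<mu> k j =
       (\<Sum>i'\<in>{4*i..<4*i+4}. \<Sum>j'\<in>{4*j..<4*j+4}. D (Suc k) i' j' * \<mu> (Suc k) i' * \<mu> (Suc k) j')" for k i j
    proof (rule LIMSEQ_unique)
      show "(\<lambda>n. d (r n) k i j * m (r n) k i * m (r n) k j) \<longlonglongrightarrow> D k i j * \<mu> k i * \<mu> k j"
        by (intro tendsto_intros m_lim d_lim)
      show "(\<lambda>n. d (r n) k i j * m (r n) k i * m (r n) k j) \<longlonglongrightarrow>
        (\<Sum>i'\<in>{4*i..<4*i+4}. \<Sum>j'\<in>{4*j..<4*j+4}. D (Suc k) i' j' * \<mu> (Suc k) i' * \<mu> (Suc k) j')"
        unfolding dS[of _ k i j] by (intro tendsto_intros m_lim d_lim)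
    qed
    show "(\<Sum>i<4^k. \<mu> k i) = 1" for k
    proof (rule LIMSEQ_unique)
      show "(\<lambda>n. \<Sum>i<4^k. m (r n) k i) \<longlonglongrightarrow> (\<Sum>i<4^k. \<mu> k i)"
        by (intro tendsto_intros m_lim)
      have "(\<Sum>i<4^k. m n k i) = 1" for n
      proof -
        have "(\<Sum>i<4^k. \<Sum>x\<in>{x\<in>V n. C n k x = i}. 1 :: real) = (\<Sum>x\<in>V n. 1)"
          by (rule sum.group) (use V Cless in auto)
        then have "(\<Sum>i<4^k. cell_card (V n) (C n k) i) = N n" by (simp add: cell_card_def N_def)
        then show ?thesis using N[of n] by (simp add: m_def flip: sum_divide_distrib)
      qed
      then show "(\<lambda>n. \<Sum>i<4^k. m (r n) k i) \<longlonglongrightarrow> 1" by simp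
    qed
    fix q Q a e L
    assume Q: "Q \<subseteq> {0..<q} \<times> {0..<q}" "irrefl Q" "asym Q"
      and lim: "(\<lambda>n. hom_dens (q, Q) (P n)) \<longlonglongrightarrow> a" and e: "(e :: real) > 0"
    have finQ: "finite Q" using Q(1) by (rule finite_subset) auto
    define err where "err n k = \<bar>hom_dens (q, Q) (P n) - block_dens q Q (4^k) (m n k) (d n k)\<bar>" for n k
    \<comment> \<open>The length of the window of levels: the cut error 1 / sqrt K, summed over the
      edges of Q, is at most e / 2, for every n alike.\<close>
    obtain K :: nat where K: "K > 0" "real (card Q) / sqrt K \<le> e / 2"
    proof -
      obtain K :: nat where "K > (2 * real (card Q) / e)\<^sup>2" using reals_Archimedean2 by blast
      moreover then have "2 * real (card Q) / e < sqrt K" by (intro real_less_rsqrt)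
      moreover from calculation have "K > 0" by (cases K) auto
      ultimately show thesis using that[of K] e by (auto simp: field_simps)
    qed
    have bd: "err n k \<le> card Q * \<epsilon>"
      if cut: "\<And>S T. S \<subseteq> V n \<Longrightarrow> T \<subseteq> V n \<Longrightarrow> \<bar>\<Sum>x\<in>S. \<Sum>y\<in>T. w n x y - block_average (V n) (w n) (C n k) x y\<bar> \<le> \<epsilon> * (N n)\<^sup>2"
      for n k and \<epsilon> :: real
    proof -
      have "\<bar>hom_sum q (V n) Q (\<lambda>_. w n) - hom_sum q (V n) Q (\<lambda>_. block_average (V n) (w n) (C n k))\<bar> \<le> card Q * (\<epsilon> * N n ^ q)"
        unfolding N_def
        by (rule counting_lemma[OF V(1) Q])
           (use w01 cut d01[unfolded d_def] in \<open>auto simp: N_def block_average_def\<close>)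
      then have "\<bar>hom_sum q (V n) Q (\<lambda>_. w n) - hom_sum q (V n) Q (\<lambda>_. block_average (V n) (w n) (C n k))\<bar> / N n ^ q \<le> card Q * \<epsilon>"
        using N[of n] by (simp add: divide_le_eq mult.assoc)
      moreover have "hom_dens (q, Q) (P n) = hom_sum q (V n) Q (\<lambda>_. w n) / N n ^ q"
        using hom_dens_eq_hom_sum[OF finQ, of q "fst (P n)" "snd (P n)"]
        by (simp add: V_def N_def w_def[abs_def])
      moreover have "block_dens q Q (4^k) (m n k) (d n k) = hom_sum q (V n) Q (\<lambda>_. block_average (V n) (w n) (C n k)) / N n ^ q"
        unfolding m_def d_def N_def
        by (rule hom_sum_block_average_eq_block_dens[symmetric]) (use V Cless Q in auto)
      ultimately show ?thesis
        using N[of n] by (simp add: err_def abs_divide flip: diff_divide_distrib)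
    qed
    have "\<exists>k\<in>{L..<L+K}. err n k \<le> e / 2" for n
    proof -
      obtain k where k: "L \<le> k" "k < L + K" "\<And>S T. S \<subseteq> V n \<Longrightarrow> T \<subseteq> V n \<Longrightarrow>
        \<bar>\<Sum>x\<in>S. \<Sum>y\<in>T. w n x y - block_average (V n) (w n) (C n k) x y\<bar> \<le> (real (card (V n)))\<^sup>2 / sqrt K"
        using weak_regularity[where V = "V n" and w = "w n" and C = "C n" and K = K and L = L,
            OF V(1) V(2) w01 Ccut[where n = n, unfolded N_def] K(1)] by blast
      have "err n k \<le> card Q * (1 / sqrt K)"
        using bd[of n k "1 / sqrt K"] k(3) by (auto simp: N_def)
      also have "\<dots> \<le> e / 2" using K(2) by simp
      finally show ?thesis using k by (intro bexI[of _ k]) auto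
    qed
    then have "\<forall>n. \<exists>k. k \<in> {L..<L+K} \<and> err (r n) k \<le> e / 2"
      by blast
    then obtain \<kappa> where \<kappa>: "\<And>n. \<kappa> n \<in> {L..<L+K}"
      "\<And>n. err (r n) (\<kappa> n) \<le> e / 2"
      by metis
    \<comment> \<open>Pigeonhole: the window is finite, so some level in it is good for infinitely
      many n. At that fixed level the error converges, hence its limit is small.\<close>
    have "\<exists>k\<in>{L..<L+K}. \<exists>\<^sub>F n in sequentially. \<kappa> n = k"
    proof (rule ccontr)
      assume "\<not> ?thesis"
      then have "\<forall>k\<in>{L..<L+K}. \<forall>\<^sub>F n in sequentially. \<kappa> n \<noteq> k" by (simp add: frequently_def)
      then have "\<forall>\<^sub>F n in sequentially. \<forall>k\<in>{L..<L+K}. \<kappa> n \<noteq> k" by (subst eventually_ball_finite_distrib) auto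
      then have "\<forall>\<^sub>F n::nat in sequentially. False"
        by (rule eventually_mono) (use \<kappa>(1) in blast)
      then show False by simp
    qed
    then obtain k where k: "k \<in> {L..<L+K}" "\<exists>\<^sub>F n in sequentially. \<kappa> n = k" by blast
    have lim_err: "(\<lambda>n. err (r n) k)
       \<longlonglongrightarrow> \<bar>a - block_dens q Q (4^k) (\<mu> k) (D k)\<bar>"
      unfolding err_def block_dens_def
      by (intro tendsto_intros m_lim d_lim LIMSEQ_subseq_LIMSEQ[OF lim r, unfolded o_def])
    have freq: "\<exists>\<^sub>F n in sequentially. err (r n) k \<le> e / 2"
      using k(2) by (rule frequently_elim1) (use \<kappa>(2) in metis)
    have "\<bar>a - block_dens q Q (4^k) (\<mu> k) (D k)\<bar> \<le> e"
    proof (rule ccontr)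
      assume "\<not> ?thesis"
      then have "\<forall>\<^sub>F n in sequentially. e / 2 < err (r n) k"
        using e by (intro order_tendstoD(1)[OF lim_err]) auto
      with freq show False by (auto simp: frequently_def not_le)
    qed
    then show "\<exists>k\<ge>L. \<bar>block_dens q Q (4^k) (\<mu> k) (D k) - a\<bar> \<le> e"
      using k(1) by (auto simp: abs_minus_commute)
  qed
qed

section \<open>The limit kernel\<close>

lemma sum_of_bool_delta2:
  fixes g :: "nat \<Rightarrow> nat \<Rightarrow> real"
  assumes "a < n" "b < m"
  shows "(\<Sum>i<n. \<Sum>j<m. g i j * of_bool (a = i \<and> b = j)) = g a b"
proof -
  have "(\<Sum>j<m. g i j * of_bool (a = i \<and> b = j)) = g i b * of_bool (a = i)" for i
    using assms(2) by (cases "a = i") (simp_all add: of_bool_def if_distrib[of "\<lambda>z. g i _ * z"] sum.delta' cong: if_cong)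
  then show ?thesis
    using assms(1) by (simp add: of_bool_def if_distrib[of "\<lambda>z. g _ b * z"] sum.delta' cong: if_cong)
qed

section \<open>Step functions on nested cells as a martingale\<close>

text \<open>\<open>D_refine\<close> says that on blocks of positive mass a density is the weighted
  average of the densities of its sixteen sub-blocks, which is the martingale property of the step
  functions. Labels are controlled at all points, so later constructions are defined
  everywhere.\<close>

locale cell_template = prob_space M for M :: "'a measure" +
  fixes c :: "nat \<Rightarrow> 'a \<Rightarrow> nat" and \<mu> :: "nat \<Rightarrow> nat \<Rightarrow> real" and D :: "nat \<Rightarrow> nat \<Rightarrow> nat \<Rightarrow> real"
  assumes c_measurable [measurable]: "\<And>k. c k \<in> measurable M (count_space UNIV)"
    and c_less: "\<And>k x. c k x < 4 ^ k"
    and c_refine: "\<And>k x. c (Suc k) x div 4 = c k x"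
    and mass: "\<And>k i. i < 4 ^ k \<Longrightarrow> measure M {x\<in>space M. c k x = i} = \<mu> k i"
    and D_bounds: "\<And>k i j. 0 \<le> D k i j \<and> D k i j \<le> 1"
    and D_refine: "\<And>k i j. D k i j * \<mu> k i * \<mu> k j =
       (\<Sum>i'\<in>{4*i..<4*i+4}. \<Sum>j'\<in>{4*j..<4*j+4}. D (Suc k) i' j' * \<mu> (Suc k) i' * \<mu> (Suc k) j')"
begin

sublocale MM: pair_prob_space M M ..

abbreviation MM :: "('a \<times> 'a) measure" where "MM \<equiv> M \<Otimes>\<^sub>M M"

definition cell_int :: "nat \<Rightarrow> ('a \<times> 'a \<Rightarrow> real) \<Rightarrow> nat \<Rightarrow> nat \<Rightarrow> real" where
  "cell_int k f i j = (\<integral>z. f z * of_bool (c k (fst z) = i \<and> c k (snd z) = j) \<partial>MM)"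

definition U :: "nat \<Rightarrow> 'a \<times> 'a \<Rightarrow> real" where
  "U k z = D k (c k (fst z)) (c k (snd z))"

lemma measurable_cell_function:
  fixes h :: "nat \<Rightarrow> nat \<Rightarrow> 'b"
  shows "(\<lambda>z. h (c k (fst z)) (c k (snd z))) \<in> measurable MM (count_space UNIV)"
  by measurable

lemma U_measurable [measurable]: "U k \<in> borel_measurable MM"
  unfolding U_def[abs_def]
  by (rule measurable_compose[OF measurable_cell_function[of "D k"]]) simp

lemma U_bounds: "0 \<le> U k z" "U k z \<le> 1"
  using D_bounds by (auto simp: U_def)

lemma integrable_cell_part:
  assumes "integrable MM f"
  shows "integrable MM (\<lambda>z. f z * of_bool (c k (fst z) = i \<and> c k (snd z) = j) :: real)"
proof (rule Bochner_Integration.integrable_bound[OF assms])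
  have [measurable]: "f \<in> borel_measurable MM" using assms by auto
  show "(\<lambda>z. f z * of_bool (c k (fst z) = i \<and> c k (snd z) = j)) \<in> borel_measurable MM" by measurable
qed (auto simp: abs_mult)

lemma integral_times_cell_function:
  assumes f: "integrable MM f"
  shows "(\<integral>z. f z * h (c k (fst z)) (c k (snd z)) \<partial>MM) = (\<Sum>i<4^k. \<Sum>j<4^k. h i j * cell_int k f i j)"
proof -
  have "f z * h (c k (fst z)) (c k (snd z)) =
      (\<Sum>i<4^k. \<Sum>j<4^k. h i j * (f z * of_bool (c k (fst z) = i \<and> c k (snd z) = j)))" for z
    using sum_of_bool_delta2[OF c_less[of k "fst z"] c_less[of k "snd z"], of "\<lambda>i j. f z * h i j"]
    by (simp add: mult_ac)
  then have "(\<integral>z. f z * h (c k (fst z)) (c k (snd z)) \<partial>MM) =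
      (\<integral>z. (\<Sum>i<4^k. \<Sum>j<4^k. h i j * (f z * of_bool (c k (fst z) = i \<and> c k (snd z) = j))) \<partial>MM)"
    by simp
  also have "\<dots> = (\<Sum>i<4^k. \<integral>z. (\<Sum>j<4^k. h i j * (f z * of_bool (c k (fst z) = i \<and> c k (snd z) = j))) \<partial>MM)"
    by (intro Bochner_Integration.integral_sum Bochner_Integration.integrable_sum
        integrable_mult_right integrable_cell_part f)
  also have "\<dots> = (\<Sum>i<4^k. \<Sum>j<4^k. h i j * cell_int k f i j)"
    unfolding cell_int_def
  proof (rule sum.cong[OF refl])
    fix i
    show "(\<integral>z. (\<Sum>j<4^k. h i j * (f z * of_bool (c k (fst z) = i \<and> c k (snd z) = j))) \<partial>MM) =
      (\<Sum>j<4^k. h i j * (\<integral>z. f z * of_bool (c k (fst z) = i \<and> c k (snd z) = j) \<partial>MM))"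
      by (subst Bochner_Integration.integral_sum)
         (intro integrable_mult_right integrable_cell_part f, simp)
  qed
  finally show ?thesis .
qed

lemma cell_int_1:
  assumes "i < 4 ^ k" "j < 4 ^ k"
  shows "cell_int k (\<lambda>_. 1) i j = \<mu> k i * \<mu> k j"
proof -
  let ?A = "\<lambda>i. {x\<in>space M. c k x = i}"
  have A: "?A i \<in> sets M" for i by measurable
  have "cell_int k (\<lambda>_. 1) i j = (\<integral>z. indicator (?A i \<times> ?A j) z \<partial>MM)"
    unfolding cell_int_def by (intro Bochner_Integration.integral_cong) (auto simp: space_pair_measure indicator_def of_bool_def)
  also have "\<dots> = measure MM (?A i \<times> ?A j)"
    using A by (simp add: sets.Int_space_eq2)
  also have "\<dots> = measure M (?A i) * measure M (?A j)"
    using A by (simp add: measure_def emeasure_pair_measure_Times enn2real_mult)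
  finally show ?thesis using mass assms by simp
qed

lemma integral_cell_function:
  "(\<integral>z. h (c k (fst z)) (c k (snd z)) \<partial>MM) = (\<Sum>i<4^k. \<Sum>j<4^k. h i j * (\<mu> k i * \<mu> k j))"
  using integral_times_cell_function[of "\<lambda>_. 1" h k] by (simp add: cell_int_1)

text \<open>One step of the martingale property, tested against an arbitrary function of the coarser
  cells.\<close>

lemma integral_U_Suc:
  "(\<integral>z. U (Suc k) z * h (c k (fst z)) (c k (snd z)) \<partial>MM) = (\<integral>z. U k z * h (c k (fst z)) (c k (snd z)) \<partial>MM)"
proof -
  have "(\<integral>z. U (Suc k) z * h (c k (fst z)) (c k (snd z)) \<partial>MM) =
    (\<Sum>i<4*4^k. \<Sum>j<4*4^k. D (Suc k) i j * h (i div 4) (j div 4) * (\<mu> (Suc k) i * \<mu> (Suc k) j))"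
    using integral_cell_function[of "\<lambda>i j. D (Suc k) i j * h (i div 4) (j div 4)" "Suc k"]
    by (simp add: U_def c_refine)
  also have "\<dots> = (\<Sum>i<4^k. \<Sum>j<4^k. \<Sum>i'\<in>{4*i..<4*i+4}. \<Sum>j'\<in>{4*j..<4*j+4}.
      D (Suc k) i' j' * h (i' div 4) (j' div 4) * (\<mu> (Suc k) i' * \<mu> (Suc k) j'))"
    unfolding sum_blocks_of_4[symmetric] by (rule sum.cong[OF refl], rule sum.swap)
  also have "\<dots> = (\<Sum>i<4^k. \<Sum>j<4^k. h i j * (D k i j * \<mu> k i * \<mu> k j))"
  proof (intro sum.cong refl)
    fix i j
    have "(\<Sum>i'\<in>{4*i..<4*i+4}. \<Sum>j'\<in>{4*j..<4*j+4}.
      D (Suc k) i' j' * h (i' div 4) (j' div 4) * (\<mu> (Suc k) i' * \<mu> (Suc k) j')) =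
      (\<Sum>i'\<in>{4*i..<4*i+4}. \<Sum>j'\<in>{4*j..<4*j+4}. h i j * (D (Suc k) i' j' * \<mu> (Suc k) i' * \<mu> (Suc k) j'))"
    proof (intro sum.cong refl)
      fix i' j' assume "i' \<in> {4*i..<4*i+4}" "j' \<in> {4*j..<4*j+4}"
      then have "i' div 4 = i" "j' div 4 = j" by auto
      then show "D (Suc k) i' j' * h (i' div 4) (j' div 4) * (\<mu> (Suc k) i' * \<mu> (Suc k) j') =
        h i j * (D (Suc k) i' j' * \<mu> (Suc k) i' * \<mu> (Suc k) j')" by simp
    qed
    then show "(\<Sum>i'\<in>{4*i..<4*i+4}. \<Sum>j'\<in>{4*j..<4*j+4}.
      D (Suc k) i' j' * h (i' div 4) (j' div 4) * (\<mu> (Suc k) i' * \<mu> (Suc k) j')) = h i j * (D k i j * \<mu> k i * \<mu> k j)"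
      by (simp add: D_refine[of k i j] sum_distrib_left)
  qed
  also have "\<dots> = (\<integral>z. U k z * h (c k (fst z)) (c k (snd z)) \<partial>MM)"
    using integral_cell_function[of "\<lambda>i j. D k i j * h i j" k] by (simp add: U_def mult_ac)
  finally show ?thesis .
qed

lemma c_coarsen: "c (k + d) x div 4 ^ d = c k x"
proof (induction d)
  case (Suc d)
  have "c (k + Suc d) x div 4 ^ Suc d = c (Suc (k + d)) x div 4 div 4 ^ d"
    by (simp add: div_mult2_eq)
  with Suc show ?case by (simp add: c_refine)
qed simp

lemma integral_U_coarse:
  assumes "k \<le> l"
  shows "(\<integral>z. U l z * h (c k (fst z)) (c k (snd z)) \<partial>MM) = (\<integral>z. U k z * h (c k (fst z)) (c k (snd z)) \<partial>MM)"
proof -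
  have "(\<integral>z. U (k + d) z * h (c k (fst z)) (c k (snd z)) \<partial>MM) = (\<integral>z. U k z * h (c k (fst z)) (c k (snd z)) \<partial>MM)" for d
  proof (induction d)
    case (Suc d)
    with integral_U_Suc[of "k + d" "\<lambda>i j. h (i div 4 ^ d) (j div 4 ^ d)"]
    show ?case by (simp add: c_coarsen)
  qed simp
  from this[of "l - k"] assms show ?thesis by simp
qed

lemma U_integrable [simp]: "integrable MM (U k)"
  by (rule MM.P.integrable_const_bound[where B = 1]) (use U_bounds in auto)

text \<open>By the martingale property the cross term in a squared difference equals the coarser
  energy. Squared L2 distances are thus differences of the monotone bounded sequence
  \<open>En\<close>.\<close>

lemma U_L1_Cauchy:
  assumes e: "e > 0"
  shows "\<exists>N. \<forall>k\<ge>N. \<forall>l\<ge>N. (\<integral>z. \<bar>U k z - U l z\<bar> \<partial>MM) < e"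
proof -
  have abs_diff: "\<bar>U k z - U l z\<bar> \<le> 1" for k l z
    using U_bounds[of k z] U_bounds[of l z] by linarith
  define En where "En k = (\<integral>z. U k z * U k z \<partial>MM)" for k
  have int2: "integrable MM (\<lambda>z. U k z * U l z)" for k l
  proof (rule MM.P.integrable_const_bound[where B = 1])
    show "AE z in MM. norm (U k z * U l z) \<le> 1"
    proof (rule AE_I2)
      fix z show "norm (U k z * U l z) \<le> 1"
        using mult_le_one[OF U_bounds(2)[of k z] U_bounds[of l z]] U_bounds(1)[of k z] U_bounds(1)[of l z]
        by (simp add: abs_mult)
    qed
    show "(\<lambda>z. U k z * U l z) \<in> borel_measurable MM"
      by (rule borel_measurable_times[OF U_measurable U_measurable])
  qed
  have gap: "(\<integral>z. (U l z - U k z)\<^sup>2 \<partial>MM) = En l - En k" if "k \<le> l" for k l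
  proof -
    have "(\<integral>z. (U l z - U k z)\<^sup>2 \<partial>MM) = (\<integral>z. U l z * U l z - 2 * (U l z * U k z) + U k z * U k z \<partial>MM)"
      by (intro Bochner_Integration.integral_cong refl) (simp add: power2_eq_square algebra_simps)
    also have "\<dots> = En l - 2 * (\<integral>z. U l z * U k z \<partial>MM) + En k"
      unfolding En_def using int2 by simp
    also have "(\<integral>z. U l z * U k z \<partial>MM) = En k"
      using integral_U_coarse[OF that, of "D k"] by (simp add: En_def U_def)
    finally show ?thesis by simp
  qed
  have mono: "En k \<le> En l" if "k \<le> l" for k l
    using gap[OF that] Bochner_Integration.integral_nonneg[of MM "\<lambda>z. (U l z - U k z)\<^sup>2"] by simp
  have En1: "En k \<le> 1" for k
    unfolding En_def using int2
    by (intro MM.P.integral_le_const AE_I2) (simp_all add: mult_le_one U_bounds)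
  have En0: "0 \<le> En k" for k by (simp add: En_def)
  have "Bseq En" by (rule BseqI'[where K = 1]) (use En0 En1 in simp)
  then have "convergent En" using mono by (intro Bseq_mono_convergent) auto
  then have "Cauchy En" by (rule convergent_Cauchy)
  then obtain N where N: "\<And>k l. k \<ge> N \<Longrightarrow> l \<ge> N \<Longrightarrow> dist (En k) (En l) < e\<^sup>2"
    using metric_CauchyD[of En "e\<^sup>2"] e by auto
  have le: "(\<integral>z. \<bar>U l z - U k z\<bar> \<partial>MM) < e" if "N \<le> k" "k \<le> l" for k l
  proof -
    \<comment> \<open>For t = \<open>\<bar>U l z - U k z\<bar>\<close> the integrands compare
      because (t - e)^2 is nonnegative; this passes from L2 to L1 pointwise.\<close>
    have "(\<integral>z. \<bar>U l z - U k z\<bar> \<partial>MM) \<le> (\<integral>z. e / 2 + (U l z - U k z)\<^sup>2 / (2 * e) \<partial>MM)"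
    proof (rule integral_mono)
      have "integrable MM (\<lambda>z. U l z * U l z - 2 * (U l z * U k z) + U k z * U k z)"
        using int2 by simp
      also have "(\<lambda>z. U l z * U l z - 2 * (U l z * U k z) + U k z * U k z) = (\<lambda>z. (U l z - U k z)\<^sup>2)"
        by (auto simp: power2_eq_square algebra_simps)
      finally show "integrable MM (\<lambda>z. e / 2 + (U l z - U k z)\<^sup>2 / (2 * e))" by simp
      fix z
      define t where "t = \<bar>U l z - U k z\<bar>"
      have "0 \<le> (t - e)\<^sup>2 / (2 * e)" using e by simp
      also have "\<dots> = e / 2 + t\<^sup>2 / (2 * e) - t" using e by (simp add: power2_eq_square field_simps)
      finally show "\<bar>U l z - U k z\<bar> \<le> e / 2 + (U l z - U k z)\<^sup>2 / (2 * e)" by (simp add: t_def)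
    qed auto
    also have "\<dots> = e / 2 + (En l - En k) / (2 * e)"
    proof -
      have "integrable MM (\<lambda>z. (U l z - U k z)\<^sup>2)"
        by (rule MM.P.integrable_const_bound[where B = 1])
           (use abs_diff in \<open>auto intro!: AE_I2 simp: abs_square_le_1\<close>)
      then show ?thesis using gap[OF that(2)] by (simp add: MM.P.prob_space)
    qed
    also have "\<dots> < e / 2 + e\<^sup>2 / (2 * e)"
    proof -
      have "En l - En k < e\<^sup>2"
        using N[of k l] that mono[OF that(2)] by (simp add: dist_real_def)
      then show ?thesis using e by (simp add: divide_strict_right_mono)
    qed
    also have "\<dots> = e" using e by (simp add: power2_eq_square field_simps)
    finally show ?thesis .
  qed
  show ?thesis
  proof (intro exI allI impI)
    fix k l assume "N \<le> k" "N \<le> l"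
    then show "(\<integral>z. \<bar>U k z - U l z\<bar> \<partial>MM) < e"
      using le[of k l] le[of l k] by (cases "k \<le> l") (auto simp: abs_minus_commute)
  qed
qed

text \<open>A subsequence that is Cauchy almost everywhere supplies the limit; the L1 Cauchy
  property then carries the convergence over to the full sequence.\<close>

lemma U_L1_limit:
  obtains W where "W \<in> borel_measurable MM" "\<And>z. 0 \<le> W z \<and> W z \<le> (1::real)"
    "(\<lambda>k. \<integral>z. \<bar>U k z - W z\<bar> \<partial>MM) \<longlonglongrightarrow> 0"
proof -
  obtain r where r: "strict_mono r" "AE z in MM. Cauchy (\<lambda>i. U (r i) z)"
  proof (rule cauchy_L1_AE_cauchy_subseq[of MM U])
    show "\<exists>N. \<forall>i\<ge>N. \<forall>j\<ge>N. (\<integral>z. norm (U i z - U j z) \<partial>MM) < e" if "0 < e" for e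
      using U_L1_Cauchy[OF that] by simp
  qed simp
  \<comment> \<open>Where the subsequence diverges \<open>lim\<close> is unspecified; the clamp puts
    the values in [0, 1] at every point.\<close>
  define W where "W z = max 0 (min 1 (lim (\<lambda>i. U (r i) z)))" for z
  have W_meas [measurable]: "W \<in> borel_measurable MM" unfolding W_def[abs_def] by measurable
  have W_bounds: "0 \<le> W z" "W z \<le> 1" for z by (auto simp: W_def)
  have lim: "AE z in MM. (\<lambda>i. U (r i) z) \<longlonglongrightarrow> W z"
    using r(2)
  proof eventually_elim
    case (elim z)
    then have *: "(\<lambda>i. U (r i) z) \<longlonglongrightarrow> lim (\<lambda>i. U (r i) z)"
      by (simp add: Cauchy_convergent_iff convergent_LIMSEQ_iff)
    have "0 \<le> lim (\<lambda>i. U (r i) z)" by (rule LIMSEQ_le_const[OF *]) (use U_bounds in auto)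
    moreover have "lim (\<lambda>i. U (r i) z) \<le> 1" by (rule LIMSEQ_le_const2[OF *]) (use U_bounds in auto)
    ultimately have "0 \<le> lim (\<lambda>i. U (r i) z)" "lim (\<lambda>i. U (r i) z) \<le> 1" .
    with * show ?case by (simp add: W_def)
  qed
  have "(\<lambda>k. \<integral>z. \<bar>U k z - W z\<bar> \<partial>MM) \<longlonglongrightarrow> 0"
  proof (rule LIMSEQ_I)
    fix e :: real assume "0 < e"
    then obtain N where N: "\<And>k l. k \<ge> N \<Longrightarrow> l \<ge> N \<Longrightarrow> (\<integral>z. \<bar>U k z - U l z\<bar> \<partial>MM) < e / 2"
      using U_L1_Cauchy[of "e / 2"] by auto
    have "norm ((\<integral>z. \<bar>U k z - W z\<bar> \<partial>MM) - 0) < e" if "k \<ge> N" for k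
    proof -
      have conv: "(\<lambda>i. \<integral>z. \<bar>U k z - U (r i) z\<bar> \<partial>MM) \<longlonglongrightarrow> (\<integral>z. \<bar>U k z - W z\<bar> \<partial>MM)"
      proof (rule integral_dominated_convergence[where w = "\<lambda>_. 1"])
        show "AE z in MM. (\<lambda>i. \<bar>U k z - U (r i) z\<bar>) \<longlonglongrightarrow> \<bar>U k z - W z\<bar>"
          using lim by eventually_elim (intro tendsto_intros)
        show "AE z in MM. norm \<bar>U k z - U (r i) z\<bar> \<le> 1" for i
        proof (rule AE_I2)
          fix z show "norm \<bar>U k z - U (r i) z\<bar> \<le> 1"
            using U_bounds[of k z] U_bounds[of "r i" z] by (simp add: abs_le_iff)
        qed
      qed auto
      have "(\<integral>z. \<bar>U k z - W z\<bar> \<partial>MM) \<le> e / 2"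
      proof (rule LIMSEQ_le_const2[OF conv], intro exI allI impI)
        fix i assume "N \<le> i"
        then have "N \<le> r i" using seq_suble[OF r(1), of i] by simp
        with N[OF that] show "(\<integral>z. \<bar>U k z - U (r i) z\<bar> \<partial>MM) \<le> e / 2" by (simp add: less_imp_le)
      qed
      moreover have "0 \<le> (\<integral>z. \<bar>U k z - W z\<bar> \<partial>MM)" by simp
      ultimately show ?thesis using \<open>0 < e\<close> by simp
    qed
    then show "\<exists>no. \<forall>n\<ge>no. norm ((\<integral>z. \<bar>U n z - W z\<bar> \<partial>MM) - 0) < e" by blast
  qed
  then show thesis using W_bounds by (intro that[OF W_meas]) blast+
qed

end

section \<open>Continuity of kernel densities in L1\<close>

lemma (in prob_space) distr_PiM_two_components:
  assumes I: "finite I" "i \<in> I" "j \<in> I" "i \<noteq> j"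
  shows "distr (PiM I (\<lambda>_. M)) (M \<Otimes>\<^sub>M M) (\<lambda>x. (x i, x j)) = M \<Otimes>\<^sub>M M"
proof (rule pair_measure_eqI[symmetric])
  interpret PP: product_prob_space "\<lambda>_. M" I
    by (rule product_prob_spaceI) (rule prob_space_axioms)
  show "sigma_finite_measure M" "sigma_finite_measure M" by unfold_locales
  show "sets (M \<Otimes>\<^sub>M M) = sets (distr (PiM I (\<lambda>_. M)) (M \<Otimes>\<^sub>M M) (\<lambda>x. (x i, x j)))" by simp
  have [measurable]: "(\<lambda>x. (x i, x j)) \<in> measurable (PiM I (\<lambda>_. M)) (M \<Otimes>\<^sub>M M)"
    using I by measurable
  fix A B assume A: "A \<in> sets M" and B: "B \<in> sets M"
  define E where "E k = (if k = i then A else if k = j then B else space M)" for k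
  have "(\<lambda>x. (x i, x j)) -` (A \<times> B) \<inter> space (PiM I (\<lambda>_. M)) = PiE I E"
  proof (intro set_eqI iffI)
    fix x assume "x \<in> PiE I E"
    moreover have "E k \<subseteq> space M" for k
      using sets.sets_into_space[OF A] sets.sets_into_space[OF B] by (simp add: E_def)
    ultimately have "x \<in> space (PiM I (\<lambda>_. M))" "x i \<in> E i" "x j \<in> E j"
      using I by (auto simp: space_PiM PiE_iff)
    then show "x \<in> (\<lambda>x. (x i, x j)) -` (A \<times> B) \<inter> space (PiM I (\<lambda>_. M))"
      using I by (simp add: E_def)
  qed (use I in \<open>auto simp: space_PiM E_def PiE_iff\<close>)
  then have "emeasure (distr (PiM I (\<lambda>_. M)) (M \<Otimes>\<^sub>M M) (\<lambda>x. (x i, x j))) (A \<times> B) = emeasure (PiM I (\<lambda>_. M)) (PiE I E)"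
    using A B by (subst emeasure_distr) auto
  also have "\<dots> = (\<Prod>k\<in>I. emeasure M (E k))"
    using A B I(1) by (intro PP.emeasure_PiM) (auto simp: E_def)
  also have "\<dots> = emeasure M A * emeasure M B"
  proof -
    have "(\<Prod>k\<in>I. emeasure M (E k)) = emeasure M (E i) * (emeasure M (E j) * (\<Prod>k\<in>I - {i} - {j}. emeasure M (E k)))"
      using I by (simp add: prod.remove[of I i] prod.remove[of "I - {i}" j])
    also have "(\<Prod>k\<in>I - {i} - {j}. emeasure M (E k)) = 1"
      by (intro prod.neutral) (auto simp: E_def emeasure_space_1)
    finally show ?thesis using I by (simp add: E_def)
  qed
  finally show "emeasure M A * emeasure M B =
      emeasure (distr (PiM I (\<lambda>_. M)) (M \<Otimes>\<^sub>M M) (\<lambda>x. (x i, x j))) (A \<times> B)" ..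
qed

text \<open>Two products of factors in [0, 1] differ by at most the sum of the differences of their
  factors. Irreflexivity makes every edge see two distinct coordinates, whose joint law is the
  product measure, so each edge contributes exactly one L1 distance.\<close>

lemma (in prob_space) kernel_dens_L1_continuous:
  assumes Q: "Q \<subseteq> {0..<q} \<times> {0..<q}" "irrefl Q"
    and [measurable]: "w \<in> borel_measurable (M \<Otimes>\<^sub>M M)" "w' \<in> borel_measurable (M \<Otimes>\<^sub>M M)"
    and w: "\<And>z. z \<in> space (M \<Otimes>\<^sub>M M) \<Longrightarrow> 0 \<le> w z \<and> w z \<le> (1::real)"
    and w': "\<And>z. z \<in> space (M \<Otimes>\<^sub>M M) \<Longrightarrow> 0 \<le> w' z \<and> w' z \<le> (1::real)"
  shows "\<bar>kernel_dens M (\<lambda>x y. w (x, y)) (q, Q) - kernel_dens M (\<lambda>x y. w' (x, y)) (q, Q)\<bar>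
    \<le> card Q * (\<integral>z. \<bar>w z - w' z\<bar> \<partial>(M \<Otimes>\<^sub>M M))"
proof -
  let ?I = "{0..<q}"
  let ?MM = "M \<Otimes>\<^sub>M M"
  let ?P = "PiM ?I (\<lambda>_. M)"
  interpret PP: product_prob_space "\<lambda>_. M" ?I
    by (rule product_prob_spaceI) (rule prob_space_axioms)
  have fin_P: "finite_measure ?P"
    by (intro prob_space.axioms(1) prob_space_PiM prob_space_axioms)
  interpret MM: pair_prob_space M M ..
  have proj [measurable]: "(\<lambda>x. (x i, x j)) \<in> measurable ?P ?MM" if "(i, j) \<in> Q" for i j
    using that Q(1) by (intro measurable_Pair measurable_component_singleton) auto
  have sp: "(x i, x j) \<in> space ?MM" if "(i, j) \<in> Q" "x \<in> space ?P" for i j x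
    using that(1) measurable_space[OF proj[OF that(1)] that(2)] by simp
  have int: "integrable ?P (\<lambda>x. \<Prod>(i,j)\<in>Q. v (x i, x j))"
    if [measurable]: "v \<in> borel_measurable ?MM"
      and v: "\<And>z. z \<in> space ?MM \<Longrightarrow> 0 \<le> v z \<and> v z \<le> (1::real)" for v
  proof (rule finite_measure.integrable_const_bound[OF fin_P, where B = 1])
    have "norm (\<Prod>(i,j)\<in>Q. v (x i, x j)) \<le> 1" if "x \<in> space ?P" for x
      unfolding prod_norm[symmetric] by (rule prod_le_1) (use v sp that in auto)
    then show "AE x in ?P. norm (\<Prod>(i,j)\<in>Q. v (x i, x j)) \<le> 1" by (intro AE_I2)
    have "(\<lambda>x. v (x (fst e), x (snd e))) \<in> borel_measurable ?P" if "e \<in> Q" for e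
      using proj[of "fst e" "snd e"] that by (intro measurable_compose[OF _ \<open>v \<in> _\<close>]) auto
    then show "(\<lambda>x. \<Prod>(i,j)\<in>Q. v (x i, x j)) \<in> borel_measurable ?P"
      unfolding case_prod_unfold by (intro borel_measurable_prod)
  qed
  have dist: "integrable ?MM (\<lambda>z. \<bar>w z - w' z\<bar>)"
  proof (rule MM.P.integrable_const_bound[where B = 1])
    show "AE z in ?MM. norm \<bar>w z - w' z\<bar> \<le> 1"
    proof (rule AE_I2)
      fix z assume "z \<in> space ?MM"
      then show "norm \<bar>w z - w' z\<bar> \<le> 1" using w[of z] w'[of z] by (simp add: abs_le_iff)
    qed
  qed simp
  have edge: "integrable ?P (\<lambda>x. \<bar>w (x i, x j) - w' (x i, x j)\<bar>)"
      "(\<integral>x. \<bar>w (x i, x j) - w' (x i, x j)\<bar> \<partial>?P) = (\<integral>z. \<bar>w z - w' z\<bar> \<partial>?MM)"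
    if e: "(i, j) \<in> Q" for i j
  proof -
    have eq: "distr ?P ?MM (\<lambda>x. (x i, x j)) = ?MM"
      using Q e by (intro distr_PiM_two_components) (auto simp: irrefl_def)
    have meas: "(\<lambda>z. \<bar>w z - w' z\<bar>) \<in> borel_measurable ?MM" by measurable
    have "integrable (distr ?P ?MM (\<lambda>x. (x i, x j))) (\<lambda>z. \<bar>w z - w' z\<bar>)"
      using dist by (simp only: eq)
    then show "integrable ?P (\<lambda>x. \<bar>w (x i, x j) - w' (x i, x j)\<bar>)"
      by (simp only: integrable_distr_eq[OF proj[OF e] meas])
    have "(\<integral>z. \<bar>w z - w' z\<bar> \<partial>?MM) = (\<integral>z. \<bar>w z - w' z\<bar> \<partial>(distr ?P ?MM (\<lambda>x. (x i, x j))))"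
      by (simp only: eq)
    also have "\<dots> = (\<integral>x. \<bar>w (x i, x j) - w' (x i, x j)\<bar> \<partial>?P)"
      by (rule integral_distr[OF proj[OF e] meas])
    finally show "(\<integral>x. \<bar>w (x i, x j) - w' (x i, x j)\<bar> \<partial>?P) = (\<integral>z. \<bar>w z - w' z\<bar> \<partial>?MM)" ..
  qed
  have "\<bar>kernel_dens M (\<lambda>x y. w (x, y)) (q, Q) - kernel_dens M (\<lambda>x y. w' (x, y)) (q, Q)\<bar> =
     \<bar>\<integral>x. (\<Prod>(i,j)\<in>Q. w (x i, x j)) - (\<Prod>(i,j)\<in>Q. w' (x i, x j)) \<partial>?P\<bar>"
    using int[of w] int[of w'] w w' by (simp add: kernel_dens_def)
  also have "\<dots> \<le> (\<integral>x. \<bar>(\<Prod>(i,j)\<in>Q. w (x i, x j)) - (\<Prod>(i,j)\<in>Q. w' (x i, x j))\<bar> \<partial>?P)"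
    by (rule integral_abs_bound)
  also have "\<dots> \<le> (\<integral>x. (\<Sum>(i,j)\<in>Q. \<bar>w (x i, x j) - w' (x i, x j)\<bar>) \<partial>?P)"
  proof (rule integral_mono)
    show "integrable ?P (\<lambda>x. \<bar>(\<Prod>(i,j)\<in>Q. w (x i, x j)) - (\<Prod>(i,j)\<in>Q. w' (x i, x j))\<bar>)"
      using int[of w] int[of w'] w w' by simp
    show "integrable ?P (\<lambda>x. \<Sum>(i,j)\<in>Q. \<bar>w (x i, x j) - w' (x i, x j)\<bar>)"
      using edge(1) by (auto simp: case_prod_unfold)
    fix x assume x: "x \<in> space ?P"
    have "norm ((\<Prod>e\<in>Q. w (x (fst e), x (snd e))) - (\<Prod>e\<in>Q. w' (x (fst e), x (snd e))))
      \<le> (\<Sum>e\<in>Q. norm (w (x (fst e), x (snd e)) - w' (x (fst e), x (snd e))))"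
    proof (rule norm_prod_diff)
      fix e assume "e \<in> Q"
      then have "(x (fst e), x (snd e)) \<in> space ?MM" using sp[of "fst e" "snd e" x] x by simp
      then show "norm (w (x (fst e), x (snd e))) \<le> 1" "norm (w' (x (fst e), x (snd e))) \<le> 1"
        using w w' by auto
    qed
    then show "\<bar>(\<Prod>(i,j)\<in>Q. w (x i, x j)) - (\<Prod>(i,j)\<in>Q. w' (x i, x j))\<bar> \<le> (\<Sum>(i,j)\<in>Q. \<bar>w (x i, x j) - w' (x i, x j)\<bar>)"
      by (simp add: case_prod_unfold)
  qed
  also have "\<dots> = (\<Sum>(i,j)\<in>Q. \<integral>x. \<bar>w (x i, x j) - w' (x i, x j)\<bar> \<partial>?P)"
    unfolding case_prod_unfold using edge(1) by (intro Bochner_Integration.integral_sum) auto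
  also have "\<dots> = (\<Sum>(i,j)\<in>Q. \<integral>z. \<bar>w z - w' z\<bar> \<partial>?MM)"
    by (intro sum.cong refl) (use edge(2) in auto)
  also have "\<dots> = card Q * (\<integral>z. \<bar>w z - w' z\<bar> \<partial>?MM)" by simp
  finally show ?thesis .
qed

lemma (in prob_space) kernel_dens_cong_AE:
  assumes Q: "Q \<subseteq> {0..<q} \<times> {0..<q}" "irrefl Q"
    and w: "w \<in> borel_measurable (M \<Otimes>\<^sub>M M)" "w' \<in> borel_measurable (M \<Otimes>\<^sub>M M)"
     "\<And>z. z \<in> space (M \<Otimes>\<^sub>M M) \<Longrightarrow> 0 \<le> w z \<and> w z \<le> (1::real)"
     "\<And>z. z \<in> space (M \<Otimes>\<^sub>M M) \<Longrightarrow> 0 \<le> w' z \<and> w' z \<le> (1::real)"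
    and eq: "AE z in M \<Otimes>\<^sub>M M. w z = w' z"
  shows "kernel_dens M (\<lambda>x y. w (x, y)) (q, Q) = kernel_dens M (\<lambda>x y. w' (x, y)) (q, Q)"
proof -
  have "(\<integral>z. \<bar>w z - w' z\<bar> \<partial>(M \<Otimes>\<^sub>M M)) = (\<integral>z. 0 \<partial>(M \<Otimes>\<^sub>M M))"
    using w(1,2) eq by (intro integral_cong_AE) auto
  then show ?thesis using kernel_dens_L1_continuous[OF Q w] by simp
qed

context cell_template
begin

text \<open>Expand over all label vectors \<phi>: at each point exactly one indicator survives, and
  each indicator factors over independent coordinates.\<close>

lemma kernel_dens_U:
  assumes Q: "Q \<subseteq> {0..<q} \<times> {0..<q}"
  shows "kernel_dens M (\<lambda>x y. U k (x, y)) (q, Q) = block_dens q Q (4^k) (\<mu> k) (D k)"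
proof -
  let ?I = "{0..<q}"
  let ?P = "PiM ?I (\<lambda>_. M)"
  let ?F = "?I \<rightarrow>\<^sub>E {..<(4::nat)^k}"
  interpret PP: product_prob_space "\<lambda>_. M" ?I
    by (rule product_prob_spaceI) (rule prob_space_axioms)
  define d where "d \<phi> = (\<Prod>e\<in>Q. D k (\<phi> (fst e)) (\<phi> (snd e)))" for \<phi>
  have finF: "finite ?F" by (intro finite_PiE) auto
  have expand: "(\<Prod>(i,j)\<in>Q. U k (x i, x j)) = (\<Sum>\<phi>\<in>?F. (\<Prod>i\<in>?I. of_bool (c k (x i) = \<phi> i)) * d \<phi>)" for x
  proof -
    define \<psi> where "\<psi> = restrict (\<lambda>i. c k (x i)) ?I"
    have \<psi>: "\<psi> \<in> ?F" using c_less by (auto simp: \<psi>_def)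
    have "(\<Prod>i\<in>?I. of_bool (c k (x i) = \<phi> i)) = (of_bool (\<phi> = \<psi>) :: real)" if \<phi>: "\<phi> \<in> ?F" for \<phi>
    proof (cases "\<phi> = \<psi>")
      case False
      then obtain i where "i \<in> ?I" "\<phi> i \<noteq> \<psi> i" using PiE_ext[OF \<phi> \<psi>] by auto
      then have "(\<Prod>i\<in>?I. of_bool (c k (x i) = \<phi> i)) = (0 :: real)" by (intro prod_zero bexI[of _ i]) (auto simp: \<psi>_def)
      with False show ?thesis by simp
    qed (auto simp: \<psi>_def)
    then have "(\<Sum>\<phi>\<in>?F. (\<Prod>i\<in>?I. of_bool (c k (x i) = \<phi> i)) * d \<phi>) = (\<Sum>\<phi>\<in>?F. of_bool (\<phi> = \<psi>) * d \<phi>)"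
      by (intro sum.cong) auto
    also have "\<dots> = (\<Sum>\<phi>\<in>?F. if \<phi> = \<psi> then d \<phi> else 0)" by (intro sum.cong) auto
    also have "\<dots> = d \<psi>" using \<psi> finF by simp
    also have "\<dots> = (\<Prod>(i,j)\<in>Q. U k (x i, x j))"
      unfolding d_def case_prod_unfold U_def by (intro prod.cong refl) (use Q in \<open>auto simp: \<psi>_def\<close>)
    finally show ?thesis ..
  qed
  have int1: "integrable M (\<lambda>y. of_bool (c k y = i) :: real)" for i
    by (rule integrable_const_bound[where B = 1]) auto
  have int: "integrable ?P (\<lambda>x. (\<Prod>i\<in>?I. of_bool (c k (x i) = \<phi> i) :: real))" for \<phi>
    by (rule PP.product_integrable_prod) (use int1 in auto)
  have val: "(\<integral>x. (\<Prod>i\<in>?I. of_bool (c k (x i) = \<phi> i)) \<partial>?P) = (\<Prod>i\<in>?I. \<mu> k (\<phi> i))" if "\<phi> \<in> ?F" for \<phi>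
  proof -
    have "(\<integral>x. (\<Prod>i\<in>?I. of_bool (c k (x i) = \<phi> i)) \<partial>?P) = (\<Prod>i\<in>?I. \<integral>y. of_bool (c k y = \<phi> i) \<partial>M :: real)"
      using PP.product_integral_prod[of ?I "\<lambda>i y. of_bool (c k y = \<phi> i) :: real"] int1 by simp
    also have "\<dots> = (\<Prod>i\<in>?I. \<mu> k (\<phi> i))"
    proof (intro prod.cong refl)
      fix i assume i: "i \<in> ?I"
      have "(\<integral>y. of_bool (c k y = \<phi> i) \<partial>M) = (\<integral>y. indicator {y\<in>space M. c k y = \<phi> i} y \<partial>M :: real)"
        by (intro Bochner_Integration.integral_cong) (auto simp: indicator_def of_bool_def)
      also have "\<dots> = measure M {y\<in>space M. c k y = \<phi> i}" by simp
      also have "\<dots> = \<mu> k (\<phi> i)" using that i by (intro mass) auto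
      finally show "(\<integral>y. of_bool (c k y = \<phi> i) \<partial>M) = \<mu> k (\<phi> i)" .
    qed
    finally show ?thesis .
  qed
  have "kernel_dens M (\<lambda>x y. U k (x, y)) (q, Q) = (\<integral>x. (\<Sum>\<phi>\<in>?F. (\<Prod>i\<in>?I. of_bool (c k (x i) = \<phi> i)) * d \<phi>) \<partial>?P)"
    by (simp add: kernel_dens_def expand)
  also have "\<dots> = (\<Sum>\<phi>\<in>?F. (\<integral>x. (\<Prod>i\<in>?I. of_bool (c k (x i) = \<phi> i)) * d \<phi> \<partial>?P))"
    by (intro Bochner_Integration.integral_sum integrable_mult_left int)
  also have "\<dots> = (\<Sum>\<phi>\<in>?F. (\<Prod>i\<in>?I. \<mu> k (\<phi> i)) * d \<phi>)"
    by (intro sum.cong refl) (simp add: val)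
  finally show ?thesis by (simp add: block_dens_def d_def)
qed

text \<open>By L1 continuity the block densities converge along all levels, so a number they
  approach at arbitrarily high levels is their limit.\<close>

lemma kernel_dens_L1_limit:
  assumes Q: "Q \<subseteq> {0..<q} \<times> {0..<q}" "irrefl Q"
    and W: "W \<in> borel_measurable MM" "\<And>z. 0 \<le> W z \<and> W z \<le> (1::real)"
      "(\<lambda>k. \<integral>z. \<bar>U k z - W z\<bar> \<partial>MM) \<longlonglongrightarrow> 0"
    and cluster: "\<And>e L. e > 0 \<Longrightarrow> \<exists>k\<ge>L. \<bar>block_dens q Q (4^k) (\<mu> k) (D k) - a\<bar> \<le> e"
  shows "kernel_dens M (\<lambda>x y. W (x, y)) (q, Q) = a"
proof (rule ccontr)
  let ?t = "kernel_dens M (\<lambda>x y. W (x, y)) (q, Q)"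
  assume "?t \<noteq> a"
  define e where "e = \<bar>?t - a\<bar> / 3"
  have e: "e > 0" using \<open>?t \<noteq> a\<close> by (simp add: e_def)
  have "(\<lambda>k. card Q * (\<integral>z. \<bar>U k z - W z\<bar> \<partial>MM)) \<longlonglongrightarrow> real (card Q) * 0"
    by (intro tendsto_intros W)
  then have "\<forall>\<^sub>F k in sequentially. card Q * (\<integral>z. \<bar>U k z - W z\<bar> \<partial>MM) < e"
    using e by (intro order_tendstoD(2)) auto
  then obtain L where L: "\<And>k. k \<ge> L \<Longrightarrow> card Q * (\<integral>z. \<bar>U k z - W z\<bar> \<partial>MM) < e"
    by (auto simp: eventually_sequentially)
  obtain k where k: "k \<ge> L" "\<bar>block_dens q Q (4^k) (\<mu> k) (D k) - a\<bar> \<le> e" using cluster[OF e] by blast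
  have "\<bar>block_dens q Q (4^k) (\<mu> k) (D k) - ?t\<bar> < e"
    using kernel_dens_L1_continuous[OF Q U_measurable W(1), of k] U_bounds W(2) L[OF k(1)]
    by (simp add: kernel_dens_U[OF Q(1)])
  with k(2) have "\<bar>?t - a\<bar> < 2 * e" by linarith
  then show False using e by (simp add: e_def)
qed

end

section \<open>From almost everywhere to everywhere\<close>

lemma (in prob_space) nn_integral_PiM_3:
  assumes [measurable]: "f \<in> borel_measurable (M \<Otimes>\<^sub>M (M \<Otimes>\<^sub>M M))"
  shows "(\<integral>\<^sup>+x. f (x 0, x 1, x 2) \<partial>PiM {0..<3::nat} (\<lambda>_. M)) = (\<integral>\<^sup>+a. \<integral>\<^sup>+b. \<integral>\<^sup>+c. f (a, b, c) \<partial>M \<partial>M \<partial>M)"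
proof -
  interpret PP: product_prob_space "\<lambda>_. M" "UNIV :: nat set"
    by (rule product_prob_spaceI) (rule prob_space_axioms)
  have "{0..<3::nat} = insert 0 (insert 1 (insert 2 {}))" by auto
  then have "(\<integral>\<^sup>+x. f (x 0, x 1, x 2) \<partial>PiM {0..<3::nat} (\<lambda>_. M)) =
      (\<integral>\<^sup>+x. f (x 0, x 1, x 2) \<partial>PiM (insert (0::nat) (insert 1 (insert 2 {}))) (\<lambda>_. M))" by (simp only:)
  also have "\<dots> = (\<integral>\<^sup>+a. \<integral>\<^sup>+x. f (a, x 1, x 2) \<partial>PiM (insert (1::nat) (insert 2 {})) (\<lambda>_. M) \<partial>M)"
    by (subst PP.product_nn_integral_insert_rev) (auto intro!: measurable_compose[OF _ assms] measurable_Pair measurable_component_singleton)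
  also have "\<dots> = (\<integral>\<^sup>+a. \<integral>\<^sup>+b. \<integral>\<^sup>+x. f (a, b, x 2) \<partial>PiM (insert (2::nat) {}) (\<lambda>_. M) \<partial>M \<partial>M)"
    by (intro nn_integral_cong, subst PP.product_nn_integral_insert_rev)
       (auto intro!: measurable_compose[OF _ assms] measurable_Pair measurable_component_singleton)
  also have "\<dots> = (\<integral>\<^sup>+a. \<integral>\<^sup>+b. \<integral>\<^sup>+c. f (a, b, c) \<partial>M \<partial>M \<partial>M)"
    by (intro nn_integral_cong, subst PP.product_nn_integral_insert_rev)
       (auto intro!: measurable_compose[OF _ assms] measurable_Pair measurable_component_singleton
         simp: PiM_empty nn_integral_count_space_finite)
  finally show ?thesis .
qed

context cell_template
begin

section \<open>Masses and densities of relations inside blocks\<close>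

lemma cell_int_nonneg:
  assumes "\<And>z. 0 \<le> f z"
  shows "0 \<le> cell_int k f i j"
  unfolding cell_int_def using assms by (intro Bochner_Integration.integral_nonneg) simp

lemma cell_int_mono:
  assumes "integrable MM f" "integrable MM g" "\<And>z. f z \<le> g z"
  shows "cell_int k f i j \<le> cell_int k g i j"
  unfolding cell_int_def
  by (intro integral_mono integrable_cell_part assms mult_right_mono) auto

lemma cell_int_add:
  assumes "integrable MM f" "integrable MM g"
  shows "cell_int k (\<lambda>z. f z + g z) i j = cell_int k f i j + cell_int k g i j"
  unfolding cell_int_def using integrable_cell_part[OF assms(1)] integrable_cell_part[OF assms(2)]
  by (simp add: distrib_right)

lemma abs_cell_int_le:
  "\<bar>cell_int k f i j\<bar> \<le> cell_int k (\<lambda>z. \<bar>f z\<bar>) i j"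
  unfolding cell_int_def by (rule order_trans[OF integral_abs_bound]) (simp add: abs_mult)

lemma integrable_of_bool:
  assumes [measurable]: "Measurable.pred MM P"
  shows "integrable MM (\<lambda>z. of_bool (P z) :: real)"
  by (rule MM.P.integrable_const_bound[where B = 1]) auto

definition cell_mass :: "nat \<Rightarrow> ('a \<times> 'a \<Rightarrow> bool) \<Rightarrow> nat \<Rightarrow> nat \<Rightarrow> real" where
  "cell_mass k P = cell_int k (\<lambda>z. of_bool (P z))"

lemma cell_mass_bounds:
  assumes "Measurable.pred MM P" "i < 4 ^ k" "j < 4 ^ k"
  shows "0 \<le> cell_mass k P i j" "cell_mass k P i j \<le> \<mu> k i * \<mu> k j"
proof -
  show "0 \<le> cell_mass k P i j" unfolding cell_mass_def by (rule cell_int_nonneg) simp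
  have "cell_mass k P i j \<le> cell_int k (\<lambda>_. 1) i j"
    unfolding cell_mass_def by (rule cell_int_mono) (use integrable_of_bool[OF assms(1)] in auto)
  then show "cell_mass k P i j \<le> \<mu> k i * \<mu> k j" using assms by (simp add: cell_int_1)
qed

lemma cell_mass_cover:
  assumes [measurable]: "Measurable.pred MM P" "Measurable.pred MM N" and "i < 4 ^ k" "j < 4 ^ k"
    and "\<And>z. P z \<or> N z"
  shows "\<mu> k i * \<mu> k j \<le> cell_mass k P i j + cell_mass k N i j"
proof -
  have "cell_int k (\<lambda>_. 1) i j \<le> cell_int k (\<lambda>z. of_bool (P z) + of_bool (N z)) i j"
  proof (rule cell_int_mono)
    show "integrable MM (\<lambda>z. of_bool (P z) + of_bool (N z) :: real)"
      by (intro Bochner_Integration.integrable_add integrable_of_bool) auto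
    show "1 \<le> (of_bool (P z) + of_bool (N z) :: real)" for z using assms(5)[of z] by auto
  qed simp
  then show ?thesis
    using assms(3,4) integrable_of_bool[OF assms(1)] integrable_of_bool[OF assms(2)]
    by (simp add: cell_int_1 cell_int_add cell_mass_def)
qed

lemma \<mu>_nonneg: "i < 4 ^ k \<Longrightarrow> 0 \<le> \<mu> k i"
  using mass[of i k] measure_nonneg by metis

lemma ennreal_cell_mass:
  assumes [measurable]: "Measurable.pred MM P"
  shows "ennreal (cell_mass k P i j) =
    (\<integral>\<^sup>+a. \<integral>\<^sup>+b. of_bool (P (a, b) \<and> c k a = i \<and> c k b = j) \<partial>M \<partial>M)"
proof -
  have "ennreal (cell_mass k P i j) = (\<integral>\<^sup>+z. ennreal (of_bool (P z) * of_bool (c k (fst z) = i \<and> c k (snd z) = j)) \<partial>MM)"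
    unfolding cell_mass_def cell_int_def
    by (rule nn_integral_eq_integral[symmetric])
       (use integrable_cell_part[OF integrable_of_bool[OF assms]] in auto)
  also have "\<dots> = (\<integral>\<^sup>+z. of_bool (P z \<and> c k (fst z) = i \<and> c k (snd z) = j) \<partial>MM)"
    by (intro nn_integral_cong) (auto simp: of_bool_def)
  also have "\<dots> = (\<integral>\<^sup>+a. \<integral>\<^sup>+b. of_bool (P (a, b) \<and> c k a = i \<and> c k b = j) \<partial>M \<partial>M)"
    by (subst nn_integral_fst[symmetric]) auto
  finally show ?thesis .
qed

lemma ennreal_mass:
  assumes "i < 4 ^ k"
  shows "(\<integral>\<^sup>+a. of_bool (c k a = i) \<partial>M) = ennreal (\<mu> k i)"
proof -
  have "(\<integral>\<^sup>+a. of_bool (c k a = i) \<partial>M) = (\<integral>\<^sup>+a. indicator {a\<in>space M. c k a = i} a \<partial>M)"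
    by (intro nn_integral_cong) (auto simp: indicator_def of_bool_def)
  also have "\<dots> = emeasure M {a\<in>space M. c k a = i}" by simp
  finally show ?thesis using mass[OF assms] by (simp add: emeasure_eq_measure)
qed

lemma cell_mass_swap:
  assumes [measurable]: "Measurable.pred MM P"
  shows "cell_mass k (\<lambda>z. P (snd z, fst z)) i j = cell_mass k P j i"
proof -
  have "ennreal (cell_mass k (\<lambda>z. P (snd z, fst z)) i j) =
     (\<integral>\<^sup>+a. \<integral>\<^sup>+b. of_bool (P (b, a) \<and> c k a = i \<and> c k b = j) \<partial>M \<partial>M)"
    by (subst ennreal_cell_mass) auto
  also have "\<dots> = (\<integral>\<^sup>+b. \<integral>\<^sup>+a. of_bool (P (b, a) \<and> c k a = i \<and> c k b = j) \<partial>M \<partial>M)"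
    by (rule MM.Fubini') measurable
  also have "\<dots> = ennreal (cell_mass k P j i)"
    by (subst ennreal_cell_mass) (auto intro!: nn_integral_cong simp: conj_commute)
  finally show ?thesis
    by (subst (asm) ennreal_inj) (auto simp: cell_mass_def intro!: cell_int_nonneg)
qed

lemma cell_indicator_measurable:
  fixes P :: "'a \<times> 'a \<Rightarrow> bool" and i j k
  assumes [measurable]: "Measurable.pred MM P"
  defines "g \<equiv> \<lambda>a b. of_bool (P (a, b) \<and> c k a = i \<and> c k b = j) :: ennreal"
  shows "a \<in> space M \<Longrightarrow> g a \<in> borel_measurable M"
    and "(\<lambda>a. \<integral>\<^sup>+b. g a b \<partial>M) \<in> borel_measurable M"
proof -
  have g: "case_prod g \<in> borel_measurable MM" unfolding g_def by measurable
  show "a \<in> space M \<Longrightarrow> g a \<in> borel_measurable M"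
    using measurable_Pair2[OF g, of a] by simp
  show "(\<lambda>a. \<integral>\<^sup>+b. g a b \<partial>M) \<in> borel_measurable M"
    using borel_measurable_nn_integral_fst[OF g] by simp
qed

text \<open>Almost surely at most two of the three relations hold at a triple; integrate this over
  the triples with cells i, j, l. Divided by the masses, it says that three block densities add up
  to at most 2. It will serve both transitivity, with N the set where the kernel is below 1, and
  irreflexivity, with N a reversed relation.\<close>

lemma triple_mass_inequality:
  assumes [measurable]: "Measurable.pred MM A" "Measurable.pred MM A'" "Measurable.pred MM N"
    and ijl: "i < 4 ^ k" "j < 4 ^ k" "l < 4 ^ k"
    and ae: "AE x in PiM {0..<3::nat} (\<lambda>_. M). \<not> (A (x 0, x 1) \<and> A' (x 1, x 2) \<and> N (x 0, x 2))"
  shows "cell_mass k A i j * \<mu> k l + \<mu> k i * cell_mass k A' j l + \<mu> k j * cell_mass k N i l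
    \<le> 2 * (\<mu> k i * \<mu> k j * \<mu> k l)"
proof -
  let ?P = "PiM {0..<3::nat} (\<lambda>_. M)"
  define F where "F = (\<lambda>(a, b, d). of_bool (A (a, b) \<and> c k a = i \<and> c k b = j) * of_bool (c k d = l)
     + of_bool (c k a = i) * of_bool (A' (b, d) \<and> c k b = j \<and> c k d = l)
     + of_bool (c k b = j) * of_bool (N (a, d) \<and> c k a = i \<and> c k d = l) :: ennreal)"
  define H where "H = (\<lambda>(a, b, d). 2 * (of_bool (c k a = i) * of_bool (c k b = j) * of_bool (c k d = l)) :: ennreal)"
  have [measurable]: "F \<in> borel_measurable (M \<Otimes>\<^sub>M (M \<Otimes>\<^sub>M M))" "H \<in> borel_measurable (M \<Otimes>\<^sub>M (M \<Otimes>\<^sub>M M))"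
    unfolding F_def H_def by measurable
  have "(\<integral>\<^sup>+x. F (x 0, x 1, x 2) \<partial>?P) \<le> (\<integral>\<^sup>+x. H (x 0, x 1, x 2) \<partial>?P)"
    using ae by (intro nn_integral_mono_AE) (auto elim!: eventually_mono simp: F_def H_def of_bool_def)
  then have le: "(\<integral>\<^sup>+a. \<integral>\<^sup>+b. \<integral>\<^sup>+d. F (a, b, d) \<partial>M \<partial>M \<partial>M) \<le> (\<integral>\<^sup>+a. \<integral>\<^sup>+b. \<integral>\<^sup>+d. H (a, b, d) \<partial>M \<partial>M \<partial>M)"
    by (simp only: nn_integral_PiM_3[OF \<open>F \<in> _\<close>] nn_integral_PiM_3[OF \<open>H \<in> _\<close>])
  have H: "(\<integral>\<^sup>+a. \<integral>\<^sup>+b. \<integral>\<^sup>+d. H (a, b, d) \<partial>M \<partial>M \<partial>M) = ennreal (2 * (\<mu> k i * \<mu> k j * \<mu> k l))"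
    using ijl by (simp add: H_def nn_integral_cmult nn_integral_multc ennreal_mass \<mu>_nonneg ennreal_mult mult_ac)
  have F1: "(\<integral>\<^sup>+a. \<integral>\<^sup>+b. \<integral>\<^sup>+d. of_bool (A (a, b) \<and> c k a = i \<and> c k b = j) * of_bool (c k d = l) \<partial>M \<partial>M \<partial>M)
     = ennreal (cell_mass k A i j * \<mu> k l)" (is "?lhs = _")
  proof -
    note m = cell_indicator_measurable[OF assms(1), where i = i and j = j and k = k]
    have "?lhs
      = (\<integral>\<^sup>+a. (\<integral>\<^sup>+b. of_bool (A (a, b) \<and> c k a = i \<and> c k b = j) \<partial>M) * ennreal (\<mu> k l) \<partial>M)"
      using ijl by (intro nn_integral_cong) (simp add: nn_integral_cmult nn_integral_multc m(1) ennreal_mass)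
    also have "\<dots> = ennreal (cell_mass k A i j) * ennreal (\<mu> k l)"
      by (simp add: nn_integral_multc m(2) ennreal_cell_mass)
    finally show ?thesis using ijl cell_mass_bounds(1)[OF assms(1), of i k j] by (simp add: ennreal_mult \<mu>_nonneg)
  qed
  have F2: "(\<integral>\<^sup>+a. \<integral>\<^sup>+b. \<integral>\<^sup>+d. of_bool (c k a = i) * of_bool (A' (b, d) \<and> c k b = j \<and> c k d = l) \<partial>M \<partial>M \<partial>M)
     = ennreal (\<mu> k i * cell_mass k A' j l)" (is "?lhs = _")
  proof -
    note m = cell_indicator_measurable[OF assms(2), where i = j and j = l and k = k]
    have "(\<integral>\<^sup>+b. \<integral>\<^sup>+d. of_bool (c k a = i) * of_bool (A' (b, d) \<and> c k b = j \<and> c k d = l) \<partial>M \<partial>M)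
      = of_bool (c k a = i) * ennreal (cell_mass k A' j l)" for a
    proof -
      have "(\<integral>\<^sup>+b. \<integral>\<^sup>+d. of_bool (c k a = i) * of_bool (A' (b, d) \<and> c k b = j \<and> c k d = l) \<partial>M \<partial>M)
        = (\<integral>\<^sup>+b. of_bool (c k a = i) * (\<integral>\<^sup>+d. of_bool (A' (b, d) \<and> c k b = j \<and> c k d = l) \<partial>M) \<partial>M)"
        by (intro nn_integral_cong) (simp add: nn_integral_cmult m(1))
      then show ?thesis by (simp add: nn_integral_cmult m(2) ennreal_cell_mass)
    qed
    then show ?thesis using ijl cell_mass_bounds(1)[OF assms(2), of j k l]
      by (simp add: nn_integral_multc ennreal_mass ennreal_mult \<mu>_nonneg)
  qed
  have F3: "(\<integral>\<^sup>+a. \<integral>\<^sup>+b. \<integral>\<^sup>+d. of_bool (c k b = j) * of_bool (N (a, d) \<and> c k a = i \<and> c k d = l) \<partial>M \<partial>M \<partial>M)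
     = ennreal (\<mu> k j * cell_mass k N i l)" (is "?lhs = _")
  proof -
    note m = cell_indicator_measurable[OF assms(3), where i = i and j = l and k = k]
    have "?lhs
      = (\<integral>\<^sup>+a. ennreal (\<mu> k j) * (\<integral>\<^sup>+d. of_bool (N (a, d) \<and> c k a = i \<and> c k d = l) \<partial>M) \<partial>M)"
      using ijl by (intro nn_integral_cong) (simp add: nn_integral_cmult nn_integral_multc m(1) ennreal_mass)
    also have "\<dots> = ennreal (\<mu> k j) * ennreal (cell_mass k N i l)"
      by (simp add: nn_integral_cmult m(2) ennreal_cell_mass)
    finally show ?thesis using ijl cell_mass_bounds(1)[OF assms(3), of i k l] by (simp add: ennreal_mult \<mu>_nonneg)
  qed
  have F: "(\<integral>\<^sup>+a. \<integral>\<^sup>+b. \<integral>\<^sup>+d. F (a, b, d) \<partial>M \<partial>M \<partial>M) =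
     ennreal (cell_mass k A i j * \<mu> k l + \<mu> k i * cell_mass k A' j l + \<mu> k j * cell_mass k N i l)"
  proof -
    define f1 f2 f3 :: "'a \<times> 'a \<times> 'a \<Rightarrow> ennreal" where
      "f1 = (\<lambda>(a, b, d). of_bool (A (a, b) \<and> c k a = i \<and> c k b = j) * of_bool (c k d = l))" and
      "f2 = (\<lambda>(a, b, d). of_bool (c k a = i) * of_bool (A' (b, d) \<and> c k b = j \<and> c k d = l))" and
      "f3 = (\<lambda>(a, b, d). of_bool (c k b = j) * of_bool (N (a, d) \<and> c k a = i \<and> c k d = l))"
    have [measurable]: "f1 \<in> borel_measurable (M \<Otimes>\<^sub>M MM)" "f2 \<in> borel_measurable (M \<Otimes>\<^sub>M MM)" "f3 \<in> borel_measurable (M \<Otimes>\<^sub>M MM)"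
      unfolding f1_def f2_def f3_def by measurable
    have three: "(\<integral>\<^sup>+a. \<integral>\<^sup>+b. \<integral>\<^sup>+d. g (a, b, d) \<partial>M \<partial>M \<partial>M) = integral\<^sup>N (M \<Otimes>\<^sub>M MM) g"
      \<comment> \<open>Additivity is applied to integrals over the triple product, where joint
        measurability of the three parts is at hand.\<close>
      if g: "g \<in> borel_measurable (M \<Otimes>\<^sub>M MM)" for g
    proof -
      have "(\<integral>\<^sup>+b. \<integral>\<^sup>+d. g (a, b, d) \<partial>M \<partial>M) = (\<integral>\<^sup>+z. g (a, z) \<partial>MM)" if "a \<in> space M" for a
        using nn_integral_fst[OF measurable_Pair2[OF g that]] by simp
      then have "(\<integral>\<^sup>+a. \<integral>\<^sup>+b. \<integral>\<^sup>+d. g (a, b, d) \<partial>M \<partial>M \<partial>M) = (\<integral>\<^sup>+a. \<integral>\<^sup>+z. g (a, z) \<partial>MM \<partial>M)"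
        by (rule nn_integral_cong)
      also have "\<dots> = integral\<^sup>N (M \<Otimes>\<^sub>M MM) g" by (rule MM.P.nn_integral_fst[OF g])
      finally show ?thesis .
    qed
    have "F = (\<lambda>z. f1 z + f2 z + f3 z)" by (auto simp: F_def f1_def f2_def f3_def)
    then have "integral\<^sup>N (M \<Otimes>\<^sub>M MM) F = integral\<^sup>N (M \<Otimes>\<^sub>M MM) f1 + integral\<^sup>N (M \<Otimes>\<^sub>M MM) f2 + integral\<^sup>N (M \<Otimes>\<^sub>M MM) f3"
      by (simp add: nn_integral_add)
    also have "\<dots> = ennreal (cell_mass k A i j * \<mu> k l) + ennreal (\<mu> k i * cell_mass k A' j l) + ennreal (\<mu> k j * cell_mass k N i l)"
      using F1 F2 F3 three[of f1] three[of f2] three[of f3] by (simp add: f1_def f2_def f3_def)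
    finally show ?thesis
      using three[of F] ijl cell_mass_bounds(1)[OF assms(1), of i k j] cell_mass_bounds(1)[OF assms(2), of j k l]
        cell_mass_bounds(1)[OF assms(3), of i k l]
      by (simp add: ennreal_plus[symmetric] \<mu>_nonneg del: ennreal_plus)
  qed
  show ?thesis using le unfolding F H
    by (subst (asm) ennreal_le_iff) (use ijl \<mu>_nonneg in auto)
qed

text \<open>The conditional probability of P given the cells of both coordinates. On blocks of mass
  0 it is 0 by division by zero, so a positive value certifies that both cells have positive
  mass.\<close>

definition cell_density :: "nat \<Rightarrow> ('a \<times> 'a \<Rightarrow> bool) \<Rightarrow> 'a \<times> 'a \<Rightarrow> real" where
  "cell_density k P z = cell_mass k P (c k (fst z)) (c k (snd z)) / (\<mu> k (c k (fst z)) * \<mu> k (c k (snd z)))"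

lemma cell_density_measurable [measurable]: "cell_density k P \<in> borel_measurable MM"
  unfolding cell_density_def[abs_def]
  by (rule measurable_compose[OF measurable_cell_function[of "\<lambda>i j. cell_mass k P i j / (\<mu> k i * \<mu> k j)"]]) simp

lemma cell_density_bounds:
  assumes "Measurable.pred MM P"
  shows "0 \<le> cell_density k P z" "cell_density k P z \<le> 1"
proof -
  note b = cell_mass_bounds[OF assms c_less c_less, of k "fst z" "snd z"]
  have \<mu>: "0 \<le> \<mu> k (c k (fst z)) * \<mu> k (c k (snd z))" by (simp add: \<mu>_nonneg c_less)
  show "0 \<le> cell_density k P z" unfolding cell_density_def using b \<mu> by (intro divide_nonneg_nonneg)
  show "cell_density k P z \<le> 1" unfolding cell_density_def
    unfolding divide_le_eq_1 using b \<mu> by linarith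
qed

text \<open>Conditional expectation E contracts L1 and fixes functions H of the cells up to null
  sets. With f the indicator of P, the distance from E f to f is at most that from E f to H plus
  that from H to f, and the first is bounded by the second.\<close>

lemma cell_density_L1_approx:
  assumes P[measurable]: "Measurable.pred MM P" and h: "\<And>i j. 0 \<le> h i j \<and> h i j \<le> (1::real)"
  shows "(\<integral>z. \<bar>cell_density k P z - of_bool (P z)\<bar> \<partial>MM)
    \<le> 2 * (\<integral>z. \<bar>of_bool (P z) - h (c k (fst z)) (c k (snd z))\<bar> \<partial>MM)"
proof -
  define H where "H z = h (c k (fst z)) (c k (snd z))" for z
  have [measurable]: "H \<in> borel_measurable MM"
    unfolding H_def[abs_def] by (rule measurable_compose[OF measurable_cell_function[of h]]) simp
  have intP: "integrable MM (\<lambda>z. of_bool (P z) :: real)" by (rule integrable_of_bool[OF P])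
  have intH: "integrable MM H"
    by (rule MM.P.integrable_const_bound[where B = 1]) (use h in \<open>auto simp: H_def\<close>)
  have intD: "integrable MM (cell_density k P)"
    by (rule MM.P.integrable_const_bound[where B = 1]) (use cell_density_bounds[OF P] in auto)
  have "(\<integral>z. \<bar>cell_density k P z - H z\<bar> \<partial>MM) =
     (\<Sum>i<4^k. \<Sum>j<4^k. \<bar>cell_mass k P i j / (\<mu> k i * \<mu> k j) - h i j\<bar> * (\<mu> k i * \<mu> k j))"
    using integral_cell_function[of "\<lambda>i j. \<bar>cell_mass k P i j / (\<mu> k i * \<mu> k j) - h i j\<bar>" k]
    by (simp add: cell_density_def H_def)
  also have "\<dots> \<le> (\<Sum>i<4^k. \<Sum>j<4^k. cell_int k (\<lambda>z. \<bar>of_bool (P z) - H z\<bar>) i j)"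
  proof (intro sum_mono)
    fix i j :: nat assume "i \<in> {..<4^k}" "j \<in> {..<4^k}"
    then have ij: "i < 4 ^ k" "j < 4 ^ k" by auto
    show "\<bar>cell_mass k P i j / (\<mu> k i * \<mu> k j) - h i j\<bar> * (\<mu> k i * \<mu> k j) \<le> cell_int k (\<lambda>z. \<bar>of_bool (P z) - H z\<bar>) i j"
    proof (cases "\<mu> k i * \<mu> k j = 0")
      case True
      then show ?thesis using cell_int_nonneg[of "\<lambda>z. \<bar>of_bool (P z) - H z\<bar>" k i j] by auto
    next
      case False
      then have pos: "0 < \<mu> k i * \<mu> k j" using \<mu>_nonneg ij by (simp add: less_le)
      have "\<bar>cell_mass k P i j / (\<mu> k i * \<mu> k j) - h i j\<bar> * (\<mu> k i * \<mu> k j) =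
          \<bar>(cell_mass k P i j / (\<mu> k i * \<mu> k j) - h i j) * (\<mu> k i * \<mu> k j)\<bar>"
        by (metis abs_mult abs_of_pos pos)
      also have "\<dots> = \<bar>cell_mass k P i j - h i j * (\<mu> k i * \<mu> k j)\<bar>"
        using False by (simp add: left_diff_distrib)
      also have "cell_mass k P i j - h i j * (\<mu> k i * \<mu> k j) = cell_int k (\<lambda>z. of_bool (P z) - H z) i j"
      proof -
        have "cell_int k (\<lambda>z. of_bool (P z) - H z) i j = cell_mass k P i j - cell_int k H i j"
          unfolding cell_mass_def cell_int_def
          using integrable_cell_part[OF intP] integrable_cell_part[OF intH] by (simp add: left_diff_distrib)
        also have "cell_int k H i j = h i j * cell_int k (\<lambda>_. 1) i j"
        proof -
          have "cell_int k H i j = (\<integral>z. h i j * (1 * of_bool (c k (fst z) = i \<and> c k (snd z) = j)) \<partial>MM)"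
            unfolding cell_int_def by (intro Bochner_Integration.integral_cong) (auto simp: H_def)
          then show ?thesis by (simp add: cell_int_def)
        qed
        finally show ?thesis by (simp add: cell_int_1 ij)
      qed
      also have "\<bar>cell_int k (\<lambda>z. of_bool (P z) - H z) i j\<bar> \<le> cell_int k (\<lambda>z. \<bar>of_bool (P z) - H z\<bar>) i j"
        by (rule abs_cell_int_le)
      finally show ?thesis .
    qed
  qed
  also have "\<dots> = (\<integral>z. \<bar>of_bool (P z) - H z\<bar> \<partial>MM)"
    using integral_times_cell_function[of "\<lambda>z. \<bar>of_bool (P z) - H z\<bar>" "\<lambda>_ _. 1" k] intP intH by simp
  finally have le: "(\<integral>z. \<bar>cell_density k P z - H z\<bar> \<partial>MM) \<le> (\<integral>z. \<bar>of_bool (P z) - H z\<bar> \<partial>MM)" .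
  have "(\<integral>z. \<bar>cell_density k P z - of_bool (P z)\<bar> \<partial>MM)
     \<le> (\<integral>z. \<bar>cell_density k P z - H z\<bar> + \<bar>of_bool (P z) - H z\<bar> \<partial>MM)"
    using intP intH intD by (intro integral_mono) auto
  also have "\<dots> = (\<integral>z. \<bar>cell_density k P z - H z\<bar> \<partial>MM) + (\<integral>z. \<bar>of_bool (P z) - H z\<bar> \<partial>MM)"
    using intP intH intD by simp
  finally show ?thesis using le by (simp add: H_def)
qed

text \<open>The indicator of \<open>{V > 0}\<close> is close in mean to \<open>min 1 (m V)\<close> for large \<open>m\<close>, which in turn is close
  to a function of the cells alone; so no martingale convergence theorem is needed.\<close>

lemma cell_density_pos_L1:
  assumes V[measurable]: "V \<in> borel_measurable MM" and V01: "\<And>z. 0 \<le> V z \<and> V z \<le> (1::real)"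
    and v01: "\<And>k i j. 0 \<le> v k i j \<and> v k i j \<le> (1::real)"
    and lim: "(\<lambda>k. \<integral>z. \<bar>v k (c k (fst z)) (c k (snd z)) - V z\<bar> \<partial>MM) \<longlonglongrightarrow> 0"
  shows "(\<lambda>k. \<integral>z. \<bar>cell_density k (\<lambda>z. 0 < V z) z - of_bool (0 < V z)\<bar> \<partial>MM) \<longlonglongrightarrow> 0"
proof (rule LIMSEQ_I)
  fix e :: real assume e: "0 < e"
  define gap where "gap m z = \<bar>of_bool (0 < V z) - min 1 (real m * V z)\<bar>" for m z
  have [measurable]: "gap m \<in> borel_measurable MM" for m unfolding gap_def[abs_def] by measurable
  define vk where "vk k z = v k (c k (fst z)) (c k (snd z))" for k z
  have vk01: "0 \<le> vk k z \<and> vk k z \<le> 1" for k z using v01 by (simp add: vk_def)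
  have [measurable]: "vk k \<in> borel_measurable MM" for k
    unfolding vk_def[abs_def] by (rule measurable_compose[OF measurable_cell_function[of "v k"]]) simp
  have bnd: "\<bar>of_bool b - min 1 (real m * t)\<bar> \<le> 1" if "0 \<le> t \<and> t \<le> 1" for b m t
  proof -
    have "0 \<le> real m * t" using that by simp
    then show ?thesis by (cases b) (auto simp: abs_le_iff)
  qed
  \<comment> \<open>For each z with V z > 0 the gap is eventually 0, and otherwise it is always
    0.\<close>
  have "(\<lambda>m. \<integral>z. gap m z \<partial>MM) \<longlonglongrightarrow> (\<integral>z. 0 \<partial>MM)"
  proof (rule integral_dominated_convergence[where w = "\<lambda>_. 1"])
    show "AE z in MM. (\<lambda>m. gap m z) \<longlonglongrightarrow> 0"
    proof (rule AE_I2)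
      fix z
      show "(\<lambda>m. gap m z) \<longlonglongrightarrow> 0"
      proof (cases "0 < V z")
        case True
        obtain m0 :: nat where "1 / V z < m0" using reals_Archimedean2 by blast
        then have "1 \<le> real m * V z" if "m \<ge> m0" for m
        proof -
          have "1 / V z \<le> real m" using \<open>1 / V z < m0\<close> that by linarith
          then show ?thesis using True by (simp add: divide_le_eq)
        qed
        then have "\<forall>\<^sub>F m in sequentially. gap m z = 0"
          using True by (intro eventually_sequentiallyI[of m0]) (simp add: gap_def)
        then show ?thesis by (rule tendsto_eventually)
      next
        case False
        then have "V z = 0" using V01[of z] by simp
        then show ?thesis by (simp add: gap_def)
      qed
    qed
    show "AE z in MM. norm (gap m z) \<le> 1" for m
      using bnd[OF V01] by (intro AE_I2) (simp add: gap_def)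
  qed auto
  then have "\<forall>\<^sub>F m in sequentially. (\<integral>z. gap m z \<partial>MM) < e / 4"
    using e by (intro order_tendstoD(2)[where a = "e / 4"]) auto
  then obtain m where m: "(\<integral>z. gap m z \<partial>MM) < e / 4"
    by (auto dest: eventually_happens)
  \<comment> \<open>The slope m is fixed before the level k, because replacing V by its cell
    approximation inside \<open>min 1\<close> costs a factor m.\<close>
  have "(\<lambda>k. real m * (\<integral>z. \<bar>vk k z - V z\<bar> \<partial>MM)) \<longlonglongrightarrow> real m * 0"
    unfolding vk_def by (intro tendsto_intros lim)
  then have "\<forall>\<^sub>F k in sequentially. real m * (\<integral>z. \<bar>vk k z - V z\<bar> \<partial>MM) < e / 4"
    using e by (intro order_tendstoD(2)[where a = "e / 4"]) auto
  then obtain k0 where k0: "\<And>k. k \<ge> k0 \<Longrightarrow> real m * (\<integral>z. \<bar>vk k z - V z\<bar> \<partial>MM) < e / 4"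
    by (auto simp: eventually_sequentially)
  have int1: "integrable MM (\<lambda>z. \<bar>vk k z - V z\<bar>)" for k
  proof (rule MM.P.integrable_const_bound[where B = 1])
    show "AE z in MM. norm \<bar>vk k z - V z\<bar> \<le> 1"
    proof (rule AE_I2)
      fix z show "norm \<bar>vk k z - V z\<bar> \<le> 1" using vk01[of k z] V01[of z] by (simp add: abs_le_iff)
    qed
  qed simp
  have int2: "integrable MM (\<lambda>z. gap m z)"
    using bnd[OF V01] by (intro MM.P.integrable_const_bound[where B = 1] AE_I2) (simp_all add: gap_def)
  have int3: "integrable MM (\<lambda>z. \<bar>of_bool (0 < V z) - min 1 (real m * vk k z)\<bar>)" for k
    using bnd[OF vk01] by (intro MM.P.integrable_const_bound[where B = 1] AE_I2) simp_all
  have "norm ((\<integral>z. \<bar>cell_density k (\<lambda>z. 0 < V z) z - of_bool (0 < V z)\<bar> \<partial>MM) - 0) < e" if k: "k \<ge> k0" for k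
  proof -
    have "(\<integral>z. \<bar>cell_density k (\<lambda>z. 0 < V z) z - of_bool (0 < V z)\<bar> \<partial>MM)
      \<le> 2 * (\<integral>z. \<bar>of_bool (0 < V z) - min 1 (real m * vk k z)\<bar> \<partial>MM)"
      unfolding vk_def
      by (rule cell_density_L1_approx[where h = "\<lambda>i j. min 1 (real m * v k i j)"]) (use v01 in auto)
    also have "(\<integral>z. \<bar>of_bool (0 < V z) - min 1 (real m * vk k z)\<bar> \<partial>MM)
       \<le> (\<integral>z. gap m z + real m * \<bar>vk k z - V z\<bar> \<partial>MM)"
    proof (rule integral_mono)
      fix z
      have "\<bar>min 1 (real m * V z) - min 1 (real m * vk k z)\<bar> \<le> \<bar>real m * V z - real m * vk k z\<bar>" by linarith
      also have "\<dots> = real m * \<bar>vk k z - V z\<bar>"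
        by (simp add: right_diff_distrib[symmetric] abs_mult abs_minus_commute)
      finally show "\<bar>of_bool (0 < V z) - min 1 (real m * vk k z)\<bar>
          \<le> gap m z + real m * \<bar>vk k z - V z\<bar>" unfolding gap_def by linarith
    qed (use int1 int2 int3 in auto)
    also have "\<dots> = (\<integral>z. gap m z \<partial>MM) + real m * (\<integral>z. \<bar>vk k z - V z\<bar> \<partial>MM)"
      using int1 int2 by simp
    also have "\<dots> < e / 2" using m k0[OF k] by linarith
    finally show ?thesis by simp
  qed
  then show "\<exists>no. \<forall>n\<ge>no. norm ((\<integral>z. \<bar>cell_density n (\<lambda>z. 0 < V z) z - of_bool (0 < V z)\<bar> \<partial>MM) - 0) < e"
    by blast
qed

end

section \<open>Order axioms almost everywhere, then everywhere\<close>

text \<open>The difference of the two densities is the integral of the nonnegative function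
  \<open>W (x 0, x 1) * W (x 1, x 2) * (1 - W (x 0, x 2))\<close>, which therefore vanishes almost
  everywhere.\<close>

lemma (in prob_space) AE_path_transitive:
  assumes [measurable]: "W \<in> borel_measurable (M \<Otimes>\<^sub>M M)" and W01: "\<And>z. 0 \<le> W z \<and> W z \<le> (1::real)"
    and eq: "kernel_dens M (\<lambda>x y. W (x, y)) (3, {(0,1),(1,2)}) = kernel_dens M (\<lambda>x y. W (x, y)) (3, {(0,1),(1,2),(0,2)})"
  shows "AE x in PiM {0..<3::nat} (\<lambda>_. M). \<not> (0 < W (x 0, x 1) \<and> 0 < W (x 1, x 2) \<and> 0 < 1 - W (x 0, x 2))"
proof -
  let ?P = "PiM {0..<3::nat} (\<lambda>_. M)"
  have fin_P: "finite_measure ?P"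
    by (intro prob_space.axioms(1) prob_space_PiM prob_space_axioms)
  have [measurable]: "(\<lambda>x. W (x i, x j)) \<in> borel_measurable ?P" if "i < 3" "j < 3" for i j
    using that by (intro measurable_compose[OF _ assms(1)] measurable_Pair measurable_component_singleton) auto
  have int: "integrable ?P (\<lambda>x. W (x 0, x 1) * W (x 1, x 2))"
    using W01 by (intro finite_measure.integrable_const_bound[OF fin_P, where B = 1])
      (auto simp: abs_mult intro!: mult_le_one)
  have int': "integrable ?P (\<lambda>x. W (x 0, x 1) * (W (x 1, x 2) * W (x 0, x 2)))"
    using W01 by (intro finite_measure.integrable_const_bound[OF fin_P, where B = 1])
      (auto simp: abs_mult intro!: mult_le_one mult_nonneg_nonneg)
  let ?f = "\<lambda>x :: nat \<Rightarrow> 'a. W (x 0, x 1) * W (x 1, x 2) - W (x 0, x 1) * (W (x 1, x 2) * W (x 0, x 2))"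
  have "(\<integral>x. ?f x \<partial>?P) = 0"
    using eq int int' by (simp add: kernel_dens_def)
  moreover have nonneg: "0 \<le> ?f x" for x :: "nat \<Rightarrow> 'a"
  proof -
    have "?f x = W (x 0, x 1) * W (x 1, x 2) * (1 - W (x 0, x 2))" by (simp add: algebra_simps)
    then show ?thesis using W01 by simp
  qed
  ultimately have "AE x in ?P. ?f x = 0"
    using int int' by (subst (asm) integral_nonneg_eq_0_iff_AE) auto
  then show ?thesis
  proof eventually_elim
    case (elim x)
    then have "W (x 0, x 1) * W (x 1, x 2) * (1 - W (x 0, x 2)) = 0" by (simp add: algebra_simps)
    then show ?case by auto
  qed
qed

lemma (in prob_space) AE_no_cycle:
  assumes [measurable]: "W \<in> borel_measurable (M \<Otimes>\<^sub>M M)" and W01: "\<And>z. 0 \<le> W z \<and> W z \<le> (1::real)"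
    and eq: "kernel_dens M (\<lambda>x y. W (x, y)) (3, {(0,1),(1,2),(2,0)}) = 0"
  shows "AE x in PiM {0..<3::nat} (\<lambda>_. M). \<not> (0 < W (x 0, x 1) \<and> 0 < W (x 1, x 2) \<and> 0 < W (x 2, x 0))"
proof -
  let ?P = "PiM {0..<3::nat} (\<lambda>_. M)"
  have fin_P: "finite_measure ?P"
    by (intro prob_space.axioms(1) prob_space_PiM prob_space_axioms)
  have [measurable]: "(\<lambda>x. W (x i, x j)) \<in> borel_measurable ?P" if "i < 3" "j < 3" for i j
    using that by (intro measurable_compose[OF _ assms(1)] measurable_Pair measurable_component_singleton) auto
  have int: "integrable ?P (\<lambda>x. W (x 0, x 1) * (W (x 1, x 2) * W (x 2, x 0)))"
    using W01 by (intro finite_measure.integrable_const_bound[OF fin_P, where B = 1])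
      (auto simp: abs_mult intro!: mult_le_one mult_nonneg_nonneg)
  have "(\<integral>x. W (x 0, x 1) * (W (x 1, x 2) * W (x 2, x 0)) \<partial>?P) = 0"
    using eq by (simp add: kernel_dens_def)
  then have "AE x in ?P. W (x 0, x 1) * (W (x 1, x 2) * W (x 2, x 0)) = 0"
    using int W01 by (subst (asm) integral_nonneg_eq_0_iff_AE) auto
  then show ?thesis by eventually_elim auto
qed

context cell_template
begin

text \<open>The relations \<open>R\<close> and \<open>T\<close> are read off from block densities,
  hence make sense at every point, and the triple inequality holds for all blocks. So R composed
  with R lies in T and R is irreflexive without exceptional sets, while almost everywhere R and T
  mean W > 0 and W = 1.\<close>

lemma strict_kernel_modification:
  assumes W[measurable]: "W \<in> borel_measurable MM" and W01: "\<And>z. 0 \<le> W z \<and> W z \<le> (1::real)"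
    and lim: "(\<lambda>k. \<integral>z. \<bar>U k z - W z\<bar> \<partial>MM) \<longlonglongrightarrow> 0"
    and path: "AE x in PiM {0..<3::nat} (\<lambda>_. M). \<not> (0 < W (x 0, x 1) \<and> 0 < W (x 1, x 2) \<and> 0 < 1 - W (x 0, x 2))"
    and cycle: "AE x in PiM {0..<3::nat} (\<lambda>_. M). \<not> (0 < W (x 0, x 1) \<and> 0 < W (x 1, x 2) \<and> 0 < W (x 2, x 0))"
  obtains W' where "W' \<in> borel_measurable MM" "\<And>z. 0 \<le> W' z \<and> W' z \<le> (1::real)"
    "AE z in MM. W z = W' z" "strict_kernel M (\<lambda>x y. 0 < W' (x, y)) (\<lambda>x y. W' (x, y))"
proof -
  define P where "P z \<longleftrightarrow> 0 < W z" for z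
  define N where "N z \<longleftrightarrow> 0 < 1 - W z" for z
  have P[measurable]: "Measurable.pred MM P" and N[measurable]: "Measurable.pred MM N"
    unfolding P_def[abs_def] N_def[abs_def] by measurable
  define dP where "dP k z = cell_density k P z" for k z
  define dN where "dN k z = cell_density k N z" for k z
  have [measurable]: "dP k \<in> borel_measurable MM" "dN k \<in> borel_measurable MM" for k
    unfolding dP_def[abs_def] dN_def[abs_def] by measurable
  have dP01: "0 \<le> dP k z" "dP k z \<le> 1" and dN01: "0 \<le> dN k z" "dN k z \<le> 1" for k z
    using cell_density_bounds[OF P] cell_density_bounds[OF N] by (auto simp: dP_def dN_def)
  have "(\<lambda>k. \<integral>z. \<bar>dP k z - of_bool (P z)\<bar> \<partial>MM) \<longlonglongrightarrow> 0"
    unfolding dP_def P_def[abs_def]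
    by (rule cell_density_pos_L1[where v = D]) (use W01 D_bounds lim in \<open>auto simp: U_def\<close>)
  moreover have "(\<lambda>k. \<integral>z. \<bar>dN k z - of_bool (N z)\<bar> \<partial>MM) \<longlonglongrightarrow> 0"
    unfolding dN_def N_def[abs_def]
  proof (rule cell_density_pos_L1[where v = "\<lambda>k i j. 1 - D k i j"])
    have "\<bar>1 - D k (c k (fst z)) (c k (snd z)) - (1 - W z)\<bar> = \<bar>U k z - W z\<bar>" for k z
      by (simp add: U_def abs_minus_commute)
    then show "(\<lambda>k. \<integral>z. \<bar>1 - D k (c k (fst z)) (c k (snd z)) - (1 - W z)\<bar> \<partial>MM) \<longlonglongrightarrow> 0"
      using lim by simp
  qed (use W01 D_bounds in auto)
  ultimately have "(\<lambda>k. (\<integral>z. \<bar>dP k z - of_bool (P z)\<bar> \<partial>MM) + (\<integral>z. \<bar>dN k z - of_bool (N z)\<bar> \<partial>MM)) \<longlonglongrightarrow> 0"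
    using tendsto_add_zero by blast
  moreover have bnd: "\<bar>t - of_bool b\<bar> \<le> 1" if "0 \<le> t" "t \<le> (1::real)" for t b
    using that by (cases b) auto
  moreover have intP: "integrable MM (\<lambda>z. \<bar>dP k z - of_bool (P z)\<bar>)" for k
    by (rule MM.P.integrable_const_bound[where B = 1]) (use bnd[OF dP01] in auto)
  moreover have intN: "integrable MM (\<lambda>z. \<bar>dN k z - of_bool (N z)\<bar>)" for k
    by (rule MM.P.integrable_const_bound[where B = 1]) (use bnd[OF dN01] in auto)
  ultimately have "(\<lambda>k. \<integral>z. norm (\<bar>dP k z - of_bool (P z)\<bar> + \<bar>dN k z - of_bool (N z)\<bar>) \<partial>MM) \<longlonglongrightarrow> 0"
    by simp
  \<comment> \<open>The two errors were added first so that one almost everywhere convergent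
    subsequence serves both densities.\<close>
  then obtain s where s: "AE z in MM. (\<lambda>n. \<bar>dP (s n) z - of_bool (P z)\<bar> + \<bar>dN (s n) z - of_bool (N z)\<bar>) \<longlonglongrightarrow> 0"
    using tendsto_L1_AE_subseq[of MM "\<lambda>k z. \<bar>dP k z - of_bool (P z)\<bar> + \<bar>dN k z - of_bool (N z)\<bar>"] intP intN
    by auto
  define R where "R z \<longleftrightarrow> (\<lambda>n. dP (s n) z) \<longlonglongrightarrow> 1" for z
  define T where "T z \<longleftrightarrow> R z \<and> (\<lambda>n. dN (s n) z) \<longlonglongrightarrow> 0" for z
  have RT[measurable]: "Measurable.pred MM R" "Measurable.pred MM T"
    unfolding R_def[abs_def] T_def[abs_def] by measurable
  have comp: "T (x, z)" if "R (x, y)" "R (y, z)" for x y z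
  proof -
    have pos: "0 < \<mu> k (c k a) \<and> 0 < \<mu> k (c k b)" if "0 < dP k (a, b)" for k a b
      using that \<mu>_nonneg[OF c_less, of k a] \<mu>_nonneg[OF c_less, of k b]
      by (auto simp: dP_def cell_density_def less_le)
    have "\<forall>\<^sub>F n in sequentially. 0 < dP (s n) (x, y)" "\<forall>\<^sub>F n in sequentially. 0 < dP (s n) (y, z)"
      using that unfolding R_def by (auto intro: order_tendstoD(1))
    \<comment> \<open>The first inequality is the triple inequality divided by the masses, the
      second holds because P or N is true everywhere. As both densities on the right tend to 1, that
      of N at (x, z) tends to 0, which forces that of P to 1.\<close>
    then have ev: "\<forall>\<^sub>F n in sequentially. dN (s n) (x, z) \<le> 2 - dP (s n) (x, y) - dP (s n) (y, z) \<and>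
        1 \<le> dP (s n) (x, z) + dN (s n) (x, z)"
    proof eventually_elim
      case (elim n)
      define k where "k = s n"
      define a b d where "a = \<mu> k (c k x)" and "b = \<mu> k (c k y)" and "d = \<mu> k (c k z)"
      have abd: "0 < a" "0 < b" "0 < d" using pos[OF elim(1)] pos[OF elim(2)] by (auto simp: a_def b_def d_def k_def)
      define p q r where "p = cell_mass k P (c k x) (c k y)" and "q = cell_mass k P (c k y) (c k z)"
        and "r = cell_mass k N (c k x) (c k z)"
      have "p * d + a * q + b * r \<le> 2 * (a * b * d)"
        unfolding p_def q_def r_def a_def b_def d_def
        by (rule triple_mass_inequality[OF P P N c_less c_less c_less])
           (use path in \<open>simp only: P_def N_def\<close>)
      then have "(p * d + a * q + b * r) / (a * b * d) \<le> 2" using abd by (simp add: divide_le_eq)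
      moreover have "(p * d + a * q + b * r) / (a * b * d) = p / (a * b) + q / (b * d) + r / (a * d)"
        using abd by (simp add: field_simps)
      moreover have "a * d \<le> cell_mass k P (c k x) (c k z) + r"
        unfolding a_def d_def r_def
        by (rule cell_mass_cover[OF P N c_less c_less]) (use W01 in \<open>auto simp: P_def N_def not_less less_le\<close>)
      then have "1 \<le> (cell_mass k P (c k x) (c k z) + r) / (a * d)" using abd by (simp add: le_divide_eq)
      then have "1 \<le> cell_mass k P (c k x) (c k z) / (a * d) + r / (a * d)" by (simp only: add_divide_distrib)
      moreover have "dP k (x, y) = p / (a * b)" "dP k (y, z) = q / (b * d)" "dN k (x, z) = r / (a * d)"
        "dP k (x, z) = cell_mass k P (c k x) (c k z) / (a * d)"
        by (simp_all add: dP_def dN_def cell_density_def a_def b_def d_def p_def q_def r_def)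
      ultimately show ?case
        unfolding k_def[symmetric] by linarith
    qed
    have "(\<lambda>n. 2 - dP (s n) (x, y) - dP (s n) (y, z)) \<longlonglongrightarrow> 2 - 1 - 1"
      using that unfolding R_def by (intro tendsto_intros)
    then have lim2: "(\<lambda>n. 2 - dP (s n) (x, y) - dP (s n) (y, z)) \<longlonglongrightarrow> 0" by simp
    have N0: "(\<lambda>n. dN (s n) (x, z)) \<longlonglongrightarrow> 0"
    proof (rule tendsto_sandwich[OF _ _ tendsto_const lim2])
      show "\<forall>\<^sub>F n in sequentially. 0 \<le> dN (s n) (x, z)" using dN01(1) by (intro always_eventually allI)
      show "\<forall>\<^sub>F n in sequentially. dN (s n) (x, z) \<le> 2 - dP (s n) (x, y) - dP (s n) (y, z)"
        using ev by (rule eventually_mono) blast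
    qed
    have "(\<lambda>n. 1 - dN (s n) (x, z)) \<longlonglongrightarrow> 1 - 0"
      by (rule tendsto_diff[OF tendsto_const N0])
    then have lim1: "(\<lambda>n. 1 - dN (s n) (x, z)) \<longlonglongrightarrow> 1" by simp
    have "(\<lambda>n. dP (s n) (x, z)) \<longlonglongrightarrow> 1"
    proof (rule tendsto_sandwich[OF _ _ lim1 tendsto_const])
      show "\<forall>\<^sub>F n in sequentially. dP (s n) (x, z) \<le> 1" using dP01(2) by (intro always_eventually allI)
      show "\<forall>\<^sub>F n in sequentially. 1 - dN (s n) (x, z) \<le> dP (s n) (x, z)"
        using ev by (rule eventually_mono) linarith
    qed
    with N0 show ?thesis by (simp add: T_def R_def)
  qed
  have irrefl: "\<not> R (x, x)" for x
  proof
    assume "R (x, x)"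
    then have "(\<lambda>n. dP (s n) (x, x)) \<longlonglongrightarrow> 1" by (simp add: R_def)
    \<comment> \<open>All three vertices are placed in the cell of x. The 3-cycle uses P twice and
      the reversal of P once, and the reversal has the same mass in a diagonal block; so three times
      this density is at most 2.\<close>
    moreover have "dP k (x, x) \<le> 2 / 3" for k
    proof -
      define a where "a = \<mu> k (c k x)"
      define p where "p = cell_mass k P (c k x) (c k x)"
      have "p * a + a * p + a * cell_mass k (\<lambda>z. P (snd z, fst z)) (c k x) (c k x) \<le> 2 * (a * a * a)"
        unfolding p_def a_def
      proof (rule triple_mass_inequality[OF P P _ c_less c_less c_less])
        show "AE x in PiM {0..<3::nat} (\<lambda>_. M). \<not> (P (x 0, x 1) \<and> P (x 1, x 2) \<and> P (snd (x 0, x 2), fst (x 0, x 2)))"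
          using cycle by (simp add: P_def)
      qed measurable
      then have *: "3 * a * p \<le> 2 * (a * a * a)" by (simp add: cell_mass_swap[OF P] p_def)
      have "0 \<le> a" by (simp add: a_def \<mu>_nonneg c_less)
      have "p / (a * a) \<le> 2 / 3"
      proof (cases "a = 0")
        case False
        with \<open>0 \<le> a\<close> have "0 < a" by simp
        have "a * (3 * p) \<le> a * (2 * (a * a))" using * by (simp add: mult_ac)
        then have "3 * p \<le> 2 * (a * a)" using \<open>0 < a\<close> by (simp only: mult_le_cancel_left_pos)
        then show ?thesis using \<open>0 < a\<close> by (simp add: divide_le_eq)
      qed simp
      then show ?thesis by (simp add: dP_def cell_density_def p_def a_def)
    qed
    ultimately have "1 \<le> (2 / 3 :: real)" by (intro LIMSEQ_le_const2) auto
    then show False by simp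
  qed
  \<comment> \<open>The value 1 / 2 is taken on a null set only; it just has to be positive, so that
    \<open>W'\<close> is positive exactly on R.\<close>
  define W' where "W' z = (if T z then 1 else if R z then (if 0 < W z \<and> W z < 1 then W z else 1 / 2) else 0)" for z
  have W'_meas [measurable]: "W' \<in> borel_measurable MM" unfolding W'_def[abs_def] by measurable
  have W'01: "0 \<le> W' z \<and> W' z \<le> 1" for z by (auto simp: W'_def)
  have W'_pos: "0 < W' z \<longleftrightarrow> R z" for z by (auto simp: W'_def T_def)
  have W'_one: "W' z = 1" if "T z" for z using that by (simp add: W'_def)
  have "AE z in MM. W z = W' z"
    using s
  proof eventually_elim
    case (elim z)
    have "(\<lambda>n. dP (s n) z - of_bool (P z)) \<longlonglongrightarrow> 0"
      by (rule tendsto_rabs_zero_cancel, rule tendsto_sandwich[OF _ _ tendsto_const[of 0] elim]) auto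
    then have lP: "(\<lambda>n. dP (s n) z) \<longlonglongrightarrow> of_bool (P z)" by (simp add: LIM_zero_iff)
    have "(\<lambda>n. dN (s n) z - of_bool (N z)) \<longlonglongrightarrow> 0"
      by (rule tendsto_rabs_zero_cancel, rule tendsto_sandwich[OF _ _ tendsto_const[of 0] elim]) auto
    then have lN: "(\<lambda>n. dN (s n) z) \<longlonglongrightarrow> of_bool (N z)" by (simp add: LIM_zero_iff)
    have R: "R z \<longleftrightarrow> P z"
      using lP LIMSEQ_unique[OF lP, of 1] by (auto simp: R_def)
    have T: "T z \<longleftrightarrow> P z \<and> \<not> N z"
      unfolding T_def R using lN LIMSEQ_unique[OF lN, of 0] by auto
    show ?case using W01[of z] by (auto simp: W'_def R T P_def N_def)
  qed
  moreover have "strict_kernel M (\<lambda>x y. 0 < W' (x, y)) (\<lambda>x y. W' (x, y))"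
  proof -
    have "ordered_prob_space M (\<lambda>x y. 0 < W' (x, y))"
      unfolding ordered_prob_space_def
    proof (intro conjI)
      have "{(x, y) \<in> space M \<times> space M. 0 < W' (x, y)} = {z \<in> space MM. 0 < W' z}"
        by (auto simp: space_pair_measure)
      then show "{(x, y) \<in> space M \<times> space M. 0 < W' (x, y)} \<in> sets MM" by simp
      show "\<forall>x\<in>space M. \<forall>y\<in>space M. \<forall>z\<in>space M. 0 < W' (x, y) \<longrightarrow> 0 < W' (y, z) \<longrightarrow> 0 < W' (x, z)"
        unfolding W'_pos using comp unfolding T_def by blast
      show "\<forall>x\<in>space M. \<not> 0 < W' (x, x)"
        unfolding W'_pos using irrefl by blast
    qed (rule prob_space_axioms)
    moreover have "W' (x, z) = 1" if "0 < W' (x, y)" "0 < W' (y, z)" for x y z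
      using W'_one[OF comp] that by (simp add: W'_pos)
    ultimately show ?thesis
      unfolding strict_kernel_def is_kernel_def using W'01 by simp
  qed
  ultimately show thesis using W'01 by (intro that[OF W'_meas]) blast+
qed

end

lemma valid_poset_asym: "valid_poset (q, R) \<Longrightarrow> asym R"
  unfolding valid_poset_def by (auto simp: asym_on_def irrefl_def dest: transD)

lemma strict_kernel_representation:
  assumes "p \<in> Pbar"
  obtains w :: "real \<times> real \<Rightarrow> real" where
    "w \<in> borel_measurable (unit_interval_space \<Otimes>\<^sub>M unit_interval_space)" "\<And>z. 0 \<le> w z \<and> w z \<le> 1"
    "strict_kernel unit_interval_space (\<lambda>x y. 0 < w (x, y)) (\<lambda>x y. w (x, y))"
    "represents unit_interval_space (\<lambda>x y. w (x, y)) p"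
proof -
  let ?I = unit_interval_space
  obtain P where P: "\<And>n::nat. valid_poset (P n)"
    and P_lim: "\<And>Q. valid_poset Q \<Longrightarrow> (\<lambda>n. hom_dens Q (P n)) \<longlonglongrightarrow> fst p Q"
    using Pbar_imp_convergent_posets[OF assms] by blast
  obtain \<mu> :: "nat \<Rightarrow> nat \<Rightarrow> real" and D :: "nat \<Rightarrow> nat \<Rightarrow> nat \<Rightarrow> real" where
    \<mu>: "\<And>k i. 0 \<le> \<mu> k i" "\<And>k. (\<Sum>i<4^k. \<mu> k i) = 1"
      "\<And>k i. \<mu> k i = (\<Sum>i'\<in>{4*i..<4*i+4}. \<mu> (Suc k) i')"
    and D: "\<And>k i j. 0 \<le> D k i j \<and> D k i j \<le> 1"
      "\<And>k i j. D k i j * \<mu> k i * \<mu> k j =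
       (\<Sum>i'\<in>{4*i..<4*i+4}. \<Sum>j'\<in>{4*j..<4*j+4}. D (Suc k) i' j' * \<mu> (Suc k) i' * \<mu> (Suc k) j')"
    and cluster: "\<And>q Q a e L. Q \<subseteq> {0..<q} \<times> {0..<q} \<Longrightarrow> irrefl Q \<Longrightarrow> asym Q \<Longrightarrow>
       (\<lambda>n. hom_dens (q, Q) (P n)) \<longlonglongrightarrow> a \<Longrightarrow> e > 0 \<Longrightarrow>
       \<exists>k\<ge>L. \<bar>block_dens q Q (4^k) (\<mu> k) (D k) - a\<bar> \<le> e"
    by (rule poset_sequence_limit_template[of P]) (use P in blast)+
  obtain c :: "nat \<Rightarrow> real \<Rightarrow> nat" where c:
    "\<And>k. c k \<in> measurable ?I (count_space UNIV)"
    "\<And>k u. c k u < 4 ^ k" "\<And>k u. c (Suc k) u div 4 = c k u"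
    "\<And>k i. i < 4 ^ k \<Longrightarrow> measure ?I {u\<in>space ?I. c k u = i} = \<mu> k i"
    using unit_interval_cells[of \<mu>, OF \<mu>] by blast
  interpret cell_template unit_interval_space c \<mu> D
    by (intro cell_template.intro cell_template_axioms.intro prob_space_unit_interval c D)
  obtain W where W: "W \<in> borel_measurable MM" "\<And>z. 0 \<le> W z \<and> W z \<le> (1::real)"
    and W_lim: "(\<lambda>k. \<integral>z. \<bar>U k z - W z\<bar> \<partial>MM) \<longlonglongrightarrow> 0"
    using U_L1_limit by blast
  have dens: "kernel_dens ?I (\<lambda>x y. W (x, y)) (q, Q) = a"
    if Q: "Q \<subseteq> {0..<q} \<times> {0..<q}" "irrefl Q" "asym Q" and lim: "(\<lambda>n. hom_dens (q, Q) (P n)) \<longlonglongrightarrow> a" for q Q a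
    by (rule kernel_dens_L1_limit[OF Q(1,2) W W_lim cluster[OF Q lim]])
  have dens_poset: "kernel_dens ?I (\<lambda>x y. W (x, y)) (q, Q) = fst p (q, Q)" if "valid_poset (q, Q)" for q Q
    using that by (intro dens P_lim valid_poset_asym) (auto simp: valid_poset_def)
  have trans_P: "trans (snd (P n))" and irrefl_P: "irrefl (snd (P n))" for n
    using P[of n] by (auto simp: valid_poset_def)
  have chain: "valid_poset (3, {(0,1),(1,2),(0,2)})"
    by (auto simp: valid_poset_def irrefl_def trans_def)
  \<comment> \<open>The path is not a transitive relation, so its density is not a coordinate of p
    that carries information. In a poset, however, every image of the path is an image of the chain,
    which identifies the limit.\<close>
  have path_eq: "hom_dens (3, {(0,1),(1,2)}) (P n) = hom_dens (3, {(0,1),(1,2),(0,2)}) (P n)" for n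
  proof -
    have "(\<forall>(i,j)\<in>{(0,1),(1,2)}. (f i, f j) \<in> snd (P n)) \<longleftrightarrow> (\<forall>(i,j)\<in>{(0,1),(1,2),(0,2)}. (f i, f j) \<in> snd (P n))"
      for f :: "nat \<Rightarrow> nat"
      using transD[OF trans_P[of n], of "f 0" "f 1" "f 2"] by auto
    then show ?thesis by (simp add: hom_dens_def)
  qed
  have "kernel_dens ?I (\<lambda>x y. W (x, y)) (3, {(0,1),(1,2)}) = fst p (3, {(0,1),(1,2),(0,2)})"
  proof (rule dens)
    show "(\<lambda>n. hom_dens (3, {(0,1),(1,2)}) (P n)) \<longlonglongrightarrow> fst p (3, {(0,1),(1,2),(0,2)})"
      unfolding path_eq by (rule P_lim[OF chain])
  qed (auto simp: irrefl_def asym_on_def)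
  then have path: "AE x in PiM {0..<3::nat} (\<lambda>_. ?I). \<not> (0 < W (x 0, x 1) \<and> 0 < W (x 1, x 2) \<and> 0 < 1 - W (x 0, x 2))"
    by (intro AE_path_transitive W) (simp only: dens_poset[OF chain])
  \<comment> \<open>Transitivity would close a directed 3-cycle to a loop, so no map of this kind
    into a poset exists.\<close>
  have cycle_0: "hom_dens (3, {(0,1),(1,2),(2,0)}) (P n) = 0" for n
  proof -
    have "\<not> (\<forall>(i,j)\<in>{(0,1),(1,2),(2,0)}. (f i, f j) \<in> snd (P n))" for f :: "nat \<Rightarrow> nat"
      using transD[OF trans_P[of n], of "f 0" "f 1" "f 2"] transD[OF trans_P[of n], of "f 0" "f 2" "f 0"]
        irrefl_P[of n] by (auto simp: irrefl_def)
    then have "{f \<in> {0..<3::nat} \<rightarrow>\<^sub>E {0..<fst (P n)}. \<forall>(i,j)\<in>{(0,1),(1,2),(2,0)}. (f i, f j) \<in> snd (P n)} = {}"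
      by blast
    then show ?thesis by (simp only: hom_dens_def fst_conv snd_conv card.empty of_nat_0 div_0)
  qed
  have "kernel_dens ?I (\<lambda>x y. W (x, y)) (3, {(0,1),(1,2),(2,0)}) = 0"
  proof (rule dens)
    show "(\<lambda>n. hom_dens (3, {(0,1),(1,2),(2,0)}) (P n)) \<longlonglongrightarrow> 0"
      unfolding cycle_0 by (rule tendsto_const)
  qed (auto simp: irrefl_def asym_on_def)
  then have cycle: "AE x in PiM {0..<3::nat} (\<lambda>_. ?I). \<not> (0 < W (x 0, x 1) \<and> 0 < W (x 1, x 2) \<and> 0 < W (x 2, x 0))"
    by (intro AE_no_cycle W)
  obtain w where w: "w \<in> borel_measurable MM" "\<And>z. 0 \<le> w z \<and> w z \<le> (1::real)"
    "AE z in MM. W z = w z" "strict_kernel ?I (\<lambda>x y. 0 < w (x, y)) (\<lambda>x y. w (x, y))"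
    using strict_kernel_modification[OF W W_lim path cycle] by blast
  have "represents ?I (\<lambda>x y. w (x, y)) p"
    unfolding represents_def
  proof (intro allI impI)
    fix Q assume Q: "valid_poset Q"
    obtain q R where QR: "Q = (q, R)" by (cases Q)
    have "fst p (q, R) = kernel_dens ?I (\<lambda>x y. W (x, y)) (q, R)"
      using dens_poset Q QR by simp
    also have "\<dots> = kernel_dens ?I (\<lambda>x y. w (x, y)) (q, R)"
      by (rule kernel_dens_cong_AE) (use Q QR W w in \<open>auto simp: valid_poset_def\<close>)
    finally show "fst p Q = kernel_dens ?I (\<lambda>x y. w (x, y)) Q" using QR by simp
  qed
  with w show thesis by (intro that[of w]) blast+
qed

section \<open>Transport to the unit square\<close>

text \<open>If \<open>x \<prec> y\<close> had down-sets of equal measure for all \<open>x\<close> in a non-null set \<open>B\<close> below \<open>y\<close>, then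
  almost all pairs of points of \<open>B\<close> would be related in both directions.\<close>

lemma (in prob_space) rank_less_AE:
  assumes lt[measurable]: "Measurable.pred (M \<Otimes>\<^sub>M M) lt"
    and asym: "\<And>x y. x \<in> space M \<Longrightarrow> y \<in> space M \<Longrightarrow> lt (x, y) \<Longrightarrow> \<not> lt (y, x)"
    and trans: "\<And>x y z. x \<in> space M \<Longrightarrow> y \<in> space M \<Longrightarrow> z \<in> space M \<Longrightarrow> lt (x, y) \<Longrightarrow> lt (y, z) \<Longrightarrow> lt (x, z)"
  defines "f \<equiv> \<lambda>x. measure M {z\<in>space M. lt (z, x)}"
  shows "f \<in> borel_measurable M" "AE z in M \<Otimes>\<^sub>M M. lt z \<longrightarrow> f (fst z) < f (snd z)"
proof -
  interpret MM: pair_prob_space M M ..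
  have slice: "{z\<in>space M. lt (z, x)} \<in> sets M" if "x \<in> space M" for x
    using that by measurable
  have "f x = enn2real (\<integral>\<^sup>+z. of_bool (lt (z, x)) \<partial>M)" if "x \<in> space M" for x
  proof -
    have "(\<integral>\<^sup>+z. of_bool (lt (z, x)) \<partial>M) = (\<integral>\<^sup>+z. indicator {z\<in>space M. lt (z, x)} z \<partial>M)"
      by (intro nn_integral_cong) (auto simp: indicator_def of_bool_def)
    also have "\<dots> = emeasure M {z\<in>space M. lt (z, x)}"
      by (rule nn_integral_indicator[OF slice[OF that]])
    finally show ?thesis by (simp add: f_def measure_def)
  qed
  moreover have "(\<lambda>z. of_bool (lt (snd z, fst z)) :: ennreal) \<in> borel_measurable (M \<Otimes>\<^sub>M M)"
    by measurable
  from borel_measurable_nn_integral_fst[OF this]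
  have "(\<lambda>x. enn2real (\<integral>\<^sup>+z. of_bool (lt (z, x)) \<partial>M)) \<in> borel_measurable M"
    by simp
  ultimately show f[measurable]: "f \<in> borel_measurable M"
    using measurable_cong[of M f "\<lambda>x. enn2real (\<integral>\<^sup>+z. of_bool (lt (z, x)) \<partial>M)"] by blast
  have mono: "f x \<le> f y" if "x \<in> space M" "y \<in> space M" "lt (x, y)" for x y
    unfolding f_def
  proof (rule finite_measure_mono)
    show "{z\<in>space M. lt (z, x)} \<subseteq> {z\<in>space M. lt (z, y)}" using that trans[of _ x y] by auto
  qed (rule slice[OF that(2)])
  have null: "AE x in M. \<not> (lt (x, y) \<and> f x = f y)" if y: "y \<in> space M" for y
  proof -
    define B where "B x \<longleftrightarrow> lt (x, y) \<and> f x = f y" for x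
    have B[measurable]: "Measurable.pred M B"
      unfolding B_def[abs_def] using y by measurable
    \<comment> \<open>For x in B the down-set of x is contained in that of y and has the same
      measure, so their difference is null. Since B lies in the down-set of y, almost all of B lies
      below x.\<close>
    have 1: "AE x' in M. B x \<and> B x' \<longrightarrow> lt (x', x)" if x: "x \<in> space M" for x
    proof (cases "B x")
      case True
      define Dx Dy where "Dx = {z\<in>space M. lt (z, x)}" and "Dy = {z\<in>space M. lt (z, y)}"
      have D: "Dx \<in> sets M" "Dy \<in> sets M" "Dx \<subseteq> Dy"
        using slice[OF x] slice[OF y] trans[OF _ x y] True by (auto simp: Dx_def Dy_def B_def)
      have "measure M (Dy - Dx) = 0"
        using True D by (simp add: finite_measure_Diff Dx_def Dy_def B_def f_def)
      then have "AE x' in M. x' \<notin> Dy - Dx"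
        using D by (intro AE_not_in) (auto simp: null_sets_def emeasure_eq_measure)
      then show ?thesis using AE_space by eventually_elim (auto simp: B_def Dx_def Dy_def)
    qed simp
    have "AE z in M \<Otimes>\<^sub>M M. B (fst z) \<and> B (snd z) \<longrightarrow> lt (snd z, fst z)"
      by (rule MM.AE_pair_measure) (use 1 in \<open>auto intro!: AE_I2\<close>)
    \<comment> \<open>The same fact with the roles of the two points exchanged, which is where
      Fubini enters.\<close>
    moreover have "AE x in M. AE x' in M. B x' \<and> B x \<longrightarrow> lt (x, x')"
      by (subst MM.AE_commute) (use 1 in \<open>auto intro!: AE_I2\<close>)
    then have "AE z in M \<Otimes>\<^sub>M M. B (snd z) \<and> B (fst z) \<longrightarrow> lt (fst z, snd z)"
      by (intro MM.AE_pair_measure) auto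
    ultimately have "AE z in M \<Otimes>\<^sub>M M. \<not> (B (fst z) \<and> B (snd z))"
      using AE_space by eventually_elim (use asym in \<open>auto simp: space_pair_measure\<close>)
    from MM.AE_pair[OF this] have 2: "AE x in M. AE x' in M. \<not> (B x \<and> B x')" by simp
    show ?thesis
      unfolding B_def[symmetric]
    proof (cases "AE x in M. \<not> B x")
      \<comment> \<open>A single point of B satisfying \<open>2\<close> would already make B null,
        so almost every point avoids B.\<close>
      case False
      with 2 have "AE x in M. \<not> B x"
        by (auto elim!: eventually_mono)
      with False show "AE x in M. \<not> B x" by simp
    qed simp
  qed
  have "AE y in M. AE x in M. \<not> (lt (x, y) \<and> f x = f y)"
    by (rule AE_I2) (rule null)
  then have "AE x in M. AE y in M. \<not> (lt (x, y) \<and> f x = f y)"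
    by (subst MM.AE_commute) auto
  then have "AE z in M \<Otimes>\<^sub>M M. \<not> (lt z \<and> f (fst z) = f (snd z))"
    by (intro MM.AE_pair_measure) auto
  then show "AE z in M \<Otimes>\<^sub>M M. lt z \<longrightarrow> f (fst z) < f (snd z)"
    using AE_space
  proof eventually_elim
    case (elim z)
    then show ?case using mono[of "fst z" "snd z"] by (auto simp: space_pair_measure less_le)
  qed
qed

text \<open>The power of an image measure is the image of the power under the componentwise map, so
  pulling a kernel back along \<phi> preserves densities.\<close>

lemma (in prob_space) kernel_dens_distr:
  assumes \<phi>[measurable]: "\<phi> \<in> measurable M N"
    and W[measurable]: "case_prod W \<in> borel_measurable (N \<Otimes>\<^sub>M N)"
    and Q: "Q \<subseteq> {0..<q} \<times> {0..<q}"
  shows "kernel_dens (distr M N \<phi>) W (q, Q) = kernel_dens M (\<lambda>x y. W (\<phi> x) (\<phi> y)) (q, Q)"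
proof -
  let ?I = "{0..<q}"
  let ?N = "distr M N \<phi>"
  have \<phi>'[measurable]: "\<phi> \<in> measurable M ?N" by simp
  have "distr M ?N \<phi> = ?N" by (rule distr_cong) auto
  then have eq: "distr (PiM ?I (\<lambda>_. M)) (PiM ?I (\<lambda>_. ?N)) (compose ?I \<phi>) = PiM ?I (\<lambda>_. ?N)"
    using distr_PiM_finite_prob_space'[of ?I "\<lambda>_. M" "\<lambda>_. ?N" \<phi>] prob_space_axioms prob_space_distr[OF \<phi>]
    by simp
  have comp: "compose ?I \<phi> \<in> measurable (PiM ?I (\<lambda>_. M)) (PiM ?I (\<lambda>_. ?N))"
    unfolding compose_def by (intro measurable_restrict measurable_compose[OF _ \<phi>'] measurable_component_singleton)
  have "(\<lambda>x. W (x (fst e)) (x (snd e))) \<in> borel_measurable (PiM ?I (\<lambda>_. ?N))" if "e \<in> Q" for e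
  proof -
    have "fst e \<in> ?I" "snd e \<in> ?I" using that Q by auto
    then have "(\<lambda>x. (x (fst e), x (snd e))) \<in> measurable (PiM ?I (\<lambda>_. ?N)) (?N \<Otimes>\<^sub>M ?N)"
      by (intro measurable_Pair measurable_component_singleton)
    moreover have "case_prod W \<in> borel_measurable (?N \<Otimes>\<^sub>M ?N)"
      using W by (simp cong: measurable_cong_sets sets_pair_measure_cong)
    ultimately have "(\<lambda>x. case_prod W (x (fst e), x (snd e))) \<in> borel_measurable (PiM ?I (\<lambda>_. ?N))"
      by (rule measurable_compose)
    then show ?thesis by simp
  qed
  then have meas: "(\<lambda>x. \<Prod>(i,j)\<in>Q. W (x i) (x j)) \<in> borel_measurable (PiM ?I (\<lambda>_. ?N))"
    unfolding case_prod_unfold by (intro borel_measurable_prod)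
  have "kernel_dens ?N W (q, Q) = (\<integral>x. (\<Prod>(i,j)\<in>Q. W (x i) (x j)) \<partial>distr (PiM ?I (\<lambda>_. M)) (PiM ?I (\<lambda>_. ?N)) (compose ?I \<phi>))"
    by (simp add: kernel_dens_def eq)
  also have "\<dots> = (\<integral>x. (\<Prod>(i,j)\<in>Q. W (compose ?I \<phi> x i) (compose ?I \<phi> x j)) \<partial>PiM ?I (\<lambda>_. M))"
    by (rule integral_distr[OF comp meas])
  also have "\<dots> = (\<integral>x. (\<Prod>(i,j)\<in>Q. W (\<phi> (x i)) (\<phi> (x j))) \<partial>PiM ?I (\<lambda>_. M))"
    by (intro Bochner_Integration.integral_cong refl prod.cong) (use Q in \<open>auto simp: compose_def\<close>)
  finally show ?thesis by (simp add: kernel_dens_def)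
qed

section \<open>Lebesgue measure on the unit interval and square\<close>

lemma sets_unit_interval_cong: "sets unit_interval_space = sets (restrict_space borel {0..1})"
  unfolding unit_interval_space_def by (rule sets_restrict_space_cong) simp

lemma measurable_unit_interval_borel [measurable]: "(\<lambda>x. x) \<in> borel_measurable unit_interval_space"
  unfolding unit_interval_space_def by (rule measurable_restrict_space1) simp

lemma emeasure_unit_interval:
  assumes "A \<in> sets borel" "A \<subseteq> {0..1}"
  shows "emeasure unit_interval_space A = emeasure lborel A"
  unfolding unit_interval_space_def using assms by (intro emeasure_restrict_space) auto

text \<open>The sigma-algebras are compared through measurability of the identity in both
  directions; the measures then agree on rectangles.\<close>

lemma unit_square_eq_pair: "unit_square_space = unit_interval_space \<Otimes>\<^sub>M unit_interval_space"
proof (rule pair_measure_eqI[symmetric])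
  interpret I: prob_space unit_interval_space by (rule prob_space_unit_interval)
  show "sigma_finite_measure unit_interval_space" "sigma_finite_measure unit_interval_space" by unfold_locales
  have *: "sets unit_square_space = sets (restrict_space (borel \<Otimes>\<^sub>M borel) ({0..1::real} \<times> {0..1::real}))"
    unfolding unit_square_space_def borel_prod by (rule sets_restrict_space_cong) simp
  show "sets (unit_interval_space \<Otimes>\<^sub>M unit_interval_space) = sets unit_square_space"
  proof
    have id: "(\<lambda>z. (fst z, snd z)) \<in> measurable (restrict_space (borel \<Otimes>\<^sub>M borel) ({0..1::real} \<times> {0..1::real}))
        (unit_interval_space \<Otimes>\<^sub>M unit_interval_space)"
      by (intro measurable_Pair; unfold measurable_cong_sets[OF refl sets_unit_interval_cong];
          intro measurable_restrict_space2 measurable_restrict_space1) (auto simp: space_restrict_space space_pair_measure)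
    show "sets (unit_interval_space \<Otimes>\<^sub>M unit_interval_space) \<subseteq> sets unit_square_space"
    proof
      fix X assume X: "X \<in> sets (unit_interval_space \<Otimes>\<^sub>M unit_interval_space)"
      from measurable_sets[OF id X] sets.sets_into_space[OF X]
      show "X \<in> sets unit_square_space"
        unfolding * by (simp add: space_restrict_space space_pair_measure Int_absorb2)
    qed
    have id': "(\<lambda>z. (fst z, snd z)) \<in> measurable (unit_interval_space \<Otimes>\<^sub>M unit_interval_space) (borel \<Otimes>\<^sub>M borel)"
      by (intro measurable_Pair measurable_compose[OF measurable_fst measurable_unit_interval_borel]
          measurable_compose[OF measurable_snd measurable_unit_interval_borel])
    show "sets unit_square_space \<subseteq> sets (unit_interval_space \<Otimes>\<^sub>M unit_interval_space)"
    proof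
      fix X assume "X \<in> sets unit_square_space"
      then obtain Y where Y: "Y \<in> sets (borel \<Otimes>\<^sub>M borel)" "X = ({0..1} \<times> {0..1}) \<inter> Y"
        unfolding * by (auto simp: sets_restrict_space)
      from measurable_sets[OF id' Y(1)] show "X \<in> sets (unit_interval_space \<Otimes>\<^sub>M unit_interval_space)"
        by (simp add: Y(2) space_pair_measure Int_commute)
    qed
  qed
  fix A B assume "A \<in> sets unit_interval_space" "B \<in> sets unit_interval_space"
  then have A: "A \<in> sets borel" "A \<subseteq> {0..1}" and B: "B \<in> sets borel" "B \<subseteq> {0..1}"
    by (auto simp: unit_interval_space_def sets_restrict_space)
  have "emeasure unit_square_space (A \<times> B) = emeasure lborel (A \<times> B)"
    unfolding unit_square_space_def using A B by (intro emeasure_restrict_space) (auto intro!: borel_Times)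
  also have "\<dots> = emeasure (lborel \<Otimes>\<^sub>M lborel) (A \<times> B)" by (simp add: lborel_prod)
  also have "\<dots> = emeasure lborel A * emeasure lborel B"
    using A B by (intro lborel.emeasure_pair_measure_Times) auto
  finally show "emeasure unit_interval_space A * emeasure unit_interval_space B = emeasure unit_square_space (A \<times> B)"
    using A B by (simp add: emeasure_unit_interval)
qed

section \<open>Quantile transforms\<close>

text \<open>The generalised inverse \<open>I\<close> of the distribution function does this on (0,
  1); what remains is a monotone extension to the closed interval.\<close>

lemma monotone_quantile:
  fixes \<nu> :: "real measure"
  assumes "prob_space \<nu>" and sets: "sets \<nu> = sets borel" and ae: "AE t in \<nu>. 0 \<le> t \<and> t \<le> 1"
  obtains q where "mono_on {0..1} q" "q \<in> borel_measurable unit_interval_space"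
    "distr unit_interval_space borel q = \<nu>"
proof -
  interpret prob_space \<nu> by fact
  interpret cdf_distribution \<nu>
    by (intro cdf_distribution.intro real_distribution.intro real_distribution_axioms.intro) (use assms in auto)
  have C1: "cdf \<nu> 1 = 1"
  proof -
    have "AE t in \<nu>. t \<in> {..1}" using ae by eventually_elim auto
    then show ?thesis unfolding cdf_def by (subst (asm) AE_in_set_eq_1) auto
  qed
  \<comment> \<open>The lower bound is -1 rather than 0 because the distribution function vanishes
    there even if \<nu> has an atom at 0. The values -1 and 1 are later given to the two end points,
    a null set.\<close>
  have C0: "cdf \<nu> (-1) = 0"
  proof -
    have "measure \<nu> {..-1} = measure \<nu> {}"
    proof (rule measure_eq_AE)
      show "AE t in \<nu>. t \<in> {..-1} \<longleftrightarrow> t \<in> {}" using ae by eventually_elim auto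
    qed auto
    then show ?thesis by (simp add: cdf_def)
  qed
  have I_bounds: "-1 \<le> I \<omega>" "I \<omega> \<le> 1" if "0 < \<omega>" "\<omega> < 1" for \<omega>
    using pseudoinverse[OF that, of "-1"] pseudoinverse[OF that, of 1] C0 C1 that by auto
  define q where "q x = (if x \<le> 0 then -1 else if x \<ge> 1 then 1 else I x)" for x
  have mono: "mono_on {0..1} q"
    unfolding mono_on_def
  proof (intro allI impI)
    fix x y :: real assume "x \<in> {0..1} \<and> y \<in> {0..1} \<and> x \<le> y"
    then show "q x \<le> q y"
      using I_bounds[of x] I_bounds[of y] mono_onD[OF mono_I, of x y] by (auto simp: q_def)
  qed
  have meas: "q \<in> borel_measurable unit_interval_space"
    using borel_measurable_mono_on_fnc[OF mono] by (simp cong: measurable_cong_sets add: sets_unit_interval_cong)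
  have "distr unit_interval_space borel q = distr (restrict_space lborel {0<..<1::real}) borel I"
  proof (rule measure_eqI)
    fix A assume "A \<in> sets (distr unit_interval_space borel q)"
    then have A: "A \<in> sets borel" by simp
    have qm: "q -` A \<inter> {0..1} \<in> sets borel"
      using measurable_sets[OF meas A] by (simp add: unit_interval_space_def sets_restrict_space_iff space_restrict_space)
    have Im: "I -` A \<inter> {0<..<1} \<in> sets borel"
      using measurable_sets[OF measurable_CI A] by (simp add: sets_restrict_space_iff space_restrict_space)
    have I_meas: "I \<in> borel_measurable (restrict_space lborel {0<..<1})"
      using measurable_CI measurable_cong_sets[OF sets_restrict_space_cong[OF sets_lborel] refl] by blast
    have "emeasure (distr unit_interval_space borel q) A = emeasure unit_interval_space (q -` A \<inter> {0..1})"
      by (simp add: emeasure_distr[OF meas A])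
    also have "\<dots> = emeasure lborel (q -` A \<inter> {0..1})"
      using qm by (intro emeasure_unit_interval) auto
    also have "\<dots> = emeasure lborel (I -` A \<inter> {0<..<1})"
    proof (rule emeasure_eq_AE)
      show "AE x in lborel. x \<in> q -` A \<inter> {0..1} \<longleftrightarrow> x \<in> I -` A \<inter> {0<..<1}"
        using AE_lborel_singleton[of 0] AE_lborel_singleton[of 1] by eventually_elim (auto simp: q_def)
    qed (use qm Im in auto)
    also have "\<dots> = emeasure (restrict_space lborel {0<..<1}) (I -` A \<inter> {0<..<1})"
      by (rule emeasure_restrict_space[symmetric]) auto
    also have "\<dots> = emeasure (distr (restrict_space lborel {0<..<1::real}) borel I) A"
      by (simp add: emeasure_distr[OF I_meas A] space_restrict_space)
    finally show "emeasure (distr unit_interval_space borel q) A = emeasure (distr (restrict_space lborel {0<..<1::real}) borel I) A" .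
  qed simp
  also have "\<dots> = \<nu>" by (rule distr_I_eq_M)
  finally show thesis using that mono meas by blast
qed

text \<open>Test the hypothesis on the set where the conclusion fails; finiteness of the integral of
  G permits the subtraction.\<close>

lemma AE_le_if_nn_integral_le:
  fixes F G :: "'a \<Rightarrow> ennreal"
  assumes [measurable]: "F \<in> borel_measurable M" "G \<in> borel_measurable M"
    and le: "\<And>A. A \<in> sets M \<Longrightarrow> (\<integral>\<^sup>+x\<in>A. F x \<partial>M) \<le> (\<integral>\<^sup>+x\<in>A. G x \<partial>M)"
    and fin: "(\<integral>\<^sup>+x. G x \<partial>M) \<noteq> \<infinity>"
  shows "AE x in M. F x \<le> G x"
proof -
  define A where "A = {x\<in>space M. G x < F x}"
  have A[measurable]: "A \<in> sets M" unfolding A_def by measurable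
  have finA: "(\<integral>\<^sup>+x\<in>A. G x \<partial>M) \<noteq> \<infinity>"
  proof -
    have "(\<integral>\<^sup>+x\<in>A. G x \<partial>M) \<le> (\<integral>\<^sup>+x. G x \<partial>M)"
      by (intro nn_integral_mono) (auto simp: indicator_def)
    then show ?thesis using fin by (auto simp: top_unique)
  qed
  have "(\<integral>\<^sup>+x. F x * indicator A x - G x * indicator A x \<partial>M) = (\<integral>\<^sup>+x\<in>A. F x \<partial>M) - (\<integral>\<^sup>+x\<in>A. G x \<partial>M)"
    by (rule nn_integral_diff) (use finA in \<open>auto simp: A_def indicator_def less_imp_le\<close>)
  also have "\<dots> = 0"
    using le[OF A] finA le_less_trans[OF le[OF A], of top] by (simp add: diff_eq_0_iff_ennreal less_top)
  finally have "AE x in M. F x * indicator A x - G x * indicator A x = 0"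
    by (subst (asm) nn_integral_0_iff_AE) auto
  then show ?thesis
    using AE_space
  proof eventually_elim
    case (elim x)
    show ?case
    proof (rule ccontr)
      assume "\<not> F x \<le> G x"
      then have "x \<in> A" "G x < F x" using elim(2) by (auto simp: A_def)
      then show False using elim(1) diff_gr0_ennreal[of "G x" "F x"] by simp
    qed
  qed
qed

text \<open>For fixed A, restrict both measures to A x UNIV and project to the second coordinate:
  the results agree on half-lines, hence on all Borel sets. So the measures agree on rectangles,
  which form a generator stable under intersections.\<close>

lemma real_pair_measure_eqI:
  fixes J1 J2 :: "(real \<times> real) measure"
  assumes J1: "finite_measure J1" "sets J1 = sets (borel \<Otimes>\<^sub>M borel)"
    and J2: "finite_measure J2" "sets J2 = sets (borel \<Otimes>\<^sub>M borel)"
    and eq: "\<And>A a. A \<in> sets borel \<Longrightarrow> emeasure J1 (A \<times> {a<..}) = emeasure J2 (A \<times> {a<..})"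
  shows "J1 = J2"
proof -
  have rect: "emeasure J1 (A \<times> B) = emeasure J2 (A \<times> B)" if A: "A \<in> sets borel" and B: "B \<in> sets borel" for A B
  proof -
    define D where "D J = distr (density J (indicator (A \<times> UNIV))) borel snd" for J :: "(real \<times> real) measure"
    have D: "emeasure (D J) C = emeasure J (A \<times> C)" if J: "sets J = sets (borel \<Otimes>\<^sub>M borel)" and C: "C \<in> sets borel" for J C
    proof -
      have "snd \<in> measurable J borel"
        unfolding measurable_cong_sets[OF J refl] by (rule measurable_snd)
      then have snd: "snd \<in> measurable (density J (indicator (A \<times> UNIV))) borel" by simp
      have sp: "space J = UNIV" using sets_eq_imp_space_eq[OF J] by (simp add: space_pair_measure)
      have sets: "A \<times> UNIV \<in> sets J" "UNIV \<times> C \<in> sets J" using A C by (auto simp: J)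
      have "emeasure (D J) C = emeasure (density J (indicator (A \<times> UNIV))) (UNIV \<times> C)"
        unfolding D_def using C by (subst emeasure_distr[OF snd]) (auto simp: sp vimage_def intro!: arg_cong2[where f = emeasure])
      also have "\<dots> = (\<integral>\<^sup>+z. indicator (A \<times> C) z \<partial>J)"
        using sets by (subst emeasure_density) (auto intro!: nn_integral_cong simp: indicator_def)
      also have "\<dots> = emeasure J (A \<times> C)"
        using A C by (intro nn_integral_indicator) (simp add: J)
      finally show ?thesis .
    qed
    have "D J1 = D J2"
    proof (rule measure_eqI_lessThan)
      fix a :: real
      show "emeasure (D J1) {a<..} = emeasure (D J2) {a<..}"
        using eq[OF A] J1 J2 by (simp add: D)
      show "emeasure (D J1) {a<..} < \<infinity>"
        using J1 finite_measure.emeasure_finite[OF J1(1)] by (simp add: D less_top)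
    qed (simp_all add: D_def)
    then have "emeasure (D J1) B = emeasure (D J2) B" by simp
    then show ?thesis using D[OF J1(2) B] D[OF J2(2) B] by simp
  qed
  let ?E = "{a \<times> b | a b. a \<in> sets (borel :: real measure) \<and> b \<in> sets (borel :: real measure)}"
  show ?thesis
  proof (rule measure_eqI_generator_eq[where E = ?E and \<Omega> = UNIV and A = "\<lambda>_. UNIV"])
    show "Int_stable ?E" by (rule Int_stable_pair_measure_generator)
    show "sets J1 = sigma_sets UNIV ?E" "sets J2 = sigma_sets UNIV ?E"
      using J1(2) J2(2) by (simp_all add: sets_pair_measure)
    show "range (\<lambda>_. UNIV) \<subseteq> ?E" by (auto intro!: exI[of _ UNIV])
    show "emeasure J1 X = emeasure J2 X" if "X \<in> ?E" for X using that rect by auto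
    show "emeasure J1 UNIV \<noteq> \<infinity>" using finite_measure.emeasure_finite[OF J1(1)] by simp
  qed auto
qed

lemma emeasure_unit_interval_less:
  fixes \<kappa> :: ennreal
  assumes "\<kappa> \<le> 1"
  shows "(\<integral>\<^sup>+y. of_bool (ennreal y < \<kappa>) \<partial>unit_interval_space) = \<kappa>"
proof -
  obtain c where c: "\<kappa> = ennreal c" "0 \<le> c" "c \<le> 1"
    using assms by (cases \<kappa>) (auto simp: top_unique)
  have "(\<integral>\<^sup>+y. of_bool (ennreal y < \<kappa>) \<partial>unit_interval_space) = (\<integral>\<^sup>+y. indicator {0..<c} y \<partial>unit_interval_space)"
    by (intro nn_integral_cong) (auto simp: c ennreal_less_iff indicator_def)
  also have "\<dots> = emeasure unit_interval_space {0..<c}"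
    by (rule nn_integral_indicator) (use c in \<open>auto simp: unit_interval_space_def sets_restrict_space_iff\<close>)
  also have "\<dots> = \<kappa>" using c by (subst emeasure_unit_interval) auto
  finally show ?thesis .
qed

text \<open>Conditional tails will be controlled at countably many levels only. The event g > a is
  the increasing union of the events g > \<open>\<sigma> n\<close>, so a real level is reached from
  above through rational ones.\<close>

lemma rational_sequence_from_above:
  fixes a :: real
  assumes "0 \<le> a" "a < 1"
  obtains \<sigma> :: "nat \<Rightarrow> real" where "\<And>n. \<sigma> n \<in> \<rat> \<inter> {0..1}" "\<And>n. a < \<sigma> n" "\<And>n. \<sigma> (Suc n) \<le> \<sigma> n"
    "\<And>b. a < b \<Longrightarrow> \<exists>n. \<sigma> n < b"
proof -
  define P where "P n s \<longleftrightarrow> s \<in> \<rat> \<and> a < s \<and> s \<le> 1 \<and> s < a + inverse (real (Suc n))" for n s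
  have ex: "\<exists>s'. P n s' \<and> s' \<le> s" if "a < s" "s \<le> 1" for n s
  proof -
    have "a < min s (a + inverse (real (Suc n)))" using that by simp
    from Rats_dense_in_real[OF this] show ?thesis using that by (auto simp: P_def)
  qed
  have "\<exists>\<sigma>. \<forall>n. P n (\<sigma> n) \<and> \<sigma> (Suc n) \<le> \<sigma> n"
  proof (rule dependent_nat_choice)
    show "\<exists>s. P 0 s" using ex[of 1 0] assms by auto
    show "\<exists>s'. P (Suc n) s' \<and> s' \<le> s" if "P n s" for s n using ex[of s "Suc n"] that by (auto simp: P_def)
  qed
  then obtain \<sigma> where \<sigma>: "\<And>n. P n (\<sigma> n)" "\<And>n. \<sigma> (Suc n) \<le> \<sigma> n" by blast
  show thesis
  proof
    show "\<exists>n. \<sigma> n < b" if ab: "a < b" for b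
    proof -
      obtain n where "inverse (real (Suc n)) < b - a" using reals_Archimedean[of "b - a"] ab by auto
      then show ?thesis using \<sigma>(1)[of n] by (auto simp: P_def intro!: exI[of _ n])
    qed
    show "\<sigma> n \<in> \<rat> \<inter> {0..1}" for n using \<sigma>(1)[of n] assms by (auto simp: P_def)
  qed (use \<sigma> in \<open>auto simp: P_def\<close>)
qed

text \<open>The second coordinate is the generalised inverse of the conditional tail function of \<open>g\<close> given
  \<open>f\<close>, which is a Radon-Nikodym derivative for each rational level.\<close>

lemma joint_quantile:
  fixes f g :: "'a \<Rightarrow> real"
  assumes "prob_space M" and f[measurable]: "f \<in> borel_measurable M" and g[measurable]: "g \<in> borel_measurable M"
    and f01: "\<And>x. x \<in> space M \<Longrightarrow> 0 \<le> f x \<and> f x \<le> 1" and g01: "\<And>x. x \<in> space M \<Longrightarrow> 0 \<le> g x \<and> g x \<le> 1"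
  obtains q \<rho> where "mono_on {0..1} q" "q \<in> borel_measurable unit_interval_space"
    "\<rho> \<in> borel_measurable (unit_interval_space \<Otimes>\<^sub>M unit_interval_space)" "\<And>z. 0 \<le> \<rho> z \<and> \<rho> z \<le> 1"
    "distr (unit_interval_space \<Otimes>\<^sub>M unit_interval_space) (borel \<Otimes>\<^sub>M borel) (\<lambda>z. (q (fst z), \<rho> z)) =
      distr M (borel \<Otimes>\<^sub>M borel) (\<lambda>x. (f x, g x))"
proof -
  interpret prob_space M by fact
  let ?I = unit_interval_space
  interpret I: prob_space ?I by (rule prob_space_unit_interval)
  interpret II: pair_prob_space ?I ?I ..
  define \<nu> where "\<nu> = distr M borel f"
  interpret \<nu>: prob_space \<nu> unfolding \<nu>_def by (rule prob_space_distr) simp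
  have \<nu>_sets [simp, measurable_cong]: "sets \<nu> = sets borel" by (simp add: \<nu>_def)
  have "AE t in \<nu>. 0 \<le> t \<and> t \<le> 1"
    unfolding \<nu>_def by (subst AE_distr_iff) (use f01 in auto)
  then obtain q where q_mono: "mono_on {0..1} q" and q[measurable]: "q \<in> borel_measurable ?I" and q_distr: "distr ?I borel q = \<nu>"
    using monotone_quantile[OF \<nu>.prob_space_axioms \<nu>_sets] by blast
  define T where "T A s = emeasure M {x\<in>space M. f x \<in> A \<and> s < g x}" for A s
  define N where "N s = distr (density M (indicator {x\<in>space M. s < g x})) borel f" for s
  have N: "emeasure (N s) A = T A s" if A[measurable]: "A \<in> sets borel" for s A
  proof -
    have "emeasure (N s) A = emeasure (density M (indicator {x\<in>space M. s < g x})) (f -` A \<inter> space M)"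
      unfolding N_def using A by (subst emeasure_distr) auto
    also have "\<dots> = (\<integral>\<^sup>+x\<in>f -` A \<inter> space M. indicator {x\<in>space M. s < g x} x \<partial>M)"
      using A by (intro emeasure_density) auto
    also have "\<dots> = (\<integral>\<^sup>+x. indicator {x\<in>space M. f x \<in> A \<and> s < g x} x \<partial>M)"
      by (intro nn_integral_cong) (auto simp: indicator_def)
    also have "\<dots> = T A s" unfolding T_def by (rule nn_integral_indicator) measurable
    finally show ?thesis .
  qed
  have \<nu>_eq: "emeasure \<nu> A = emeasure M {x\<in>space M. f x \<in> A}" if "A \<in> sets borel" for A
    unfolding \<nu>_def using that by (subst emeasure_distr) (auto simp: vimage_def Int_def conj_commute intro!: arg_cong2[where f = emeasure])
  have T_mono: "T A s' \<le> T A s" if "A \<in> sets borel" "s \<le> s'" for A s s'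
    unfolding T_def using that by (intro emeasure_mono) auto
  have T_le: "T A s \<le> emeasure \<nu> A" if "A \<in> sets borel" for A s
    unfolding T_def \<nu>_eq[OF that] using that by (intro emeasure_mono) auto
  \<comment> \<open>A version of the conditional probability of g > s given f = t, chosen separately
    for each s.\<close>
  define K where "K s = RN_deriv \<nu> (N s)" for s
  have K_meas[measurable]: "K s \<in> borel_measurable borel" for s
    using borel_measurable_RN_deriv[of \<nu> "N s"] by (simp add: K_def cong: measurable_cong_sets)
  have K_meas'[simp]: "K s \<in> borel_measurable \<nu>" for s by (simp add: K_def)
  have K: "(\<integral>\<^sup>+t\<in>A. K s t \<partial>\<nu>) = T A s" if A[measurable]: "A \<in> sets borel" for s A
  proof -
    have "absolutely_continuous \<nu> (N s)"
      unfolding absolutely_continuous_def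
    proof
      fix A assume "A \<in> null_sets \<nu>"
      then have "A \<in> sets borel" "emeasure \<nu> A = 0" by auto
      then show "A \<in> null_sets (N s)"
        using T_le[of A s] N[of A s] by (auto simp: null_sets_def N_def)
    qed
    then have "density \<nu> (K s) = N s"
      unfolding K_def by (rule \<nu>.density_RN_deriv) (simp add: N_def)
    then have "emeasure (density \<nu> (K s)) A = T A s" using N[OF A] by simp
    then show ?thesis using A by (subst (asm) emeasure_density) auto
  qed
  \<comment> \<open>With countably many levels one null set takes care of the bound by 1 and of
    monotonicity in s simultaneously.\<close>
  define S where "S = \<rat> \<inter> {0..1::real}"
  have S: "countable S" "0 \<in> S" unfolding S_def using countable_rat by (auto intro: countable_subset)
  have "AE t in \<nu>. \<forall>s\<in>S. K s t \<le> 1"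
  proof (subst AE_ball_countable[OF S(1)], intro ballI)
    fix s
    show "AE t in \<nu>. K s t \<le> 1"
    proof (rule AE_le_if_nn_integral_le)
      fix A assume "A \<in> sets \<nu>"
      then have A: "A \<in> sets borel" by simp
      then show "(\<integral>\<^sup>+t\<in>A. K s t \<partial>\<nu>) \<le> (\<integral>\<^sup>+t\<in>A. 1 \<partial>\<nu>)" using T_le[OF A, of s] by (simp add: K)
    qed (auto simp: \<nu>.emeasure_space_1)
  qed
  moreover have "AE t in \<nu>. \<forall>s\<in>S. \<forall>s'\<in>S. s \<le> s' \<longrightarrow> K s' t \<le> K s t"
  proof (subst AE_ball_countable[OF S(1)], intro ballI, subst AE_ball_countable[OF S(1)], intro ballI)
    fix s s'
    show "AE t in \<nu>. s \<le> s' \<longrightarrow> K s' t \<le> K s t"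
    proof (cases "s \<le> s'")
      case True
      have "AE t in \<nu>. K s' t \<le> K s t"
      proof (rule AE_le_if_nn_integral_le)
        fix A assume "A \<in> sets \<nu>"
        then show "(\<integral>\<^sup>+t\<in>A. K s' t \<partial>\<nu>) \<le> (\<integral>\<^sup>+t\<in>A. K s t \<partial>\<nu>)" using True by (simp add: K T_mono)
      next
        have "(\<integral>\<^sup>+t. K s t \<partial>\<nu>) = T UNIV s" using K[of UNIV s] by simp
        then show "(\<integral>\<^sup>+t. K s t \<partial>\<nu>) \<noteq> \<infinity>" by (simp add: T_def)
      qed auto
      then show ?thesis by eventually_elim simp
    qed simp
  qed
  ultimately have K_ae: "AE t in \<nu>. (\<forall>s\<in>S. K s t \<le> 1) \<and> (\<forall>s\<in>S. \<forall>s'\<in>S. s \<le> s' \<longrightarrow> K s' t \<le> K s t)"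
    by eventually_elim blast
  \<comment> \<open>The supremum of the levels whose conditional tail still exceeds y. Failing
    levels contribute 0, and 0 is itself a level, so the supremum is over a nonempty set and lies in
    [0, 1].\<close>
  define r where "r t y = (SUP s\<in>S. if ennreal y < K s t then s else 0)" for t y
  have bdd: "bdd_above ((\<lambda>s. if ennreal y < K s t then s else 0) ` S)" for t y
    by (rule bdd_aboveI[of _ 1]) (auto simp: S_def)
  have r01: "0 \<le> r t y \<and> r t y \<le> 1" for t y
  proof
    show "0 \<le> r t y" unfolding r_def
      by (rule cSUP_upper2[OF bdd S(2)]) simp
    show "r t y \<le> 1" unfolding r_def
      by (rule cSUP_least) (use S(2) in \<open>auto simp: S_def\<close>)
  qed
  have r_less: "a < r t y \<longleftrightarrow> (\<exists>s\<in>S. a < s \<and> ennreal y < K s t)" if "0 \<le> a" for a t y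
    unfolding r_def using that S(2) bdd by (subst less_cSUP_iff) auto
  have [measurable]: "(\<lambda>x. r (q (fst x)) (snd x)) \<in> borel_measurable (?I \<Otimes>\<^sub>M ?I)"
  proof -
    have [measurable]: "(\<lambda>z. snd z) \<in> borel_measurable (?I \<Otimes>\<^sub>M ?I)"
      by (rule measurable_compose[OF measurable_snd measurable_unit_interval_borel])
    show ?thesis unfolding r_def
      by (rule borel_measurable_cSUP[OF S(1) _ bdd]) measurable
  qed
  define \<rho> where "\<rho> z = r (q (fst z)) (snd z)" for z
  have \<rho>[measurable]: "\<rho> \<in> borel_measurable (?I \<Otimes>\<^sub>M ?I)" unfolding \<rho>_def by measurable
  let ?\<phi> = "\<lambda>z. (q (fst z), \<rho> z)"
  have \<phi>[measurable]: "?\<phi> \<in> measurable (?I \<Otimes>\<^sub>M ?I) (borel \<Otimes>\<^sub>M borel)" by measurable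
  \<comment> \<open>For almost every t and for 0 \<le> a < 1, the set of y with a <
    \<open>r t y\<close> has length equal to the supremum of the conditional tails at levels above
    a; integrating over t in A gives the mass of A x {a<..}. These sets determine the joint
    law.\<close>
  have key: "emeasure (?I \<Otimes>\<^sub>M ?I) {z\<in>space (?I \<Otimes>\<^sub>M ?I). q (fst z) \<in> A \<and> a < \<rho> z} = T A a" if A[measurable]: "A \<in> sets borel" for A a
  proof -
    define G where "G t = (\<integral>\<^sup>+y. of_bool (a < r t y) \<partial>?I)" for t
    have "emeasure (?I \<Otimes>\<^sub>M ?I) {z\<in>space (?I \<Otimes>\<^sub>M ?I). q (fst z) \<in> A \<and> a < \<rho> z} =
       (\<integral>\<^sup>+z. indicator {z\<in>space (?I \<Otimes>\<^sub>M ?I). q (fst z) \<in> A \<and> a < \<rho> z} z \<partial>(?I \<Otimes>\<^sub>M ?I))"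
      by (rule nn_integral_indicator[symmetric]) measurable
    also have "\<dots> = (\<integral>\<^sup>+z. indicator A (q (fst z)) * of_bool (a < \<rho> z) \<partial>(?I \<Otimes>\<^sub>M ?I))"
      by (intro nn_integral_cong) (auto simp: indicator_def)
    also have "\<dots> = (\<integral>\<^sup>+x. \<integral>\<^sup>+y. indicator A (q x) * of_bool (a < r (q x) y) \<partial>?I \<partial>?I)"
      by (subst I.nn_integral_fst[symmetric]) (auto simp: \<rho>_def)
    also have "\<dots> = (\<integral>\<^sup>+x. indicator A (q x) * G (q x) \<partial>?I)"
      unfolding G_def by (intro nn_integral_cong) (auto simp: indicator_def)
    also have "\<dots> = T A a"
    \<comment> \<open>For a outside [0, 1) the range [0, 1] of g and \<rho> decides the matter; only
      in between are the rational levels used.\<close>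
    proof (cases "a < 0")
      case True
      have "G t = 1" for t
        unfolding G_def using True r01[of t] using I.emeasure_space_1 by (simp add: less_le_trans)
      then have "(\<integral>\<^sup>+x. indicator A (q x) * G (q x) \<partial>?I) = (\<integral>\<^sup>+x. indicator A (q x) \<partial>?I)" by simp
      also have "\<dots> = (\<integral>\<^sup>+t. indicator A t \<partial>distr ?I borel q)"
        by (rule nn_integral_distr[OF q, symmetric]) simp
      also have "\<dots> = emeasure \<nu> A" using A by (simp add: q_distr)
      also have "\<dots> = T A a"
        unfolding \<nu>_eq[OF A] T_def using True g01 by (intro arg_cong2[where f = emeasure]) (auto intro: less_le_trans)
      finally show ?thesis .
    next
      case False
      then have a0: "0 \<le> a" by simp
      show ?thesis
      proof (cases "a < 1")
        case False
        have "\<not> a < r t y" for t y using r01[of t y] False by linarith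
        then have "G t = 0" for t by (simp add: G_def)
        moreover have "T A a = 0"
        proof -
          have "{x\<in>space M. f x \<in> A \<and> a < g x} = {}" using g01 False by fastforce
          then show ?thesis by (simp only: T_def emeasure_empty)
        qed
        ultimately show ?thesis by simp
      next
        case True
        obtain \<sigma> :: "nat \<Rightarrow> real" where \<sigma>: "\<And>n. \<sigma> n \<in> S" "\<And>n. a < \<sigma> n" "\<And>n. \<sigma> (Suc n) \<le> \<sigma> n"
          "\<And>b. a < b \<Longrightarrow> \<exists>n. \<sigma> n < b"
          using rational_sequence_from_above[OF a0 True] unfolding S_def by metis
        have G_ae: "AE t in \<nu>. G t = (SUP n. K (\<sigma> n) t)"
          using K_ae
        proof eventually_elim
          case (elim t)
          have "a < r t y \<longleftrightarrow> ennreal y < (SUP n. K (\<sigma> n) t)" for y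
          proof
            assume "a < r t y"
            then obtain s where s: "s \<in> S" "a < s" "ennreal y < K s t" using r_less[OF a0] by blast
            then obtain n where "\<sigma> n < s" using \<sigma>(4) by blast
            then have "K s t \<le> K (\<sigma> n) t" using elim s \<sigma>(1)[of n] by auto
            also have "\<dots> \<le> (SUP n. K (\<sigma> n) t)" by (rule SUP_upper) simp
            finally show "ennreal y < (SUP n. K (\<sigma> n) t)" using s(3) by (rule less_le_trans[rotated])
          next
            assume "ennreal y < (SUP n. K (\<sigma> n) t)"
            then obtain n where "ennreal y < K (\<sigma> n) t" by (auto simp: less_SUP_iff)
            then show "a < r t y" using r_less[OF a0] \<sigma>(1,2) by blast
          qed
          moreover have "(SUP n. K (\<sigma> n) t) \<le> 1" using elim \<sigma>(1) by (intro SUP_least) blast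
          ultimately show ?case unfolding G_def by (simp add: emeasure_unit_interval_less)
        qed
        have K_inc: "AE t in \<nu>. K (\<sigma> n) t * indicator A t \<le> K (\<sigma> (Suc n)) t * indicator A t" for n
          using K_ae by eventually_elim (use \<sigma> in \<open>auto simp: indicator_def\<close>)
        have T_SUP: "(SUP n. T A (\<sigma> n)) = T A a"
        proof -
          have "(SUP n. emeasure M {x\<in>space M. f x \<in> A \<and> \<sigma> n < g x}) = emeasure M (\<Union>n. {x\<in>space M. f x \<in> A \<and> \<sigma> n < g x})"
          proof (rule SUP_emeasure_incseq)
            show "incseq (\<lambda>n. {x\<in>space M. f x \<in> A \<and> \<sigma> n < g x})"
              using \<sigma>(3) by (intro incseq_SucI) (auto intro: le_less_trans)
          qed auto
          also have "(\<Union>n. {x\<in>space M. f x \<in> A \<and> \<sigma> n < g x}) = {x\<in>space M. f x \<in> A \<and> a < g x}"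
            using \<sigma>(2,4) by (auto intro: less_trans)
          finally show ?thesis by (simp add: T_def)
        qed
        have AK[measurable]: "(\<lambda>t. indicator A t * (SUP n. K (\<sigma> n) t)) \<in> borel_measurable borel" by measurable
        have "(\<integral>\<^sup>+x. indicator A (q x) * G (q x) \<partial>?I) = (\<integral>\<^sup>+x. indicator A (q x) * (SUP n. K (\<sigma> n) (q x)) \<partial>?I)"
        proof (rule nn_integral_cong_AE)
          have "AE x in ?I. G (q x) = (SUP n. K (\<sigma> n) (q x))"
            using G_ae unfolding q_distr[symmetric] by (rule AE_distrD[OF q])
          then show "AE x in ?I. indicator A (q x) * G (q x) = indicator A (q x) * (SUP n. K (\<sigma> n) (q x))"
            by eventually_elim simp
        qed
        also have "\<dots> = (\<integral>\<^sup>+t. indicator A t * (SUP n. K (\<sigma> n) t) \<partial>\<nu>)"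
          unfolding q_distr[symmetric] by (rule nn_integral_distr[OF q, symmetric]) simp
        also have "\<dots> = (\<integral>\<^sup>+t. (SUP n. K (\<sigma> n) t * indicator A t) \<partial>\<nu>)"
          by (intro nn_integral_cong) (auto simp: indicator_def)
        also have "\<dots> = (SUP n. (\<integral>\<^sup>+t\<in>A. K (\<sigma> n) t \<partial>\<nu>))"
          by (rule nn_integral_monotone_convergence_SUP_AE[of "\<lambda>n t. K (\<sigma> n) t * indicator A t", OF K_inc])
             (unfold measurable_cong_sets[OF \<nu>_sets refl], measurable)
        also have "\<dots> = T A a" by (simp add: K A T_SUP)
        finally show ?thesis .
      qed
    qed
    finally show ?thesis .
  qed
  have "distr (?I \<Otimes>\<^sub>M ?I) (borel \<Otimes>\<^sub>M borel) ?\<phi> = distr M (borel \<Otimes>\<^sub>M borel) (\<lambda>x. (f x, g x))"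
  proof (rule real_pair_measure_eqI)
    show "finite_measure (distr (?I \<Otimes>\<^sub>M ?I) (borel \<Otimes>\<^sub>M borel) ?\<phi>)"
      using II.prob_space_distr[OF \<phi>] by (rule prob_space.axioms(1))
    show "finite_measure (distr M (borel \<Otimes>\<^sub>M borel) (\<lambda>x. (f x, g x)))"
      by (rule prob_space.axioms(1), rule prob_space_distr) measurable
    fix A :: "real set" and a :: real assume A[measurable]: "A \<in> sets borel"
    have "emeasure (distr (?I \<Otimes>\<^sub>M ?I) (borel \<Otimes>\<^sub>M borel) ?\<phi>) (A \<times> {a<..}) = T A a"
      unfolding key[OF A, symmetric] by (subst emeasure_distr[OF \<phi>]) (auto intro!: arg_cong2[where f = emeasure])
    also have "\<dots> = emeasure (distr M (borel \<Otimes>\<^sub>M borel) (\<lambda>x. (f x, g x))) (A \<times> {a<..})"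
      unfolding T_def by (subst emeasure_distr) (auto intro!: arg_cong2[where f = emeasure])
    finally show "emeasure (distr (?I \<Otimes>\<^sub>M ?I) (borel \<Otimes>\<^sub>M borel) ?\<phi>) (A \<times> {a<..}) =
      emeasure (distr M (borel \<Otimes>\<^sub>M borel) (\<lambda>x. (f x, g x))) (A \<times> {a<..})" .
  qed simp_all
  with q_mono q \<rho> r01 show thesis by (intro that[of q \<rho>]) (simp_all add: \<rho>_def)
qed

section \<open>The kernel on the unit square\<close>

lemma measurable_clamp_unit_interval [measurable]: "(\<lambda>t. max 0 (min 1 t)) \<in> measurable borel unit_interval_space"
  unfolding measurable_cong_sets[OF refl sets_unit_interval_cong]
  by (rule measurable_restrict_space2) auto

text \<open>The auxiliary kernel V on pairs (rank, point) is w cut off unless the rank strictly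
  increases. Pulled back along \<open>\<phi> = (q, \<rho>)\<close> it respects the order of first
  coordinates since q is monotone; its densities are those of w since \<phi> has the law of (f x, x)
  and the cut-off removes only a null part of w.\<close>

lemma unit_square_kernel:
  fixes w :: "real \<times> real \<Rightarrow> real"
  assumes w[measurable]: "w \<in> borel_measurable (unit_interval_space \<Otimes>\<^sub>M unit_interval_space)"
    and w01: "\<And>z. 0 \<le> w z \<and> w z \<le> 1"
    and strict: "strict_kernel unit_interval_space (\<lambda>x y. 0 < w (x, y)) (\<lambda>x y. w (x, y))"
  obtains W where "is_kernel unit_square_space (\<lambda>a b. fst a < fst b) W"
    "\<And>Q. valid_poset Q \<Longrightarrow> kernel_dens unit_square_space W Q = kernel_dens unit_interval_space (\<lambda>x y. w (x, y)) Q"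
proof -
  let ?I = unit_interval_space and ?S = unit_square_space
  interpret prob_space ?I by (rule prob_space_unit_interval)
  interpret II: pair_prob_space ?I ?I ..
  interpret S: prob_space ?S unfolding unit_square_eq_pair by (rule II.prob_space_axioms)
  have space_S: "space ?S = {0..1} \<times> {0..1}"
    by (simp add: unit_square_eq_pair space_pair_measure)
  have irrefl: "\<not> 0 < w (x, x)" if "x \<in> space ?I" for x
    using strict that unfolding strict_kernel_def is_kernel_def ordered_prob_space_def by blast
  have one: "w (x, z) = 1" if "x \<in> space ?I" "y \<in> space ?I" "z \<in> space ?I" "0 < w (x, y)" "0 < w (y, z)" for x y z
    using strict that unfolding strict_kernel_def is_kernel_def by blast
  have trans: "0 < w (x, z)" if "x \<in> space ?I" "y \<in> space ?I" "z \<in> space ?I" "0 < w (x, y)" "0 < w (y, z)" for x y z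
    using one[OF that] by simp
  define f where "f x = measure ?I {z\<in>space ?I. 0 < w (z, x)}" for x
  have asym: "\<not> 0 < w (y, x)" if "x \<in> space ?I" "y \<in> space ?I" "0 < w (x, y)" for x y
    using trans[of x y x] irrefl[of x] that by blast
  have lt: "Measurable.pred (?I \<Otimes>\<^sub>M ?I) (\<lambda>z. 0 < w z)" by measurable
  have f[measurable]: "f \<in> borel_measurable ?I"
    unfolding f_def[abs_def] by (rule rank_less_AE(1)[where lt = "\<lambda>z. 0 < w z"]) (fact lt asym trans)+
  have f_less: "AE z in ?I \<Otimes>\<^sub>M ?I. 0 < w z \<longrightarrow> f (fst z) < f (snd z)"
    unfolding f_def[abs_def] by (rule rank_less_AE(2)[where lt = "\<lambda>z. 0 < w z"]) (fact lt asym trans)+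
  have f01: "0 \<le> f x \<and> f x \<le> 1" for x by (simp add: f_def)
  have space_I: "0 \<le> x \<and> x \<le> 1" if "x \<in> space ?I" for x using that by simp
  obtain q \<rho> where q_mono: "mono_on {0..1} q" and q[measurable]: "q \<in> borel_measurable ?I"
    and \<rho>[measurable]: "\<rho> \<in> borel_measurable (?I \<Otimes>\<^sub>M ?I)"
    and joint: "distr (?I \<Otimes>\<^sub>M ?I) (borel \<Otimes>\<^sub>M borel) (\<lambda>z. (q (fst z), \<rho> z)) = distr ?I (borel \<Otimes>\<^sub>M borel) (\<lambda>x. (f x, x))"
    by (rule joint_quantile[OF prob_space_axioms f measurable_unit_interval_borel f01 space_I]) (assumption, rule that)
  define \<phi> where "\<phi> z = (q (fst z), \<rho> z)" for z
  have \<phi>[measurable]: "\<phi> \<in> measurable ?S (borel \<Otimes>\<^sub>M borel)"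
    unfolding \<phi>_def[abs_def] unit_square_eq_pair by measurable
  \<comment> \<open>V has to be defined on the whole plane, whereas the kernel properties of w are
    known on [0, 1] only. The clamp makes them hold for all arguments and changes nothing on the
    unit interval.\<close>
  define cl where "cl t = max 0 (min 1 t)" for t :: real
  have cl[measurable]: "cl \<in> measurable borel ?I"
    unfolding cl_def[abs_def] by measurable
  have cl_space: "cl t \<in> space ?I" for t by (simp add: cl_def)
  define V :: "real \<times> real \<Rightarrow> real \<times> real \<Rightarrow> real"
    where "V a b = of_bool (fst a < fst b) * w (cl (snd a), cl (snd b))" for a b
  have V[measurable]: "case_prod V \<in> borel_measurable ((borel \<Otimes>\<^sub>M borel) \<Otimes>\<^sub>M (borel \<Otimes>\<^sub>M borel))"
    unfolding V_def by measurable
  have V01: "0 \<le> V a b \<and> V a b \<le> 1" for a b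
    using w01 by (auto simp: V_def)
  have V_pos: "0 < V a b \<longleftrightarrow> fst a < fst b \<and> 0 < w (cl (snd a), cl (snd b))" for a b
    by (auto simp: V_def)
  define W where "W a b = V (\<phi> a) (\<phi> b)" for a b
  have "is_kernel ?S (\<lambda>a b. fst a < fst b) W"
    unfolding is_kernel_def
  proof (intro conjI)
    have S1: "(\<lambda>z. fst z) \<in> borel_measurable ?S"
      unfolding unit_square_eq_pair by (rule measurable_compose[OF measurable_fst measurable_unit_interval_borel])
    have [measurable]: "(\<lambda>z. fst (fst z)) \<in> borel_measurable (?S \<Otimes>\<^sub>M ?S)" "(\<lambda>z. fst (snd z)) \<in> borel_measurable (?S \<Otimes>\<^sub>M ?S)"
      by (rule measurable_compose[OF measurable_fst S1], rule measurable_compose[OF measurable_snd S1])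
    have "{(x, y) \<in> space ?S \<times> space ?S. fst x < fst y} = {z \<in> space (?S \<Otimes>\<^sub>M ?S). fst (fst z) < fst (snd z)}"
      by (auto simp: space_pair_measure)
    also have "\<dots> \<in> sets (?S \<Otimes>\<^sub>M ?S)" by measurable
    finally show "ordered_prob_space ?S (\<lambda>a b. fst a < fst b)"
      unfolding ordered_prob_space_def using S.prob_space_axioms by auto
    show "(\<lambda>(x, y). W x y) \<in> borel_measurable (?S \<Otimes>\<^sub>M ?S)"
      unfolding W_def by measurable
    show "\<forall>x\<in>space ?S. \<forall>y\<in>space ?S. 0 \<le> W x y \<and> W x y \<le> 1"
      using V01 by (simp add: W_def)
    show "\<forall>x\<in>space ?S. \<forall>y\<in>space ?S. 0 < W x y \<longrightarrow> fst x < fst y"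
    proof (intro ballI impI, rule ccontr)
      fix x y assume "x \<in> space ?S" "y \<in> space ?S" "0 < W x y" "\<not> fst x < fst y"
      \<comment> \<open>Weak monotonicity suffices: strictly increasing values of q force strictly
        increasing arguments.\<close>
      moreover from this have "q (fst y) \<le> q (fst x)"
        by (intro mono_onD[OF q_mono]) (auto simp: space_S)
      ultimately show False by (simp add: W_def V_pos \<phi>_def)
    qed
    show "\<forall>x\<in>space ?S. \<forall>y\<in>space ?S. \<forall>z\<in>space ?S. 0 < W x y \<longrightarrow> 0 < W y z \<longrightarrow> W x z = 1"
    proof (intro ballI impI)
      fix x y z assume "0 < W x y" "0 < W y z"
      then have xy: "fst (\<phi> x) < fst (\<phi> y)" "0 < w (cl (snd (\<phi> x)), cl (snd (\<phi> y)))"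
        and yz: "fst (\<phi> y) < fst (\<phi> z)" "0 < w (cl (snd (\<phi> y)), cl (snd (\<phi> z)))"
        unfolding W_def V_pos by blast+
      have "w (cl (snd (\<phi> x)), cl (snd (\<phi> z))) = 1"
        by (rule one[OF cl_space cl_space cl_space xy(2) yz(2)])
      then show "W x z = 1" using xy(1) yz(1) by (simp add: W_def V_def)
    qed
  qed
  moreover have "kernel_dens ?S W Q = kernel_dens ?I (\<lambda>x y. w (x, y)) Q" if Q: "valid_poset Q" for Q
  proof -
    obtain n R where QR: "Q = (n, R)" by (cases Q)
    have R: "R \<subseteq> {0..<n} \<times> {0..<n}" "irrefl R" using Q QR by (auto simp: valid_poset_def)
    have fx[measurable]: "(\<lambda>x. (f x, x)) \<in> measurable ?I (borel \<Otimes>\<^sub>M borel)"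
      by (intro measurable_Pair f measurable_unit_interval_borel)
    have "kernel_dens ?S W (n, R) = kernel_dens (distr ?S (borel \<Otimes>\<^sub>M borel) \<phi>) V (n, R)"
      unfolding W_def by (rule S.kernel_dens_distr[OF \<phi> V R(1), symmetric])
    also have "distr ?S (borel \<Otimes>\<^sub>M borel) \<phi> = distr ?I (borel \<Otimes>\<^sub>M borel) (\<lambda>x. (f x, x))"
      unfolding unit_square_eq_pair \<phi>_def[abs_def] by (rule joint)
    also have "kernel_dens \<dots> V (n, R) = kernel_dens ?I (\<lambda>x y. V (f x, x) (f y, y)) (n, R)"
      by (rule kernel_dens_distr[OF fx V R(1)])
    also have "\<dots> = kernel_dens ?I (\<lambda>x y. (\<lambda>z. V (f (fst z), fst z) (f (snd z), snd z)) (x, y)) (n, R)"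
      by simp
    also have "\<dots> = kernel_dens ?I (\<lambda>x y. w (x, y)) (n, R)"
    proof (rule kernel_dens_cong_AE[OF R])
      have "(\<lambda>z. case_prod V ((f (fst z), fst z), (f (snd z), snd z))) \<in> borel_measurable (?I \<Otimes>\<^sub>M ?I)"
        by (rule measurable_compose[OF _ V])
           (intro measurable_Pair measurable_compose[OF measurable_fst f] measurable_compose[OF measurable_snd f]
             measurable_compose[OF measurable_fst measurable_unit_interval_borel]
             measurable_compose[OF measurable_snd measurable_unit_interval_borel])
      then show "(\<lambda>z. V (f (fst z), fst z) (f (snd z), snd z)) \<in> borel_measurable (?I \<Otimes>\<^sub>M ?I)" by simp
      \<comment> \<open>Almost everywhere on w > 0 the rank strictly increases, so the cut-off
        factor is 1 there.\<close>
      show "AE z in ?I \<Otimes>\<^sub>M ?I. V (f (fst z), fst z) (f (snd z), snd z) = w z"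
        using f_less AE_space
      proof eventually_elim
        case (elim z)
        then have "cl (fst z) = fst z" "cl (snd z) = snd z" by (auto simp: space_pair_measure cl_def)
        then show ?case using elim(1) w01[of z] by (cases "0 < w z") (auto simp: V_def)
      qed
    qed (use V01 w01 w in auto)
    finally show ?thesis using QR by simp
  qed
  ultimately show thesis using that by blast
qed

theorem theorem1p9:
  fixes p :: "(pcode \<Rightarrow> real) \<times> real"
  assumes "p \<in> Pinf"
  shows "(\<exists>(M :: real measure) lt W. strict_kernel M lt W \<and> represents M W p)
       \<and> (\<exists>lt W. is_kernel unit_interval_space lt W \<and> represents unit_interval_space W p)
       \<and> (\<exists>W. is_kernel unit_square_space (\<lambda>a b. fst a < fst b) W
                \<and> represents unit_square_space W p)"
proof -
  have "p \<in> Pbar" using assms by (simp add: Pinf_def)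
  then obtain w where w: "w \<in> borel_measurable (unit_interval_space \<Otimes>\<^sub>M unit_interval_space)"
    "\<And>z. 0 \<le> w z \<and> w z \<le> 1"
    and strict: "strict_kernel unit_interval_space (\<lambda>x y. 0 < w (x, y)) (\<lambda>x y. w (x, y))"
    and rep: "represents unit_interval_space (\<lambda>x y. w (x, y)) p"
    using strict_kernel_representation by blast
  obtain W where "is_kernel unit_square_space (\<lambda>a b. fst a < fst b) W"
    "\<And>Q. valid_poset Q \<Longrightarrow> kernel_dens unit_square_space W Q = kernel_dens unit_interval_space (\<lambda>x y. w (x, y)) Q"
    using unit_square_kernel[OF w strict] by blast
  then have "\<exists>W. is_kernel unit_square_space (\<lambda>a b. fst a < fst b) W \<and> represents unit_square_space W p"
    using rep by (auto simp: represents_def)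
  moreover have "is_kernel unit_interval_space (\<lambda>x y. 0 < w (x, y)) (\<lambda>x y. w (x, y))"
    using strict by (simp add: strict_kernel_def)
  ultimately show ?thesis using strict rep by blast
qed

end
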